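(* Let $q\ge2$ be an integer, let $(X,T)$ be a $\mathbb{Z}^q$-t.d.s. with metric $d$, let $\mu\in M(X,T)$, and let $\vec{v}=(1,\beta_2,\ldots,\beta_q)\in\mathbb{R}^q$ be a direction vector. Then the following statements are all equivalent, where in each of (1), (2), (4), (5) both the version "for some $\mathbf{b}\in\mathbb{R}^{q-1}_+$" and the version "for any (i.e. every) $\mathbf{b}\in\mathbb{R}^{q-1}_+$" are included among the equivalent statements: (1) $\mu$ has bounded complexity with respect to $\{\hat{d}_k^{\vec{v},\mathbf{b}}\}_{k=1}^\infty$ for some $\mathbf{b}\in\mathbb{R}^{q-1}_+$ (or for any $\mathbf{b}\in\mathbb{R}^{q-1}_+$); (2) $\mu$ has bounded complexity with respect to $\{\bar{d}_k^{\vec{v},\mathbf{b}}\}_{k=1}^\infty$ for some $\mathbf{b}\in\mathbb{R}^{q-1}_+$ (or for any $\mathbf{b}\in\mathbb{R}^{q-1}_+$); (3) $\mu$ has $\vec{v}$-discrete spectrum; (4) $T$ is $(\mu,\vec{v},\mathbf{b})$-equicontinuous in the mean for some $\mathbf{b}\in\mathbb{R}^{q-1}_+$ (or for any $\mathbf{b}\in\mathbb{R}^{q-1}_+$); (5) $T$ is $(\mu,\vec{v},\mathbf{b})$-mean equicontinuous for some $\mathbf{b}\in\mathbb{R}^{q-1}_+$ (or for any $\mathbf{b}\in\mathbb{R}^{q-1}_+$).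
   Context: A $\mathbb{Z}^q$-t.d.s. $(X,T)$ is a compact metric space $(X,d)$ with a group homomorphism $\vec{w}\mapsto T^{\vec{w}}$ from $\mathbb{Z}^q$ to the group of homeomorphisms of $X$. $\mathcal{B}_X$ is the Borel $\sigma$-algebra, and $M(X,T)$ is the set of Borel probability measures $\mu$ on $X$ with $\mu(T^{-\vec{w}}A)=\mu(A)$ for all $\vec{w}\in\mathbb{Z}^q$, $A\in\mathcal{B}_X$. $\mathbb{R}^{q-1}_+$ is the set of vectors in $\mathbb{R}^{q-1}$ with all coordinates $>0$. For $\mathbf{b}=(b_2,\ldots,b_q)\in\mathbb{R}^{q-1}_+$ let $$\Lambda^{\vec{v}}(\mathbf{b})=\{(m_1,\ldots,m_q)\in\mathbb{Z}^q:\beta_im_1-b_i\le m_i\le\beta_im_1+b_i,\ i=2,\ldots,q\}$$ and, for $k\in\mathbb{N}=\{1,2,\dots\}$, $\Lambda_k^{\vec{v}}(\mathbf{b})=\Lambda^{\vec{v}}(\mathbf{b})\cap(\{0,1,\dots,k-1\}\times\mathbb{Z}^{q-1})$. For $x,y\in X$ define $$\bar{d}_k^{\vec{v},\mathbf{b}}(x,y)=\frac{1}{\#(\Lambda_k^{\vec{v}}(\mathbf{b}))}\sum_{\vec{w}\in\Lambda_k^{\vec{v}}(\mathbf{b})}d(T^{\vec{w}}x,T^{\vec{w}}y),\qquad \hat{d}_k^{\vec{v},\mathbf{b}}(x,y)=\max_{1\le i\le k}\bar{d}_i^{\vec{v},\mathbf{b}}(x,y).$$ For a sequence $\{\rho_k\}$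 of metrics on $X$ write $B_{\rho_k}(x,\epsilon)=\{y\in X:\rho_k(x,y)<\epsilon\}$. $\mu$ has bounded complexity with respect to $\{\rho_k\}$ if for every $\epsilon>0$ there is a positive integer $C=C(\epsilon)$ such that for every $k\in\mathbb{N}$ there is a finite $F\subset X$ with $\#(F)\le C$ and $\mu\big(\bigcup_{x\in F}B_{\rho_k}(x,\epsilon)\big)>1-\epsilon$. For $\vec{w}\in\mathbb{Z}^q$ let $U_T^{\vec{w}}f=f\circ T^{\vec{w}}$ on $L^2(X,\mathcal{B}_X,\mu)$. The $\vec{v}$-directional Kronecker algebra is $$\mathcal{K}_\mu^{\vec{v}}(\mathbf{b})=\Big\{B\in\mathcal{B}_X:\overline{\{U_T^{\vec{w}}1_B:\vec{w}\in\Lambda^{\vec{v}}(\mathbf{b})\}}\text{ is compact in }L^2(X,\mathcal{B}_X,\mu)\Big\}.$$ It does not depend on $\mathbf{b}\in\mathbb{R}^{q-1}_+$, so it is written $\mathcal{K}_\mu^{\vec{v}}$. $\mu$ has $\vec{v}$-discrete spectrum if $\mathcal{K}_\mu^{\vec{v}}=\mathcal{B}_X$. A subset $K\subset X$ is $(\vec{v},\mathbf{b})$-equicontinuous in the mean if for every $\epsilon>0$ there is $\delta>0$ such that $\hat{d}_k^{\vec{v},\mathbf{b}}(x,y)<\epsilon$ for all $k\in\mathbb{N}$ and all $x,y\in K$ with $d(x,y)<\delta$. It is $(\vec{v},\mathbf{b})$-mean equicontinuous if for every $\epsilon>0$ there is $\delta>0$ such that $\limsup_{k\to\infty}\bar{d}_k^{\vec{v},\mathbf{b}}(x,y)<\epsilon$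 for all $x,y\in K$ with $d(x,y)<\delta$. $T$ is $(\mu,\vec{v},\mathbf{b})$-equicontinuous in the mean (resp. $(\mu,\vec{v},\mathbf{b})$-mean equicontinuous) if for every $\tau>0$ there is a Borel measurable $K\subset X$ with $\mu(K)>1-\tau$ that is $(\vec{v},\mathbf{b})$-equicontinuous in the mean (resp. $(\vec{v},\mathbf{b})$-mean equicontinuous). *)

theory Defs
  imports "HOL-Probability.Probability"
begin

section \<open>Actions of the integer lattice and invariant measures\<close>

text \<open>
  The group \<open>\<int>\<^sup>q\<close> and the space \<open>\<real>\<^sup>q\<close>, \<open>q \<ge> 2\<close>, are split as \<open>\<int> \<times> \<int>\<^sup>q\<^sup>-\<^sup>1\<close> and \<open>\<real> \<times> \<real>\<^sup>q\<^sup>-\<^sup>1\<close>,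
  because the first coordinate plays a special role throughout. The finite index type \<open>'n\<close> stands
  for the coordinates \<open>2, \<dots>, q\<close>; thus \<open>q = CARD('n) + 1\<close>, and \<open>q \<ge> 2\<close> since types are nonempty.
  The compact metric space is the universe of a type \<open>'a\<close> of class \<open>metric_space\<close>, with metric
  \<open>dist\<close>.
\<close>

type_synonym 'n lattice = "int \<times> (int ^ 'n)"

definition is_tds :: "('n::finite lattice \<Rightarrow> 'a::metric_space \<Rightarrow> 'a) \<Rightarrow> bool" where
  "is_tds T \<longleftrightarrow>
     compact (UNIV :: 'a set) \<and>
     (\<forall>w. \<exists>g. homeomorphism UNIV UNIV (T w) g) \<and>
     (\<forall>u w. T (u + w) = T u \<circ> T w)"

definition invariant_measures :: "('n::finite lattice \<Rightarrow> 'a::metric_space \<Rightarrow> 'a) \<Rightarrow> 'a measure set" where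
  "invariant_measures T =
     {\<mu>. prob_space \<mu> \<and> sets \<mu> = sets borel \<and>
         (\<forall>w. \<forall>A\<in>sets borel. measure \<mu> (T (- w) ` A) = measure \<mu> A)}"


section \<open>Directional strips and mean metrics\<close>

definition pos_vectors :: "(real ^ 'n) set" where
  "pos_vectors = {b. \<forall>i. 0 < b $ i}"

text \<open>A direction \<open>v\<close> always has first coordinate \<open>1\<close>, so its slopes \<open>\<beta>\<^sub>i\<close> are \<open>snd v $ i\<close>.\<close>

definition strip :: "real \<times> (real ^ 'n) \<Rightarrow> real ^ 'n \<Rightarrow> 'n::finite lattice set" where
  "strip v b =
     {m. \<forall>i. snd v $ i * real_of_int (fst m) - b $ i \<le> real_of_int (snd m $ i) \<and>
             real_of_int (snd m $ i) \<le> snd v $ i * real_of_int (fst m) + b $ i}"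

definition strip_upto :: "real \<times> (real ^ 'n) \<Rightarrow> real ^ 'n \<Rightarrow> nat \<Rightarrow> 'n::finite lattice set" where
  "strip_upto v b k = strip v b \<inter> ({0..<int k} \<times> UNIV)"

definition mean_dist ::
    "('n::finite lattice \<Rightarrow> 'a::metric_space \<Rightarrow> 'a) \<Rightarrow> real \<times> (real ^ 'n) \<Rightarrow> real ^ 'n \<Rightarrow> nat \<Rightarrow> 'a \<Rightarrow> 'a \<Rightarrow> real" where
  "mean_dist T v b k x y =
     (\<Sum>w\<in>strip_upto v b k. dist (T w x) (T w y)) / real (card (strip_upto v b k))"

definition max_mean_dist ::
    "('n::finite lattice \<Rightarrow> 'a::metric_space \<Rightarrow> 'a) \<Rightarrow> real \<times> (real ^ 'n) \<Rightarrow> real ^ 'n \<Rightarrow> nat \<Rightarrow> 'a \<Rightarrow> 'a \<Rightarrow> real" where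
  "max_mean_dist T v b k x y = Max ((\<lambda>i. mean_dist T v b i x y) ` {1..k})"

lemma finite_vec_PiE:
  fixes D :: "'n::finite \<Rightarrow> int set"
  assumes "\<And>i. finite (D i)"
  shows "finite {s :: int ^ 'n. \<forall>i. s $ i \<in> D i}"
proof -
  have "{s :: int ^ 'n. \<forall>i. s $ i \<in> D i} \<subseteq> vec_lambda ` (PiE UNIV D)"
  proof
    fix s :: "int ^ 'n" assume "s \<in> {s. \<forall>i. s $ i \<in> D i}"
    then have "vec_nth s \<in> PiE UNIV D" by auto
    then have "vec_lambda (vec_nth s) \<in> vec_lambda ` PiE UNIV D" by blast
    then show "s \<in> vec_lambda ` PiE UNIV D" by simp
  qed
  moreover have "finite (PiE (UNIV :: 'n set) D)"
    using assms by (intro finite_PiE) auto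
  ultimately show ?thesis by (meson finite_imageI finite_subset)
qed

lemma finite_strip_upto: "finite (strip_upto v b k)"
proof -
  have "strip_upto v b k \<subseteq>
      (\<Union>p\<in>{0..<int k}. {p} \<times> {s. \<forall>i. s $ i \<in>
         {\<lfloor>snd v $ i * real_of_int p - b $ i\<rfloor>..\<lceil>snd v $ i * real_of_int p + b $ i\<rceil>}})"
  proof
    fix m assume "m \<in> strip_upto v b k"
    then have m: "fst m \<in> {0..<int k}"
      and *: "snd v $ i * real_of_int (fst m) - b $ i \<le> real_of_int (snd m $ i)"
        "real_of_int (snd m $ i) \<le> snd v $ i * real_of_int (fst m) + b $ i" for i
      by (auto simp: strip_upto_def strip_def)
    have "snd m $ i \<in> {\<lfloor>snd v $ i * real_of_int (fst m) - b $ i\<rfloor>..\<lceil>snd v $ i * real_of_int (fst m) + b $ i\<rceil>}" for i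
      unfolding atLeastAtMost_iff using *[of i] by linarith
    then show "m \<in> (\<Union>p\<in>{0..<int k}. {p} \<times> {s. \<forall>i. s $ i \<in>
         {\<lfloor>snd v $ i * real_of_int p - b $ i\<rfloor>..\<lceil>snd v $ i * real_of_int p + b $ i\<rceil>}})"
      using m by (intro UN_I[of "fst m"]) (simp_all add: mem_Times_iff)
  qed
  moreover have "finite \<dots>"
    by (intro finite_UN_I finite_cartesian_product finite_vec_PiE) auto
  ultimately show ?thesis by (rule finite_subset)
qed

lemma zero_in_strip_upto:
  assumes "b \<in> pos_vectors" "k \<ge> 1"
  shows "0 \<in> strip_upto v b k"
  using assms by (auto simp: strip_upto_def strip_def pos_vectors_def less_imp_le zero_prod_def)


section \<open>Bounded complexity and measure-theoretic equicontinuity\<close>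

definition bounded_complexity :: "'a::metric_space measure \<Rightarrow> (nat \<Rightarrow> 'a \<Rightarrow> 'a \<Rightarrow> real) \<Rightarrow> bool" where
  "bounded_complexity \<mu> \<rho> \<longleftrightarrow>
     (\<forall>\<epsilon>>0. \<exists>C::nat. C > 0 \<and>
        (\<forall>k\<ge>1. \<exists>F. finite F \<and> card F \<le> C \<and>
           measure \<mu> (\<Union>x\<in>F. {y. \<rho> k x y < \<epsilon>}) > 1 - \<epsilon>))"

definition equicontinuous_in_the_mean_on ::
    "('n::finite lattice \<Rightarrow> 'a::metric_space \<Rightarrow> 'a) \<Rightarrow> real \<times> (real ^ 'n) \<Rightarrow> real ^ 'n \<Rightarrow> 'a set \<Rightarrow> bool" where
  "equicontinuous_in_the_mean_on T v b K \<longleftrightarrow>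
     (\<forall>\<epsilon>>0. \<exists>\<delta>>0. \<forall>k\<ge>1. \<forall>x\<in>K. \<forall>y\<in>K. dist x y < \<delta> \<longrightarrow> max_mean_dist T v b k x y < \<epsilon>)"

definition mean_equicontinuous_on ::
    "('n::finite lattice \<Rightarrow> 'a::metric_space \<Rightarrow> 'a) \<Rightarrow> real \<times> (real ^ 'n) \<Rightarrow> real ^ 'n \<Rightarrow> 'a set \<Rightarrow> bool" where
  "mean_equicontinuous_on T v b K \<longleftrightarrow>
     (\<forall>\<epsilon>>0. \<exists>\<delta>>0. \<forall>x\<in>K. \<forall>y\<in>K. dist x y < \<delta> \<longrightarrow>
        limsup (\<lambda>k. ereal (mean_dist T v b k x y)) < ereal \<epsilon>)"

definition measure_equicontinuous_in_the_mean ::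
    "'a::metric_space measure \<Rightarrow> ('n::finite lattice \<Rightarrow> 'a \<Rightarrow> 'a) \<Rightarrow> real \<times> (real ^ 'n) \<Rightarrow> real ^ 'n \<Rightarrow> bool" where
  "measure_equicontinuous_in_the_mean \<mu> T v b \<longleftrightarrow>
     (\<forall>\<tau>>0. \<exists>K\<in>sets borel. measure \<mu> K > 1 - \<tau> \<and> equicontinuous_in_the_mean_on T v b K)"

definition measure_mean_equicontinuous ::
    "'a::metric_space measure \<Rightarrow> ('n::finite lattice \<Rightarrow> 'a \<Rightarrow> 'a) \<Rightarrow> real \<times> (real ^ 'n) \<Rightarrow> real ^ 'n \<Rightarrow> bool" where
  "measure_mean_equicontinuous \<mu> T v b \<longleftrightarrow>
     (\<forall>\<tau>>0. \<exists>K\<in>sets borel. measure \<mu> K > 1 - \<tau> \<and> mean_equicontinuous_on T v b K)"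


section \<open>The space of square-integrable functions\<close>

text \<open>
  Elements of \<open>L\<^sup>2(\<mu>)\<close> are classes of square-integrable complex functions modulo equality almost
  everywhere. Operations on classes go through a chosen representative; the lemmas below show
  that the choice does not matter.
\<close>

definition sq_integrable :: "'a measure \<Rightarrow> ('a \<Rightarrow> complex) set" where
  "sq_integrable \<mu> = {f \<in> borel_measurable \<mu>. integrable \<mu> (\<lambda>x. (cmod (f x))\<^sup>2)}"

definition L2_class :: "'a measure \<Rightarrow> ('a \<Rightarrow> complex) \<Rightarrow> ('a \<Rightarrow> complex) set" where
  "L2_class \<mu> f = {g \<in> sq_integrable \<mu>. AE x in \<mu>. g x = f x}"

definition L2_space :: "'a measure \<Rightarrow> ('a \<Rightarrow> complex) set set" where
  "L2_space \<mu> = L2_class \<mu> ` sq_integrable \<mu>"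

definition L2_rep :: "('a \<Rightarrow> complex) set \<Rightarrow> 'a \<Rightarrow> complex" where
  "L2_rep F = (SOME f. f \<in> F)"

definition L2_dist :: "'a measure \<Rightarrow> ('a \<Rightarrow> complex) set \<Rightarrow> ('a \<Rightarrow> complex) set \<Rightarrow> real" where
  "L2_dist \<mu> F G = sqrt (LINT x|\<mu>. (cmod (L2_rep F x - L2_rep G x))\<^sup>2)"

definition L2_topology :: "'a measure \<Rightarrow> ('a \<Rightarrow> complex) set topology" where
  "L2_topology \<mu> = Metric_space.mtopology (L2_space \<mu>) (L2_dist \<mu>)"

lemma L2_rep_in: "F \<in> L2_space \<mu> \<Longrightarrow> L2_rep F \<in> F"
  unfolding L2_rep_def some_in_eq by (auto simp: L2_space_def L2_class_def)

lemma L2_rep_sq_integrable: "F \<in> L2_space \<mu> \<Longrightarrow> L2_rep F \<in> sq_integrable \<mu>"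
  using L2_rep_in[of F \<mu>] unfolding L2_space_def L2_class_def by blast

lemma L2_class_in: "f \<in> sq_integrable \<mu> \<Longrightarrow> L2_class \<mu> f \<in> L2_space \<mu>"
  unfolding L2_space_def by blast

lemma L2_rep_class:
  assumes "f \<in> sq_integrable \<mu>"
  shows "AE x in \<mu>. L2_rep (L2_class \<mu> f) x = f x"
  using L2_rep_in[OF L2_class_in[OF assms]] unfolding L2_class_def by auto

lemma L2_class_eqI:
  assumes "AE x in \<mu>. f x = g x"
  shows "L2_class \<mu> f = L2_class \<mu> g"
proof -
  have "(AE x in \<mu>. h x = f x) \<longleftrightarrow> (AE x in \<mu>. h x = g x)" for h
    using assms by (auto elim!: eventually_elim2)
  then show ?thesis unfolding L2_class_def by simp
qed

lemma L2_class_rep: "F \<in> L2_space \<mu> \<Longrightarrow> L2_class \<mu> (L2_rep F) = F"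
  using L2_class_eqI[OF L2_rep_class] unfolding L2_space_def by blast

lemma sq_integrable_diff:
  assumes "f \<in> sq_integrable \<mu>" "g \<in> sq_integrable \<mu>"
  shows "(\<lambda>x. f x - g x) \<in> sq_integrable \<mu>"
proof -
  have m[measurable]: "f \<in> borel_measurable \<mu>" "g \<in> borel_measurable \<mu>"
    and i: "integrable \<mu> (\<lambda>x. (cmod (f x))\<^sup>2)" "integrable \<mu> (\<lambda>x. (cmod (g x))\<^sup>2)"
    using assms by (auto simp: sq_integrable_def)
  have bd: "(cmod (a - b))\<^sup>2 \<le> 2 * (cmod a)\<^sup>2 + 2 * (cmod b)\<^sup>2" for a b :: complex
  proof -
    have "(cmod (a - b))\<^sup>2 \<le> (cmod a + cmod b)\<^sup>2"
      by (intro power_mono norm_triangle_ineq4) auto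
    also have "\<dots> \<le> 2 * (cmod a)\<^sup>2 + 2 * (cmod b)\<^sup>2"
      using sum_squares_bound[of "cmod a" "cmod b"] by (simp add: power2_sum)
    finally show ?thesis .
  qed
  have "integrable \<mu> (\<lambda>x. (cmod (f x - g x))\<^sup>2)"
  proof (rule Bochner_Integration.integrable_bound)
    show "integrable \<mu> (\<lambda>x. 2 * (cmod (f x))\<^sup>2 + 2 * (cmod (g x))\<^sup>2)" using i by simp
    show "AE x in \<mu>. norm ((cmod (f x - g x))\<^sup>2) \<le> norm (2 * (cmod (f x))\<^sup>2 + 2 * (cmod (g x))\<^sup>2)"
      by (intro AE_I2) (simp add: bd)
  qed measurable
  then show ?thesis by (simp add: sq_integrable_def)
qed

lemma L2_dist_class:
  assumes "f \<in> sq_integrable \<mu>" "g \<in> sq_integrable \<mu>"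
  shows "L2_dist \<mu> (L2_class \<mu> f) (L2_class \<mu> g) = sqrt (LINT x|\<mu>. (cmod (f x - g x))\<^sup>2)"
proof -
  have [measurable]: "f \<in> borel_measurable \<mu>" "g \<in> borel_measurable \<mu>"
      "L2_rep (L2_class \<mu> f) \<in> borel_measurable \<mu>" "L2_rep (L2_class \<mu> g) \<in> borel_measurable \<mu>"
    using assms L2_rep_sq_integrable[OF L2_class_in] by (auto simp: sq_integrable_def)
  have "(LINT x|\<mu>. (cmod (L2_rep (L2_class \<mu> f) x - L2_rep (L2_class \<mu> g) x))\<^sup>2) =
        (LINT x|\<mu>. (cmod (f x - g x))\<^sup>2)"
    using L2_rep_class[OF assms(1)] L2_rep_class[OF assms(2)]
    by (intro integral_cong_AE) auto
  then show ?thesis by (simp add: L2_dist_def)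
qed

lemma Minkowski_sq:
  fixes f g :: "'a \<Rightarrow> real"
  assumes [measurable]: "f \<in> borel_measurable \<mu>" "g \<in> borel_measurable \<mu>"
    and i: "integrable \<mu> (\<lambda>x. (f x)\<^sup>2)" "integrable \<mu> (\<lambda>x. (g x)\<^sup>2)"
  shows "sqrt (LINT x|\<mu>. (f x + g x)\<^sup>2) \<le> sqrt (LINT x|\<mu>. (f x)\<^sup>2) + sqrt (LINT x|\<mu>. (g x)\<^sup>2)"
proof -
  define A B C where "A = (LINT x|\<mu>. (f x)\<^sup>2)" and "B = (LINT x|\<mu>. f x * g x)"
    and "C = (LINT x|\<mu>. (g x)\<^sup>2)"
  have nn: "A \<ge> 0" "C \<ge> 0" by (auto simp: A_def C_def)
  have bd: "\<bar>a * b\<bar> \<le> a\<^sup>2 + b\<^sup>2" for a b :: real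
  proof -
    have "2 * (\<bar>a\<bar> * \<bar>b\<bar>) \<le> a\<^sup>2 + b\<^sup>2"
      using sum_squares_bound[of "\<bar>a\<bar>" "\<bar>b\<bar>"] by (simp add: mult.assoc)
    moreover have "0 \<le> \<bar>a\<bar> * \<bar>b\<bar>" by simp
    ultimately show ?thesis unfolding abs_mult by linarith
  qed
  have ifg: "integrable \<mu> (\<lambda>x. f x * g x)"
  proof (rule Bochner_Integration.integrable_bound)
    show "integrable \<mu> (\<lambda>x. (f x)\<^sup>2 + (g x)\<^sup>2)" using i by simp
    show "AE x in \<mu>. norm (f x * g x) \<le> norm ((f x)\<^sup>2 + (g x)\<^sup>2)"
      using bd[of "f _" "g _"] by (intro AE_I2) simp
  qed measurable
  have quad: "(LINT x|\<mu>. (t * f x + g x)\<^sup>2) = t\<^sup>2 * A + 2 * t * B + C" for t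
  proof -
    have "(LINT x|\<mu>. (t * f x + g x)\<^sup>2) =
        (LINT x|\<mu>. t\<^sup>2 * (f x)\<^sup>2 + 2 * t * (f x * g x) + (g x)\<^sup>2)"
      by (intro Bochner_Integration.integral_cong) (auto simp: power2_eq_square algebra_simps)
    also have "\<dots> = t\<^sup>2 * A + 2 * t * B + C"
      using i ifg by (simp add: A_def B_def C_def)
    finally show ?thesis .
  qed
  have nonneg: "t\<^sup>2 * A + 2 * t * B + C \<ge> 0" for t
    unfolding quad[symmetric] by simp
  have "B\<^sup>2 \<le> A * C"
  proof (cases "A = 0")
    case True
    then have "AE x in \<mu>. (f x)\<^sup>2 = 0"
      using i integral_nonneg_eq_0_iff_AE[of \<mu> "\<lambda>x. (f x)\<^sup>2"] by (simp add: A_def)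
    then have "B = (LINT x|\<mu>. 0)"
      unfolding B_def by (intro integral_cong_AE) auto
    then show ?thesis using True by simp
  next
    case False
    then have "A > 0" using nn by simp
    moreover have "C - B\<^sup>2 / A \<ge> 0"
      using nonneg[of "- B / A"] \<open>A > 0\<close> by (simp add: field_simps power2_eq_square)
    ultimately show ?thesis by (simp add: field_simps)
  qed
  then have "B \<le> sqrt A * sqrt C"
    by (metis real_le_rsqrt real_sqrt_mult)
  moreover have "(LINT x|\<mu>. (f x + g x)\<^sup>2) = A + 2 * B + C"
    using quad[of 1] by simp
  ultimately have "(LINT x|\<mu>. (f x + g x)\<^sup>2) \<le> (sqrt A + sqrt C)\<^sup>2"
    using nn by (simp add: power2_sum)
  then show ?thesis
    unfolding A_def[symmetric] C_def[symmetric] using nn by (intro real_le_lsqrt) auto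
qed

lemma Metric_space_L2: "Metric_space (L2_space \<mu>) (L2_dist \<mu>)"
proof
  fix F G :: "('a \<Rightarrow> complex) set"
  show "0 \<le> L2_dist \<mu> F G" by (simp add: L2_dist_def)
  show "L2_dist \<mu> F G = L2_dist \<mu> G F" by (simp add: L2_dist_def norm_minus_commute)
next
  fix F G assume FG: "F \<in> L2_space \<mu>" "G \<in> L2_space \<mu>"
  define h where "h = (\<lambda>x. L2_rep F x - L2_rep G x)"
  have h: "h \<in> sq_integrable \<mu>"
    unfolding h_def using FG by (intro sq_integrable_diff L2_rep_sq_integrable)
  have "L2_dist \<mu> F G = 0 \<longleftrightarrow> (AE x in \<mu>. (cmod (h x))\<^sup>2 = 0)"
    using h integral_nonneg_eq_0_iff_AE[of \<mu> "\<lambda>x. (cmod (h x))\<^sup>2"]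
    by (simp add: L2_dist_def h_def sq_integrable_def)
  also have "\<dots> \<longleftrightarrow> (AE x in \<mu>. L2_rep F x = L2_rep G x)" by (simp add: h_def)
  also have "\<dots> \<longleftrightarrow> F = G"
  proof
    assume "AE x in \<mu>. L2_rep F x = L2_rep G x"
    from L2_class_eqI[OF this] show "F = G" using FG by (simp add: L2_class_rep)
  qed simp
  finally show "L2_dist \<mu> F G = 0 \<longleftrightarrow> F = G" .
next
  fix F G H assume "F \<in> L2_space \<mu>" "G \<in> L2_space \<mu>" "H \<in> L2_space \<mu>"
  then have r: "L2_rep F \<in> sq_integrable \<mu>" "L2_rep G \<in> sq_integrable \<mu>" "L2_rep H \<in> sq_integrable \<mu>"
    by (auto intro: L2_rep_sq_integrable)
  define a where "a = (\<lambda>x. cmod (L2_rep F x - L2_rep G x))"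
  define b where "b = (\<lambda>x. cmod (L2_rep G x - L2_rep H x))"
  define c where "c = (\<lambda>x. cmod (L2_rep F x - L2_rep H x))"
  have m[measurable]: "a \<in> borel_measurable \<mu>" "b \<in> borel_measurable \<mu>" "c \<in> borel_measurable \<mu>"
    and i: "integrable \<mu> (\<lambda>x. (a x)\<^sup>2)" "integrable \<mu> (\<lambda>x. (b x)\<^sup>2)" "integrable \<mu> (\<lambda>x. (c x)\<^sup>2)"
    using sq_integrable_diff[OF r(1,2)] sq_integrable_diff[OF r(2,3)] sq_integrable_diff[OF r(1,3)]
    by (auto simp: sq_integrable_def a_def b_def c_def)
  have bd: "(a x + b x)\<^sup>2 \<le> 2 * (a x)\<^sup>2 + 2 * (b x)\<^sup>2" for x
    using sum_squares_bound[of "a x" "b x"] by (simp add: power2_sum)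
  have iab: "integrable \<mu> (\<lambda>x. (a x + b x)\<^sup>2)"
  proof (rule Bochner_Integration.integrable_bound)
    show "integrable \<mu> (\<lambda>x. 2 * (a x)\<^sup>2 + 2 * (b x)\<^sup>2)" using i by simp
    show "AE x in \<mu>. norm ((a x + b x)\<^sup>2) \<le> norm (2 * (a x)\<^sup>2 + 2 * (b x)\<^sup>2)"
      by (intro AE_I2) (simp add: bd)
  qed measurable
  have "c x \<le> a x + b x" for x
    using norm_triangle_ineq[of "L2_rep F x - L2_rep G x" "L2_rep G x - L2_rep H x"]
    by (simp add: a_def b_def c_def)
  then have "(LINT x|\<mu>. (c x)\<^sup>2) \<le> (LINT x|\<mu>. (a x + b x)\<^sup>2)"
    using i iab by (intro integral_mono power_mono) (auto simp: c_def)
  then have "sqrt (LINT x|\<mu>. (c x)\<^sup>2) \<le> sqrt (LINT x|\<mu>. (a x + b x)\<^sup>2)" by simp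
  also have "\<dots> \<le> sqrt (LINT x|\<mu>. (a x)\<^sup>2) + sqrt (LINT x|\<mu>. (b x)\<^sup>2)"
    using i by (intro Minkowski_sq) auto
  finally show "L2_dist \<mu> F H \<le> L2_dist \<mu> F G + L2_dist \<mu> G H"
    by (simp add: L2_dist_def a_def b_def c_def)
qed


section \<open>Koopman operators and the directional Kronecker algebra\<close>

definition koopman ::
    "'a measure \<Rightarrow> ('n::finite lattice \<Rightarrow> 'a \<Rightarrow> 'a) \<Rightarrow> 'n lattice \<Rightarrow> ('a \<Rightarrow> complex) set \<Rightarrow> ('a \<Rightarrow> complex) set" where
  "koopman \<mu> T w F = L2_class \<mu> (L2_rep F \<circ> T w)"

definition kronecker_algebra_strip ::
    "'a::metric_space measure \<Rightarrow> ('n::finite lattice \<Rightarrow> 'a \<Rightarrow> 'a) \<Rightarrow> real \<times> (real ^ 'n) \<Rightarrow> real ^ 'n \<Rightarrow> 'a set set" where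
  "kronecker_algebra_strip \<mu> T v b =
     {B \<in> sets borel.
        compactin (L2_topology \<mu>)
          (L2_topology \<mu> closure_of
             ((\<lambda>w. koopman \<mu> T w (L2_class \<mu> (indicator B))) ` strip v b))}"

text \<open>
  This algebra does not depend on the width \<open>b\<close> (theorem \<open>kronecker_algebra_strip_eq\<close> below), which
  is therefore fixed to be \<open>(1, \<dots>, 1)\<close>.
\<close>

definition kronecker_algebra ::
    "'a::metric_space measure \<Rightarrow> ('n::finite lattice \<Rightarrow> 'a \<Rightarrow> 'a) \<Rightarrow> real \<times> (real ^ 'n) \<Rightarrow> 'a set set" where
  "kronecker_algebra \<mu> T v = kronecker_algebra_strip \<mu> T v (\<chi> i. 1)"

definition discrete_spectrum ::
    "'a::metric_space measure \<Rightarrow> ('n::finite lattice \<Rightarrow> 'a \<Rightarrow> 'a) \<Rightarrow> real \<times> (real ^ 'n) \<Rightarrow> bool" where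
  "discrete_spectrum \<mu> T v \<longleftrightarrow> kronecker_algebra \<mu> T v = sets borel"


subsection \<open>Independence of the width\<close>

lemma tds_zero:
  assumes "is_tds T"
  shows "T 0 = id"
proof -
  obtain g where g: "homeomorphism UNIV UNIV (T 0) g"
    using assms unfolding is_tds_def by blast
  have "T 0 (T 0 x) = T 0 x" for x
    using assms unfolding is_tds_def by (metis add_0 comp_apply)
  then have "T 0 x = x" for x
    using g by (metis homeomorphism_apply1 UNIV_I)
  then show ?thesis by auto
qed

lemma tds_inverse:
  assumes "is_tds T"
  shows "T w (T (- w) x) = x" "T (- w) (T w x) = x"
  using assms tds_zero[OF assms] unfolding is_tds_def
  by (metis add.right_inverse comp_apply id_apply, metis add.left_inverse comp_apply id_apply)

lemma tds_borel_measurable: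
  assumes "is_tds T" "\<mu> \<in> invariant_measures T"
  shows "T w \<in> measurable \<mu> \<mu>"
proof -
  have "continuous_on UNIV (T w)"
    using assms(1) unfolding is_tds_def by (meson homeomorphism_cont1)
  then have "T w \<in> measurable borel borel"
    by (rule borel_measurable_continuous_onI)
  moreover have "measurable \<mu> \<mu> = measurable borel borel"
    using assms(2) by (intro measurable_cong_sets) (auto simp: invariant_measures_def)
  ultimately show ?thesis by simp
qed

lemma tds_distr:
  assumes "is_tds T" "\<mu> \<in> invariant_measures T"
  shows "distr \<mu> \<mu> (T w) = \<mu>"
proof (rule measure_eqI)
  interpret prob_space \<mu> using assms(2) by (simp add: invariant_measures_def)
  fix A assume "A \<in> sets (distr \<mu> \<mu> (T w))"
  then have A: "A \<in> sets \<mu>" "A \<in> sets borel"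
    using assms(2) by (auto simp: invariant_measures_def)
  have sp: "space \<mu> = UNIV"
    using assms(2) sets_eq_imp_space_eq[of \<mu> borel] by (simp add: invariant_measures_def)
  have "T w -` A = T (- w) ` A"
  proof (intro equalityI subsetI)
    fix x assume "x \<in> T w -` A"
    then show "x \<in> T (- w) ` A"
      using tds_inverse(2)[OF assms(1), of w x] by (metis image_eqI vimage_eq)
  next
    fix x assume "x \<in> T (- w) ` A"
    then show "x \<in> T w -` A"
      using tds_inverse(1)[OF assms(1), of w] by (metis imageE vimageI)
  qed
  then have "measure \<mu> (T w -` A \<inter> space \<mu>) = measure \<mu> A"
    using assms(2) A(2) unfolding invariant_measures_def sp Int_UNIV_right mem_Collect_eq by metis
  then show "emeasure (distr \<mu> \<mu> (T w)) A = emeasure \<mu> A"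
    using A tds_borel_measurable[OF assms] by (simp add: emeasure_distr emeasure_eq_measure)
qed simp

lemma AE_comp_tds:
  assumes "is_tds T" "\<mu> \<in> invariant_measures T" "AE x in \<mu>. P x"
  shows "AE x in \<mu>. P (T w x)"
proof -
  have "AE x in distr \<mu> \<mu> (T w). P x"
    using assms(3) by (simp only: tds_distr[OF assms(1,2)])
  then show ?thesis by (rule AE_distrD[OF tds_borel_measurable[OF assms(1,2)]])
qed

lemma sq_integrable_comp_tds:
  assumes "is_tds T" "\<mu> \<in> invariant_measures T" "f \<in> sq_integrable \<mu>"
  shows "f \<circ> T w \<in> sq_integrable \<mu>"
proof -
  note T[measurable] = tds_borel_measurable[OF assms(1,2), of w]
  have [measurable]: "f \<in> borel_measurable \<mu>" using assms(3) by (simp add: sq_integrable_def)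
  have "integrable (distr \<mu> \<mu> (T w)) (\<lambda>x. (cmod (f x))\<^sup>2)"
    using assms by (simp add: tds_distr sq_integrable_def)
  then have "integrable \<mu> (\<lambda>x. (cmod (f (T w x)))\<^sup>2)"
    by (rule integrable_distr[OF T])
  then show ?thesis by (simp add: sq_integrable_def comp_def)
qed

lemma koopman_class:
  assumes "is_tds T" "\<mu> \<in> invariant_measures T" "f \<in> sq_integrable \<mu>"
  shows "koopman \<mu> T w (L2_class \<mu> f) = L2_class \<mu> (f \<circ> T w)"
  unfolding koopman_def
  using AE_comp_tds[OF assms(1,2) L2_rep_class[OF assms(3)], of w] by (intro L2_class_eqI) simp

lemma koopman_in:
  assumes "is_tds T" "\<mu> \<in> invariant_measures T" "F \<in> L2_space \<mu>"
  shows "koopman \<mu> T w F \<in> L2_space \<mu>"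
  unfolding koopman_def using assms
  by (intro L2_class_in sq_integrable_comp_tds L2_rep_sq_integrable)

lemma koopman_add:
  assumes "is_tds T" "\<mu> \<in> invariant_measures T" "F \<in> L2_space \<mu>"
  shows "koopman \<mu> T (u + w) F = koopman \<mu> T w (koopman \<mu> T u F)"
proof -
  note f = L2_rep_sq_integrable[OF assms(3)]
  have "koopman \<mu> T w (koopman \<mu> T u F) = L2_class \<mu> ((L2_rep F \<circ> T u) \<circ> T w)"
    unfolding koopman_def[of _ _ u]
    by (rule koopman_class[OF assms(1,2) sq_integrable_comp_tds[OF assms(1,2) f]])
  also have "\<dots> = koopman \<mu> T (u + w) F"
    using assms(1) unfolding koopman_def is_tds_def comp_assoc by metis
  finally show ?thesis by simp
qed

lemma koopman_isometry:
  assumes "is_tds T" "\<mu> \<in> invariant_measures T" "F \<in> L2_space \<mu>" "G \<in> L2_space \<mu>"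
  shows "L2_dist \<mu> (koopman \<mu> T w F) (koopman \<mu> T w G) = L2_dist \<mu> F G"
proof -
  note T[measurable] = tds_borel_measurable[OF assms(1,2), of w]
  note fg = L2_rep_sq_integrable[OF assms(3)] L2_rep_sq_integrable[OF assms(4)]
  have [measurable]: "L2_rep F \<in> borel_measurable \<mu>" "L2_rep G \<in> borel_measurable \<mu>"
    using fg by (auto simp: sq_integrable_def)
  have "L2_dist \<mu> (koopman \<mu> T w F) (koopman \<mu> T w G) =
      sqrt (LINT x|\<mu>. (cmod (L2_rep F (T w x) - L2_rep G (T w x)))\<^sup>2)"
    unfolding koopman_def
    using L2_dist_class[OF sq_integrable_comp_tds[OF assms(1,2) fg(1), of w]
        sq_integrable_comp_tds[OF assms(1,2) fg(2), of w]] by simp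
  also have "\<dots> = sqrt (LINT x|distr \<mu> \<mu> (T w). (cmod (L2_rep F x - L2_rep G x))\<^sup>2)"
    by (subst integral_distr[OF T]) auto
  also have "\<dots> = L2_dist \<mu> F G"
    by (simp add: tds_distr[OF assms(1,2)] L2_dist_def)
  finally show ?thesis .
qed

lemma strip_subset_translates:
  fixes v :: "real \<times> (real ^ 'n::finite)"
  assumes "b \<in> pos_vectors"
  shows "\<exists>S. finite S \<and> strip v b' \<subseteq> (\<Union>s\<in>S. (\<lambda>m. m + s) ` strip v b)"
proof -
  define \<beta> where "\<beta> = snd v"
  define \<phi> where "\<phi> = (\<lambda>(p::int) (i::'n). \<lfloor>frac (\<beta> $ i * real_of_int p) / b $ i\<rfloor>)"
  have bpos: "b $ i > 0" for i using assms by (simp add: pos_vectors_def)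
  have "range \<phi> \<subseteq> PiE UNIV (\<lambda>i. {0..\<lceil>1 / b $ i\<rceil>})"
  proof (clarsimp simp: PiE_iff)
    fix p i
    have "frac (\<beta> $ i * real_of_int p) / b $ i \<le> 1 / b $ i"
      using bpos[of i] frac_lt_1[of "\<beta> $ i * real_of_int p"] by (intro divide_right_mono) auto
    then have "\<phi> p i \<le> \<lceil>1 / b $ i\<rceil>"
      unfolding \<phi>_def by linarith
    moreover have "0 \<le> \<phi> p i"
      unfolding \<phi>_def using bpos[of i] frac_ge_0 by (simp add: less_imp_le)
    ultimately show "0 \<le> \<phi> p i \<and> \<phi> p i \<le> \<lceil>1 / b $ i\<rceil>" by simp
  qed
  then have fin: "finite (range \<phi>)"
    by (rule finite_subset) (intro finite_PiE; simp)
  define R where "R = inv \<phi> ` range \<phi>"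
  define D where "D = (\<lambda>n i. {\<lfloor>- (\<bar>b' $ i\<bar> + \<bar>\<beta> $ i * real_of_int n\<bar> + b $ i)\<rfloor>..
      \<lceil>\<bar>b' $ i\<bar> + \<bar>\<beta> $ i * real_of_int n\<bar> + b $ i\<rceil>})"
  define S where "S = (\<Union>n\<in>R. {n} \<times> {s::int^'n. \<forall>i. s $ i \<in> D n i})"
  have "finite R" unfolding R_def using fin by (rule finite_imageI)
  then have "finite S"
    unfolding S_def by (intro finite_UN_I finite_cartesian_product finite_vec_PiE) (auto simp: D_def)
  moreover have "strip v b' \<subseteq> (\<Union>s\<in>S. (\<lambda>m. m + s) ` strip v b)"
  proof
    fix m assume m: "m \<in> strip v b'"
    define n where "n = inv \<phi> (\<phi> (fst m))"
    have nR: "n \<in> R" and n: "\<phi> n = \<phi> (fst m)"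
      by (auto simp: n_def R_def f_inv_into_f)
    define l :: "int^'n" where
      "l = (\<chi> i. \<lfloor>\<beta> $ i * real_of_int (fst m)\<rfloor> - \<lfloor>\<beta> $ i * real_of_int n\<rfloor>)"
    have close: "\<bar>\<beta> $ i * real_of_int (fst m - n) - real_of_int (l $ i)\<bar> \<le> b $ i" for i
    proof -
      define x y where "x = frac (\<beta> $ i * real_of_int (fst m))" and "y = frac (\<beta> $ i * real_of_int n)"
      have "\<lfloor>y / b $ i\<rfloor> = \<lfloor>x / b $ i\<rfloor>"
        using fun_cong[OF n, of i] by (simp add: \<phi>_def x_def y_def)
      then have "\<bar>x / b $ i - y / b $ i\<bar> \<le> 1" by linarith
      then have "\<bar>(x - y) / b $ i\<bar> \<le> 1" by (simp add: diff_divide_distrib)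
      then have "\<bar>x - y\<bar> \<le> b $ i" using bpos[of i] by (simp add: abs_divide)
      moreover have "x - y = \<beta> $ i * real_of_int (fst m - n) - real_of_int (l $ i)"
        by (simp add: x_def y_def l_def frac_def algebra_simps)
      ultimately show ?thesis by simp
    qed
    define p where "p = (fst m - n, l)"
    have "p \<in> strip v b"
      unfolding strip_def p_def \<beta>_def[symmetric] using close by (auto simp: abs_le_iff algebra_simps)
    moreover have "m - p \<in> S"
    proof -
      have "snd m $ i - l $ i \<in> D n i" for i
      proof -
        have "\<bar>real_of_int (snd m $ i) - \<beta> $ i * real_of_int (fst m)\<bar> \<le> \<bar>b' $ i\<bar>"
        proof -
          have "\<beta> $ i * real_of_int (fst m) - b' $ i \<le> real_of_int (snd m $ i)"
            "real_of_int (snd m $ i) \<le> \<beta> $ i * real_of_int (fst m) + b' $ i"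
            using m by (auto simp: strip_def \<beta>_def)
          then show ?thesis by linarith
        qed
        moreover have "\<beta> $ i * real_of_int (fst m - n) =
            \<beta> $ i * real_of_int (fst m) - \<beta> $ i * real_of_int n" by (simp add: algebra_simps)
        ultimately have "\<bar>real_of_int (snd m $ i - l $ i)\<bar> \<le>
            \<bar>b' $ i\<bar> + \<bar>\<beta> $ i * real_of_int n\<bar> + b $ i"
          using close[of i] by simp
        then have "real_of_int (snd m $ i - l $ i) \<le> \<bar>b' $ i\<bar> + \<bar>\<beta> $ i * real_of_int n\<bar> + b $ i"
          "- (\<bar>b' $ i\<bar> + \<bar>\<beta> $ i * real_of_int n\<bar> + b $ i) \<le> real_of_int (snd m $ i - l $ i)"
          by linarith+
        then show ?thesis unfolding D_def atLeastAtMost_iff by linarith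
      qed
      then show ?thesis
        unfolding S_def p_def using nR by (intro UN_I[of n]) (auto simp: fst_diff snd_diff mem_Times_iff)
    qed
    ultimately show "m \<in> (\<Union>s\<in>S. (\<lambda>m. m + s) ` strip v b)"
      by (intro UN_I[of "m - p"] image_eqI[of _ _ p]) auto
  qed
  ultimately show ?thesis by blast
qed

lemma kronecker_algebra_strip_subset:
  fixes \<mu> :: "'a::metric_space measure"
  assumes "is_tds T" "\<mu> \<in> invariant_measures T" "b \<in> pos_vectors"
  shows "kronecker_algebra_strip \<mu> T v b \<subseteq> kronecker_algebra_strip \<mu> T v b'"
proof
  interpret L2: Metric_space "L2_space \<mu>" "L2_dist \<mu>" by (rule Metric_space_L2)
  interpret prob_space \<mu> using assms(2) by (simp add: invariant_measures_def)
  fix B assume B: "B \<in> kronecker_algebra_strip \<mu> T v b"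
  define F where "F = L2_class \<mu> (indicator B)"
  define C where "C = L2.mtopology closure_of ((\<lambda>w. koopman \<mu> T w F) ` strip v b)"
  have Bm: "B \<in> sets borel" and C: "compactin L2.mtopology C"
    using B by (auto simp: kronecker_algebra_strip_def C_def F_def L2_topology_def)
  have [measurable]: "(indicator B :: 'a \<Rightarrow> complex) \<in> borel_measurable \<mu>"
    using Bm assms(2) by (auto simp: invariant_measures_def intro: borel_measurable_indicator)
  have "integrable \<mu> (\<lambda>x. (cmod (indicator B x))\<^sup>2)"
    by (intro integrable_const_bound[of _ 1] AE_I2) (simp add: indicator_def, measurable)
  then have F: "F \<in> L2_space \<mu>"
    unfolding F_def by (intro L2_class_in) (simp add: sq_integrable_def)
  have CS: "C \<subseteq> L2_space \<mu>" using compactin_subset_topspace[OF C] by simp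
  have sub: "(\<lambda>w. koopman \<mu> T w F) ` strip v b \<subseteq> C"
    unfolding C_def using koopman_in[OF assms(1,2) F] by (intro closure_of_subset) auto
  obtain S where S: "finite S" "strip v b' \<subseteq> (\<Union>s\<in>S. (\<lambda>m. m + s) ` strip v b)"
    using strip_subset_translates[OF assms(3)] by blast
  have cont: "continuous_map L2.mtopology L2.mtopology (koopman \<mu> T s)" for s
    unfolding L2.metric_continuous_map[OF Metric_space_L2]
    using koopman_in[OF assms(1,2)] koopman_isometry[OF assms(1,2)] by (metis image_subsetI)
  define E where "E = (\<Union>s\<in>S. koopman \<mu> T s ` C)"
  have E: "compactin L2.mtopology E"
    unfolding E_def using S(1) by (intro compactin_Union) (auto intro: image_compactin[OF C cont])
  have "(\<lambda>w. koopman \<mu> T w F) ` strip v b' \<subseteq> E"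
  proof (clarify)
    fix m1 m2 assume "(m1, m2) \<in> strip v b'"
    then obtain s p where "s \<in> S" "p \<in> strip v b" and eq: "(m1, m2) = p + s" using S(2) by blast
    then have "koopman \<mu> T (m1, m2) F = koopman \<mu> T s (koopman \<mu> T p F)"
      using koopman_add[OF assms(1,2) F] by simp
    then show "koopman \<mu> T (m1, m2) F \<in> E"
      unfolding E_def using \<open>s \<in> S\<close> \<open>p \<in> strip v b\<close> sub by blast
  qed
  moreover have "closedin L2.mtopology E"
    using E L2.Hausdorff_space_mtopology by (rule compactin_imp_closedin[rotated])
  ultimately have "L2.mtopology closure_of ((\<lambda>w. koopman \<mu> T w F) ` strip v b') \<subseteq> E"
    by (intro closure_of_minimal)
  then have "compactin L2.mtopology (L2.mtopology closure_of ((\<lambda>w. koopman \<mu> T w F) ` strip v b'))"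
    using closed_compactin[OF E] by simp
  then show "B \<in> kronecker_algebra_strip \<mu> T v b'"
    using Bm by (simp add: kronecker_algebra_strip_def F_def L2_topology_def)
qed

theorem kronecker_algebra_strip_eq:
  assumes "is_tds T" "\<mu> \<in> invariant_measures T" "b \<in> pos_vectors"
  shows "kronecker_algebra_strip \<mu> T v b = kronecker_algebra \<mu> T v"
  unfolding kronecker_algebra_def
  using kronecker_algebra_strip_subset[OF assms(1,2)] assms(3)
  by (intro equalityI) (simp_all add: pos_vectors_def)

end

(* The displacement disp B w = mu(T^{-w} B Delta B) is a symmetric subadditive function on the lattice, and
   B lies in the Kronecker algebra iff the strip is totally bounded for it.

   Bounded complexity ==> discrete spectrum: by Lusin, for every k half of the times w in the strip up
   to k fall into a bounded number of classes on which the displacement is small. Differences inside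
   the largest class give a set of return times of positive density, and disjointness of its
   translates bounds the size of separated subsets of the strip.

   Discrete spectrum ==> equicontinuity in the mean: averaging 1_B over the strip with weights that are
   Lipschitz in the displacement and concentrated on return times gives, in the limit, a function p
   close to 1_B in L^1 with |p(T^s x) - p(x)| <= C (disp B s + side s) for almost all x. The means of
   |p - 1_B| along orbits are small off a small set by a maximal inequality, and p along the strip is
   uniformly close to finitely many translates of p, to which Lusin applies. *)

theory Submission
  imports Defs
begin

section \<open>Completeness of \<open>L\<^sup>2\<close>\<close>

text \<open>Two obstacles shape the proof. The strip is not closed under addition, and its points
  are not the iterates of one map. Differences of its elements are therefore allowed to lie in wider
  strips, whose growth is linear as well, and sums along the strip are compared with sums along
  \<open>spine\<close>, one lattice point per first coordinate, thickened by a cube;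
  \<open>spine\<close> is additive up to a rounding error that a larger cube absorbs. Secondly,
  closeness in a mean metric controls most times but no single one. Hence complexity gives a
  positive density of return times and nothing better, and total boundedness must come from a
  packing argument; in the other direction a maximal inequality has to bound orbit averages for all
  lengths at once. The quantifier over \<open>b\<close> is harmless: for each fixed \<open>b\<close>
  all four properties are compared with discrete spectrum, whose definition contains no
  \<open>b\<close>.\<close>

lemma mcomplete_L2:
  assumes "finite_measure \<mu>"
  shows "Metric_space.mcomplete (L2_space \<mu>) (L2_dist \<mu>)"
proof -
  interpret L2: Metric_space "L2_space \<mu>" "L2_dist \<mu>" by (rule Metric_space_L2)
  interpret finite_measure \<mu> by (rule assms)
  \<comment> \<open>Riesz-Fischer. Completeness is what lets total boundedness of an orbit yield a
    compact closure and lets Cauchy subsequences of averages converge.\<close>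
  show ?thesis unfolding L2.mcomplete_def
  proof (intro allI impI)
    fix \<sigma> assume cauchy: "L2.MCauchy \<sigma>"
    have \<sigma>: "\<sigma> n \<in> L2_space \<mu>" for n using cauchy by (auto simp: L2.MCauchy_def)
    have "\<forall>k. \<exists>N. \<forall>n n'. N \<le> n \<longrightarrow> N \<le> n' \<longrightarrow> L2_dist \<mu> (\<sigma> n) (\<sigma> n') < (1/2)^k"
      using cauchy by (auto simp: L2.MCauchy_def)
    then obtain N where N: "\<And>k n n'. N k \<le> n \<Longrightarrow> N k \<le> n' \<Longrightarrow> L2_dist \<mu> (\<sigma> n) (\<sigma> n') < (1/2)^k"
      by metis
    \<comment> \<open>Adding up all \<open>N i\<close> with \<open>i <= k\<close> makes
      \<open>r\<close> strictly increasing and still at least \<open>N k\<close>.\<close>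
    define r where "r k = k + (\<Sum>i\<le>k. N i)" for k
    have r: "strict_mono r" by (rule strict_monoI_Suc) (simp add: r_def)
    have rN: "N k \<le> r k" for k
      unfolding r_def by (rule trans_le_add2, rule member_le_sum) auto
    define f where "f n = L2_rep (\<sigma> (r n))" for n
    have f: "f n \<in> sq_integrable \<mu>" for n unfolding f_def by (intro L2_rep_sq_integrable \<sigma>)
    have [measurable]: "f n \<in> borel_measurable \<mu>" for n
      using f[of n] by (simp add: sq_integrable_def)
    have fi: "integrable \<mu> (\<lambda>x. (cmod (f m x - f n x))\<^sup>2)" for m n
      using sq_integrable_diff[OF f f] by (simp add: sq_integrable_def)
    have d: "(LINT x|\<mu>. (cmod (f m x - f n x))\<^sup>2) \<le> (1/4)^n" if "n \<le> m" for m n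
    proof -
      have "L2_dist \<mu> (\<sigma> (r m)) (\<sigma> (r n)) < (1/2)^n"
        using rN[of n] strict_mono_less_eq[OF r, of n m] that by (intro N) auto
      then have "sqrt (LINT x|\<mu>. (cmod (f m x - f n x))\<^sup>2) \<le> sqrt ((1/4)^n)"
        by (simp add: L2_dist_def f_def real_sqrt_power real_sqrt_divide)
      then show ?thesis by simp
    qed
    define u where "u n x = cmod (f (Suc n) x - f n x)" for n x
    have [measurable]: "u n \<in> borel_measurable \<mu>" for n unfolding u_def by measurable
    define M where "M = measure \<mu> (space \<mu>) + 1"
    have M: "M > 0" by (simp add: M_def add_nonneg_pos)
    have nnu: "(\<integral>\<^sup>+x. ennreal (u n x) \<partial>\<mu>) \<le> ennreal ((1/2)^n * M)" for n
    proof -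
      \<comment> \<open>This is \<open>u <= a + u^2 / a\<close> with \<open>a = (1/2)^n\<close>. The
        integral of \<open>u^2\<close> is at most \<open>a^2\<close>, so both terms integrate to
        multiples of \<open>a\<close>, and the increments are summable in L1.\<close>
      have le: "u n x \<le> (1/2)^n + 2^n * (u n x)\<^sup>2" for x
      proof -
        define a where "a = (1/2::real)^n"
        have a: "a > 0" "2^n = 1 / a" by (auto simp: a_def power_divide)
        have "0 \<le> (u n x - a)\<^sup>2 + u n x * a" using a by (simp add: u_def)
        then have "u n x * a \<le> a * a + (u n x)\<^sup>2" by (simp add: power2_eq_square algebra_simps)
        then have "u n x \<le> a + (u n x)\<^sup>2 / a" using a(1) by (simp add: field_simps)
        then show ?thesis unfolding a_def[symmetric] a(2) by simp
      qed
      have i: "integrable \<mu> (\<lambda>x. (1/2)^n + 2^n * (u n x)\<^sup>2)"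
        unfolding u_def using fi by simp
      have "(\<integral>\<^sup>+x. ennreal (u n x) \<partial>\<mu>) \<le> (\<integral>\<^sup>+x. ennreal ((1/2)^n + 2^n * (u n x)\<^sup>2) \<partial>\<mu>)"
        using le by (intro nn_integral_mono ennreal_leI) auto
      also have "\<dots> = ennreal (LINT x|\<mu>. (1/2)^n + 2^n * (u n x)\<^sup>2)"
        using i by (intro nn_integral_eq_integral) auto
      also have "(LINT x|\<mu>. (1/2)^n + 2^n * (u n x)\<^sup>2) =
          (1/2)^n * measure \<mu> (space \<mu>) + 2^n * (LINT x|\<mu>. (u n x)\<^sup>2)"
        using fi by (simp add: u_def)
      also have "ennreal \<dots> \<le> ennreal ((1/2)^n * measure \<mu> (space \<mu>) + 2^n * (1/4)^n)"
        using d[of n "Suc n"] unfolding u_def by (intro ennreal_leI add_left_mono mult_left_mono) auto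
      also have "(1/2)^n * measure \<mu> (space \<mu>) + 2^n * (1/4)^n = (1/2)^n * M"
        by (simp add: M_def algebra_simps power_mult_distrib[symmetric])
      finally show ?thesis .
    qed
    have "(\<integral>\<^sup>+x. (\<Sum>n. ennreal (u n x)) \<partial>\<mu>) = (\<Sum>n. \<integral>\<^sup>+x. ennreal (u n x) \<partial>\<mu>)"
      by (intro nn_integral_suminf) auto
    also have "\<dots> \<le> (\<Sum>n. ennreal ((1/2)^n * M))"
      using nnu by (intro suminf_le) auto
    also have "\<dots> < \<infinity>"
    proof -
      have "summable (\<lambda>n. (1/2::real)^n * M)" by (intro summable_mult2 summable_geometric) simp
      then show ?thesis using M by (subst suminf_ennreal2) (auto)
    qed
    finally have "AE x in \<mu>. (\<Sum>n. ennreal (u n x)) \<noteq> \<infinity>"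
      by (intro nn_integral_PInf_AE) auto
    then have conv: "AE x in \<mu>. convergent (\<lambda>n. f n x)"
    proof eventually_elim
      case (elim x)
      have "summable (\<lambda>n. u n x)"
        using elim by (intro summable_suminf_not_top) (auto simp: u_def)
      then have "summable (\<lambda>n. f (Suc n) x - f n x)"
        unfolding u_def by (rule summable_norm_cancel)
      then have "convergent (\<lambda>m. \<Sum>n<m. f (Suc n) x - f n x)"
        by (simp add: summable_iff_convergent)
      then have "convergent (\<lambda>m. f m x - f 0 x)" by (simp add: sum_lessThan_telescope[of "\<lambda>n. f n x"])
      then show ?case using convergent_diff_const_right_iff by blast
    qed
    define g where "g x = lim (\<lambda>n. f n x)" for x
    have [measurable]: "g \<in> borel_measurable \<mu>" unfolding g_def by measurable
    have g: "AE x in \<mu>. (\<lambda>n. f n x) \<longlonglongrightarrow> g x"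
      using conv by eventually_elim (simp add: g_def convergent_LIMSEQ_iff)
    \<comment> \<open>Fatou in \<open>m\<close> with \<open>n\<close> fixed: the rate of the Cauchy
      sequence passes to the limit, which yields both square integrability of \<open>g\<close> and
      convergence in L2.\<close>
    have fatou: "(\<integral>\<^sup>+x. ennreal ((cmod (f n x - g x))\<^sup>2) \<partial>\<mu>) \<le> ennreal ((1/4)^n)" for n
    proof -
      have "(\<integral>\<^sup>+x. ennreal ((cmod (f n x - g x))\<^sup>2) \<partial>\<mu>) =
          (\<integral>\<^sup>+x. liminf (\<lambda>m. ennreal ((cmod (f m x - f n x))\<^sup>2)) \<partial>\<mu>)"
      proof (intro nn_integral_cong_AE, use g in eventually_elim)
        case (elim x)
        then have "(\<lambda>m. ennreal ((cmod (f m x - f n x))\<^sup>2)) \<longlonglongrightarrow> ennreal ((cmod (g x - f n x))\<^sup>2)"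
          by (intro tendsto_intros)
        from lim_imp_Liminf[OF trivial_limit_sequentially this] show ?case
          by (simp add: norm_minus_commute)
      qed
      also have "\<dots> \<le> liminf (\<lambda>m. \<integral>\<^sup>+x. ennreal ((cmod (f m x - f n x))\<^sup>2) \<partial>\<mu>)"
        by (intro nn_integral_liminf) auto
      also have "\<dots> \<le> limsup (\<lambda>m. \<integral>\<^sup>+x. ennreal ((cmod (f m x - f n x))\<^sup>2) \<partial>\<mu>)"
        by (intro Liminf_le_Limsup) simp
      also have "\<dots> \<le> ennreal ((1/4)^n)"
      proof (intro Limsup_bounded eventually_sequentiallyI[of n])
        fix m assume "n \<le> m"
        have "(\<integral>\<^sup>+x. ennreal ((cmod (f m x - f n x))\<^sup>2) \<partial>\<mu>) = ennreal (LINT x|\<mu>. (cmod (f m x - f n x))\<^sup>2)"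
          using fi by (intro nn_integral_eq_integral) auto
        then show "(\<integral>\<^sup>+x. ennreal ((cmod (f m x - f n x))\<^sup>2) \<partial>\<mu>) \<le> ennreal ((1/4)^n)"
          using d[OF \<open>n \<le> m\<close>] by (simp add: ennreal_leI)
      qed
      finally show ?thesis .
    qed
    have gi: "integrable \<mu> (\<lambda>x. (cmod (f n x - g x))\<^sup>2)" for n
    proof (rule integrableI_bounded)
      show "(\<integral>\<^sup>+x. ennreal (norm ((cmod (f n x - g x))\<^sup>2)) \<partial>\<mu>) < \<infinity>"
        using fatou[of n] by (simp add: le_less_trans)
    qed measurable
    then have "(\<lambda>x. f 0 x - g x) \<in> sq_integrable \<mu>" by (simp add: sq_integrable_def)
    from sq_integrable_diff[OF f[of 0] this] have gs: "g \<in> sq_integrable \<mu>" by simp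
    have dist_le: "L2_dist \<mu> ((\<sigma> \<circ> r) n) (L2_class \<mu> g) \<le> (1/2)^n" for n
    proof -
      have "ennreal (LINT x|\<mu>. (cmod (f n x - g x))\<^sup>2) \<le> ennreal ((1/4)^n)"
        using fatou[of n] gi[of n] by (subst nn_integral_eq_integral[symmetric]) auto
      then have "(LINT x|\<mu>. (cmod (f n x - g x))\<^sup>2) \<le> (1/4)^n" by simp
      then have "sqrt (LINT x|\<mu>. (cmod (f n x - g x))\<^sup>2) \<le> sqrt ((1/4)^n)" by simp
      also have "\<dots> = (1/2)^n" by (simp add: real_sqrt_power real_sqrt_divide)
      also have "sqrt (LINT x|\<mu>. (cmod (f n x - g x))\<^sup>2) = L2_dist \<mu> (L2_class \<mu> (f n)) (L2_class \<mu> g)"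
        using L2_dist_class[OF f gs] by simp
      also have "L2_class \<mu> (f n) = (\<sigma> \<circ> r) n" unfolding f_def by (simp add: L2_class_rep \<sigma>)
      finally show ?thesis .
    qed
    have "(\<lambda>n. L2_dist \<mu> ((\<sigma> \<circ> r) n) (L2_class \<mu> g)) \<longlonglongrightarrow> 0"
    proof (rule tendsto_sandwich[OF always_eventually always_eventually tendsto_const])
      show "(\<lambda>n. (1/2::real)^n) \<longlonglongrightarrow> 0" by (simp add: LIMSEQ_power_zero)
    qed (use dist_le in \<open>auto simp: L2_dist_def\<close>)
    then have "limitin L2.mtopology (\<sigma> \<circ> r) (L2_class \<mu> g) sequentially"
      unfolding L2.limitin_metric_dist_null using L2_class_in[OF gs] \<sigma> by simp
    then show "\<exists>x. limitin L2.mtopology \<sigma> x sequentially"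
      using L2.MCauchy_convergent_subsequence[OF cauchy r] by blast
  qed
qed

section \<open>Counting in strips\<close>

text \<open>An additive map of the lattice. Strip membership becomes a bound on it, so sums and
  differences of strip elements add the widths.\<close>

definition offset :: "real \<times> (real ^ 'n) \<Rightarrow> 'n::finite lattice \<Rightarrow> 'n \<Rightarrow> real" where
  "offset v w i = real_of_int (snd w $ i) - snd v $ i * real_of_int (fst w)"

lemma offset_add: "offset v (u + w) i = offset v u i + offset v w i"
  by (simp add: offset_def algebra_simps)

lemma offset_minus: "offset v (- w) i = - offset v w i"
  by (simp add: offset_def)

lemma offset_diff: "offset v (u - w) i = offset v u i - offset v w i"
  by (simp add: offset_def algebra_simps)

lemma mem_strip_iff: "w \<in> strip v b \<longleftrightarrow> (\<forall>i. \<bar>offset v w i\<bar> \<le> b $ i)"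
  unfolding strip_def offset_def abs_le_iff by (auto simp: algebra_simps)

lemma strip_mono: "(\<And>i. b $ i \<le> b' $ i) \<Longrightarrow> strip v b \<subseteq> strip v b'"
  unfolding mem_strip_iff subset_iff by (meson order_trans)

lemma strip_add:
  assumes "u \<in> strip v b" "w \<in> strip v b'"
  shows "u + w \<in> strip v (b + b')"
  unfolding mem_strip_iff
proof
  fix i
  have "\<bar>offset v u i\<bar> \<le> b $ i" "\<bar>offset v w i\<bar> \<le> b' $ i"
    using assms by (simp_all add: mem_strip_iff)
  then show "\<bar>offset v (u + w) i\<bar> \<le> (b + b') $ i" by (simp add: offset_add)
qed

lemma strip_diff:
  assumes "u \<in> strip v b" "w \<in> strip v b'"
  shows "u - w \<in> strip v (b + b')"
  unfolding mem_strip_iff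
proof
  fix i
  have "\<bar>offset v u i\<bar> \<le> b $ i" "\<bar>offset v w i\<bar> \<le> b' $ i"
    using assms by (simp_all add: mem_strip_iff)
  then show "\<bar>offset v (u - w) i\<bar> \<le> (b + b') $ i" by (simp add: offset_diff)
qed

definition side :: "real \<times> (real ^ 'n) \<Rightarrow> 'n::finite lattice \<Rightarrow> real" where
  "side v w = (\<Sum>i\<in>UNIV. \<bar>offset v w i\<bar>)"

lemma side_nonneg: "0 \<le> side v w"
  by (simp add: side_def sum_nonneg)

lemma side_add: "side v (u + w) \<le> side v u + side v w"
  unfolding side_def sum.distrib[symmetric] by (intro sum_mono) (simp add: offset_add abs_triangle_ineq)

lemma side_minus: "side v (- w) = side v w"
  by (simp add: side_def offset_minus)

lemma side_le_imp_mem_strip: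
  assumes "side v w \<le> r"
  shows "w \<in> strip v (\<chi> i. r)"
proof -
  have "\<bar>offset v w i\<bar> \<le> side v w" for i
    unfolding side_def by (rule member_le_sum) auto
  then show ?thesis using assms unfolding mem_strip_iff by (auto intro: order_trans)
qed

section \<open>The strip as a thickened integer path\<close>

definition spine :: "real \<times> (real ^ 'n) \<Rightarrow> int \<Rightarrow> 'n::finite lattice" where
  "spine v n = (n, \<chi> i. \<lfloor>snd v $ i * real_of_int n\<rfloor>)"

definition cube :: "int \<Rightarrow> (int ^ 'n::finite) set" where
  "cube r = {j. \<forall>i. j $ i \<in> {-r..r}}"

lemma finite_cube: "finite (cube r)"
  unfolding cube_def by (rule finite_vec_PiE) simp

lemma fst_spine [simp]: "fst (spine v n) = n"
  by (simp add: spine_def)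

lemma spine_mem_strip: "spine v n \<in> strip v (\<chi> i. 1)"
  unfolding mem_strip_iff
proof
  fix i
  show "\<bar>offset v (spine v n) i\<bar> \<le> (\<chi> i. 1) $ i"
    unfolding offset_def spine_def by (simp add: abs_le_iff; linarith)
qed

text \<open>Rounding \<open>snd v $ i * n\<close> down moves a coordinate by less than 1, hence a
  radius one larger than the rounded-up width. Through this decomposition, counts and sums over the
  strip become one-dimensional.\<close>

lemma exists_cube:
  fixes b :: "real ^ 'n::finite"
  shows "\<exists>r. \<forall>w\<in>strip v b. \<exists>j\<in>cube r. w = spine v (fst w) + (0, j)"
proof -
  define B where "B = (\<Sum>i\<in>UNIV. \<bar>b $ i\<bar>)"
  have B: "b $ i \<le> B" for i
  proof -
    have "\<bar>b $ i\<bar> \<le> B" unfolding B_def by (rule member_le_sum) auto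
    then show ?thesis by linarith
  qed
  have "\<exists>j\<in>cube (\<lceil>B\<rceil> + 1). w = spine v (fst w) + (0, j)" if w: "w \<in> strip v b" for w
  proof (intro bexI)
    let ?j = "\<chi> i. snd w $ i - \<lfloor>snd v $ i * real_of_int (fst w)\<rfloor>"
    show "w = spine v (fst w) + (0, ?j)"
      by (simp add: spine_def prod_eq_iff vec_eq_iff)
    show "?j \<in> cube (\<lceil>B\<rceil> + 1)"
      unfolding cube_def
    proof (intro CollectI allI)
      fix i
      have "\<bar>offset v w i\<bar> \<le> B" using w B[of i] unfolding mem_strip_iff by (meson order_trans)
      then have "real_of_int (snd w $ i) - snd v $ i * real_of_int (fst w) \<le> B"
        "- B \<le> real_of_int (snd w $ i) - snd v $ i * real_of_int (fst w)"
        unfolding offset_def by linarith+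
      then show "?j $ i \<in> {- (\<lceil>B\<rceil> + 1)..\<lceil>B\<rceil> + 1}" by simp linarith
    qed
  qed
  then show ?thesis by blast
qed

text \<open>\<open>D\<close> is the number of vectors in the cube: each first coordinate carries at
  most that many strip points.\<close>

lemma card_strip_le:
  fixes b :: "real ^ 'n::finite"
  shows "\<exists>D::nat. \<forall>I. finite I \<longrightarrow> finite {w \<in> strip v b. fst w \<in> I} \<and> card {w \<in> strip v b. fst w \<in> I} \<le> D * card I"
proof -
  obtain r where r: "\<forall>w\<in>strip v b. \<exists>j\<in>cube r. w = spine v (fst w) + (0, j)"
    using exists_cube by blast
  have "finite {w \<in> strip v b. fst w \<in> I} \<and> card {w \<in> strip v b. fst w \<in> I} \<le> card (cube r :: (int^'n) set) * card I"
    if I: "finite I" for I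
  proof -
    have sub: "{w \<in> strip v b. fst w \<in> I} \<subseteq> (\<lambda>(n, j). spine v n + (0, j)) ` (I \<times> cube r)"
    proof
      fix w assume "w \<in> {w \<in> strip v b. fst w \<in> I}"
      then obtain j where "j \<in> cube r" "w = spine v (fst w) + (0, j)" "fst w \<in> I" using r by blast
      then show "w \<in> (\<lambda>(n, j). spine v n + (0, j)) ` (I \<times> cube r)"
        by (intro image_eqI[of _ _ "(fst w, j)"]) auto
    qed
    have fin: "finite ((\<lambda>(n, j). spine v n + (0, j)) ` (I \<times> (cube r :: (int^'n) set)))"
      using I finite_cube by blast
    have "card {w \<in> strip v b. fst w \<in> I} \<le> card (I \<times> (cube r :: (int^'n) set))"
      using card_mono[OF fin sub] card_image_le[OF finite_cartesian_product[OF I finite_cube]]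
      by (rule le_trans)
    then show ?thesis using finite_subset[OF sub fin] by (simp add: card_cartesian_product mult.commute)
  qed
  then show ?thesis by blast
qed

text \<open>Take \<open>A = {w - w0 | w \<in> S'}\<close> with \<open>S'\<close> the largest colour class and \<open>w0\<close> its point with the
  smallest first coordinate.\<close>

lemma pigeonhole_differences:
  fixes S :: "'n::finite lattice set"
  assumes "finite S" "S \<noteq> {}" "S \<subseteq> {w. 0 \<le> fst w \<and> fst w < k}" "card (c ` S) \<le> N"
  shows "\<exists>A. finite A \<and> card S \<le> card A * N \<and>
    (\<forall>a\<in>A. 0 \<le> fst a \<and> fst a < k \<and> (\<exists>u\<in>S. \<exists>w\<in>S. c u = c w \<and> a = u - w))"
proof -
  obtain y where y: "y \<in> c ` S" "card S \<le> card (c -` {y} \<inter> S) * card (c ` S)"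
    using pigeonhole_card[of c S "c ` S"] assms by auto
  define S' where "S' = c -` {y} \<inter> S"
  have S': "finite S'" "S' \<noteq> {}" using assms(1) y(1) by (auto simp: S'_def)
  obtain w0 where w0: "w0 \<in> S'" "\<And>w. w \<in> S' \<Longrightarrow> fst w0 \<le> fst w"
    using arg_min_if_finite(1)[OF S', of fst] arg_min_least[OF S', of _ fst] by blast
  define A where "A = (\<lambda>w. w - w0) ` S'"
  have "card A = card S'" unfolding A_def by (rule card_image) (simp add: inj_on_def)
  moreover have "card S \<le> card S' * N"
    using y(2) assms(4) unfolding S'_def by (meson le_trans mult_le_mono2)
  moreover have "0 \<le> fst a \<and> fst a < k \<and> (\<exists>u\<in>S. \<exists>w\<in>S. c u = c w \<and> a = u - w)" if a: "a \<in> A" for a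
  proof -
    obtain w where w: "w \<in> S'" "a = w - w0" using a unfolding A_def by blast
    have S: "w \<in> S" "w0 \<in> S" and cw: "c w = c w0" using w(1) w0(1) by (simp_all add: S'_def)
    then have "0 \<le> fst w0" "fst w < k" using assms(3) by blast+
    then have "0 \<le> fst a" "fst a < k" using w(2) w0(2)[OF w(1)] by simp_all
    then show ?thesis using w(2) S cw by blast
  qed
  moreover have "finite A" unfolding A_def using S'(1) by (rule finite_imageI)
  ultimately show ?thesis by (intro exI[of _ A]) simp
qed

text \<open>Among \<open>k\<close> spine points, one of \<open>N\<close> colours occurs at least
  \<open>k / N\<close> times. The differences may leave the strip of width 1; it is for
  \<open>P\<close> to say how close to the line they are.\<close>

lemma many_returns:
  fixes c :: "'n::finite lattice \<Rightarrow> 'c"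
  assumes fin: "finite (c ` strip v (\<chi> i. 1))"
    and P: "\<And>u w. u \<in> strip v (\<chi> i. 1) \<Longrightarrow> w \<in> strip v (\<chi> i. 1) \<Longrightarrow> c u = c w \<Longrightarrow> P (u - w)"
  shows "\<exists>N>0. \<forall>k. \<exists>A. finite A \<and> k \<le> card A * N \<and> (\<forall>a\<in>A. 0 \<le> fst a \<and> fst a < int k \<and> P a)"
proof (intro exI[of _ "card (c ` strip v (\<chi> i. 1))"] conjI allI)
  let ?N = "card (c ` strip v (\<chi> i. 1))"
  show "?N > 0" using fin spine_mem_strip[of v 0] by (auto simp: card_gt_0_iff)
  fix k :: nat
  show "\<exists>A. finite A \<and> k \<le> card A * ?N \<and> (\<forall>a\<in>A. 0 \<le> fst a \<and> fst a < int k \<and> P a)"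
  proof (cases "k = 0")
    case True then show ?thesis by (intro exI[of _ "{}"]) auto
  next
    case False
    define S where "S = spine v ` {0..<int k}"
    have sub: "S \<subseteq> strip v (\<chi> i. 1)" unfolding S_def using spine_mem_strip by blast
    have card: "card S = k"
      unfolding S_def by (subst card_image) (auto simp: inj_on_def spine_def)
    have "card (c ` S) \<le> ?N" using sub by (intro card_mono[OF fin]) blast
    moreover have "finite S" "S \<noteq> {}" "S \<subseteq> {w. 0 \<le> fst w \<and> fst w < int k}"
      using False by (auto simp: S_def)
    ultimately have "\<exists>A. finite A \<and> card S \<le> card A * ?N \<and>
        (\<forall>a\<in>A. 0 \<le> fst a \<and> fst a < int k \<and> (\<exists>u\<in>S. \<exists>w\<in>S. c u = c w \<and> a = u - w))"
      by (intro pigeonhole_differences)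
    then obtain A where A: "finite A" "k \<le> card A * ?N"
      "\<forall>a\<in>A. 0 \<le> fst a \<and> fst a < int k \<and> (\<exists>u\<in>S. \<exists>w\<in>S. c u = c w \<and> a = u - w)"
      unfolding card by blast
    have "P a" if a: "a \<in> A" for a
    proof -
      obtain u w where "u \<in> S" "w \<in> S" "c u = c w" "a = u - w" using A(3) a by blast
      then show ?thesis using P sub by blast
    qed
    then show ?thesis using A by (intro exI[of _ A]) simp
  qed
qed

lemma side_coloring:
  assumes "\<epsilon> > 0"
  shows "\<exists>c :: 'n::finite lattice \<Rightarrow> 'n \<Rightarrow> int. finite (c ` strip v b) \<and>
    (\<forall>u w. c u = c w \<longrightarrow> side v (u - w) < \<epsilon>)"
proof (intro exI conjI allI impI)
  \<comment> \<open>Mesh of the grid in each coordinate; adding up \<open>CARD('n)\<close> errors of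
    size \<open>q\<close> gives half of \<open>\<epsilon>\<close>, hence a strict bound.\<close>
  define q where "q = \<epsilon> / (2 * real CARD('n))"
  have q: "q > 0" using assms by (simp add: q_def)
  define c where "c = (\<lambda>(w::'n lattice) i. \<lfloor>offset v w i / q\<rfloor>)"
  have "c ` strip v b \<subseteq> PiE UNIV (\<lambda>i. {\<lfloor>- (b $ i) / q\<rfloor>..\<lfloor>b $ i / q\<rfloor>})"
  proof (intro image_subsetI PiE_I)
    fix w i assume "w \<in> strip v b"
    then have "- (b $ i) \<le> offset v w i" "offset v w i \<le> b $ i"
      unfolding mem_strip_iff by (auto simp: abs_le_iff minus_le_iff)
    then show "c w i \<in> {\<lfloor>- (b $ i) / q\<rfloor>..\<lfloor>b $ i / q\<rfloor>}"
      unfolding c_def atLeastAtMost_iff using q by (intro conjI floor_mono divide_right_mono) auto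
  qed auto
  then show "finite (c ` strip v b)" by (rule finite_subset) (intro finite_PiE; simp)
  fix u w assume "c u = c w"
  then have *: "\<bar>offset v (u - w) i\<bar> \<le> q" for i
  proof -
    have "\<lfloor>offset v u i / q\<rfloor> = \<lfloor>offset v w i / q\<rfloor>" using fun_cong[OF \<open>c u = c w\<close>, of i] by (simp add: c_def)
    then have "\<bar>offset v u i / q - offset v w i / q\<bar> \<le> 1" by linarith
    then have "\<bar>(offset v u i - offset v w i) / q\<bar> \<le> 1" by (simp add: diff_divide_distrib)
    then show ?thesis using q by (simp add: offset_diff abs_divide)
  qed
  have "side v (u - w) \<le> real CARD('n) * q"
    unfolding side_def using sum_bounded_above[of UNIV "\<lambda>i. \<bar>offset v (u - w) i\<bar>" q] * by simp
  also have "\<dots> < \<epsilon>" using assms by (simp add: q_def)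
  finally show "side v (u - w) < \<epsilon>" .
qed

text \<open>A thin strip can have no point at all over many first coordinates, so the spine does not
  suffice. The bound is recurrence of the slopes modulo 1: \<open>side\<close> is small at a
  positive proportion of times.\<close>

lemma card_strip_upto_ge:
  assumes "b \<in> pos_vectors"
  shows "\<exists>N>0. \<forall>k. k \<le> card (strip_upto v b k :: 'n::finite lattice set) * N"
proof -
  define \<epsilon> where "\<epsilon> = Min (range (\<lambda>i. b $ i))"
  have \<epsilon>: "\<epsilon> > 0" "\<And>i. \<epsilon> \<le> b $ i" unfolding \<epsilon>_def using assms by (auto simp: pos_vectors_def)
  obtain c :: "'n lattice \<Rightarrow> 'n \<Rightarrow> int" where "finite (c ` strip v (\<chi> i. 1))"
    "\<And>u w. c u = c w \<Longrightarrow> side v (u - w) < \<epsilon>"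
    using side_coloring[OF \<epsilon>(1)] by metis
  from many_returns[of c v "\<lambda>w. side v w < \<epsilon>", OF this]
  obtain N where N: "N > 0" "\<forall>k. \<exists>A. finite A \<and> k \<le> card A * N \<and> (\<forall>a\<in>A. 0 \<le> fst a \<and> fst a < int k \<and> side v a < \<epsilon>)"
    by blast
  have "k \<le> card (strip_upto v b k :: 'n::finite lattice set) * N" for k
  proof -
    obtain A where A: "finite A" "k \<le> card A * N" "\<forall>a\<in>A. 0 \<le> fst a \<and> fst a < int k \<and> side v a < \<epsilon>"
      using N(2) by blast
    have "A \<subseteq> strip_upto v b k"
    proof
      fix a assume a: "a \<in> A"
      then have "a \<in> strip v (\<chi> i. \<epsilon>)" using A(3) by (intro side_le_imp_mem_strip) auto
      moreover have "strip v (\<chi> i. \<epsilon>) \<subseteq> strip v b" using \<epsilon>(2) by (intro strip_mono) auto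
      ultimately show "a \<in> strip_upto v b k" using A(3) a by (auto simp: strip_upto_def mem_Times_iff)
    qed
    then have "card A \<le> card (strip_upto v b k)" by (rule card_mono[OF finite_strip_upto])
    then show ?thesis using A(2) by (meson le_trans mult_le_mono1)
  qed
  then show ?thesis using N(1) by blast
qed

section \<open>Displacement of a set along the orbit\<close>

locale invariant_system =
  fixes T :: "'n::finite lattice \<Rightarrow> 'a::metric_space \<Rightarrow> 'a"
    and \<mu> :: "'a measure"
  assumes tds: "is_tds T" and inv: "\<mu> \<in> invariant_measures T"
begin

sublocale prob_space \<mu>
  using inv by (simp add: invariant_measures_def)

lemma sets_eq_borel [measurable_cong]: "sets \<mu> = sets borel"
  using inv by (simp add: invariant_measures_def)

lemma space_eq_UNIV [simp]: "space \<mu> = UNIV"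
  using sets_eq_imp_space_eq[OF sets_eq_borel] by simp

lemma T_measurable [measurable]: "T w \<in> measurable borel borel"
  using tds_borel_measurable[OF tds inv, of w]
  by (subst measurable_cong_sets[OF sets_eq_borel[symmetric] sets_eq_borel[symmetric]])

lemma continuous_on_T: "continuous_on UNIV (T w)"
  using tds unfolding is_tds_def by (meson homeomorphism_cont1)

lemma compact_UNIV: "compact (UNIV :: 'a set)"
  using tds unfolding is_tds_def by simp

lemma T_add: "T (u + w) x = T u (T w x)"
  using tds unfolding is_tds_def by (metis comp_apply)

lemma T_0 [simp]: "T 0 x = x"
  by (simp add: tds_zero[OF tds])

lemma integral_T:
  fixes f :: "'a \<Rightarrow> real"
  assumes [measurable]: "f \<in> borel_measurable borel"
  shows "(LINT x|\<mu>. f (T w x)) = (LINT x|\<mu>. f x)"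
proof -
  have "(LINT x|\<mu>. f (T w x)) = (LINT x|distr \<mu> \<mu> (T w). f x)"
    by (rule integral_distr[symmetric]) auto
  then show ?thesis by (simp add: tds_distr[OF tds inv])
qed

lemma integrable_T:
  fixes f :: "'a \<Rightarrow> real"
  assumes "integrable \<mu> f"
  shows "integrable \<mu> (\<lambda>x. f (T w x))"
  using assms integrable_distr[OF tds_borel_measurable[OF tds inv], of w f]
  by (simp add: tds_distr[OF tds inv])

lemma integrable_bounded:
  fixes f :: "'a \<Rightarrow> real"
  assumes "f \<in> borel_measurable borel" "\<And>x. \<bar>f x\<bar> \<le> C"
  shows "integrable \<mu> f"
  using assms by (intro integrable_const_bound[of _ C]) auto

definition disp :: "'a set \<Rightarrow> 'n lattice \<Rightarrow> real" where
  "disp B w = (LINT x|\<mu>. \<bar>indicat_real B (T w x) - indicat_real B x\<bar>)"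

lemma disp_nonneg: "0 \<le> disp B w"
  by (simp add: disp_def)

lemma disp_zero: "disp B 0 = 0"
  by (simp add: disp_def)

lemma integrable_indicator_diff:
  assumes [measurable]: "B \<in> sets borel"
  shows "integrable \<mu> (\<lambda>x. \<bar>indicat_real B (T u x) - indicat_real B (T w x)\<bar>)"
  by (rule integrable_bounded[of _ 1]) (auto simp: indicator_def)

text \<open>By invariance the L1 distance of two translates depends only on the difference of the
  times; subadditivity and symmetry of \<open>disp\<close> rest on this.\<close>

lemma disp_diff:
  assumes [measurable]: "B \<in> sets borel"
  shows "disp B (u - w) = (LINT x|\<mu>. \<bar>indicat_real B (T u x) - indicat_real B (T w x)\<bar>)"
proof -
  have "T u x = T (u - w) (T w x)" for x by (simp add: T_add[symmetric])
  then show ?thesis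
    unfolding disp_def
    using integral_T[of "\<lambda>x. \<bar>indicat_real B (T (u - w) x) - indicat_real B x\<bar>" w] by simp
qed

lemma disp_minus:
  assumes "B \<in> sets borel"
  shows "disp B (- w) = disp B w"
  using disp_diff[OF assms, of 0 w] disp_diff[OF assms, of w 0] by (simp add: abs_minus_commute)

lemma disp_add:
  assumes [measurable]: "B \<in> sets borel"
  shows "disp B (u + w) \<le> disp B u + disp B w"
proof -
  note i = integrable_indicator_diff[OF assms]
  have "disp B (u + w) = (LINT x|\<mu>. \<bar>indicat_real B (T (u + w) x) - indicat_real B (T 0 x)\<bar>)"
    using disp_diff[OF assms, of "u + w" 0] by simp
  also have "\<dots> \<le> (LINT x|\<mu>. \<bar>indicat_real B (T (u + w) x) - indicat_real B (T w x)\<bar> +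
      \<bar>indicat_real B (T w x) - indicat_real B (T 0 x)\<bar>)"
    by (intro integral_mono i Bochner_Integration.integrable_add) linarith
  also have "\<dots> = disp B (u + w - w) + disp B (w - 0)"
    unfolding disp_diff[OF assms] by (intro Bochner_Integration.integral_add i)
  finally show ?thesis by simp
qed

section \<open>The Kronecker algebra through total boundedness\<close>

lemma sq_integrable_indicator: "B \<in> sets borel \<Longrightarrow> indicator B \<in> sq_integrable \<mu>"
proof -
  assume [measurable]: "B \<in> sets borel"
  have "integrable \<mu> (\<lambda>x. (cmod (indicator B x))\<^sup>2)"
    by (rule integrable_bounded[of _ 1]) (auto simp: indicator_def)
  then show ?thesis by (simp add: sq_integrable_def)
qed

text \<open>A difference of indicators has absolute value 0 or 1, so squaring leaves it
  unchanged.\<close>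

lemma L2_dist_koopman:
  assumes B: "B \<in> sets borel"
  shows "L2_dist \<mu> (koopman \<mu> T u (L2_class \<mu> (indicator B))) (koopman \<mu> T w (L2_class \<mu> (indicator B)))
    = sqrt (disp B (u - w))"
proof -
  note ind = sq_integrable_indicator[OF B]
  have "(cmod (indicator B (T u x) - indicator B (T w x)))\<^sup>2 =
      \<bar>indicat_real B (T u x) - indicat_real B (T w x)\<bar>" for x
    by (simp add: indicator_def)
  then show ?thesis
    unfolding disp_diff[OF B] koopman_class[OF tds inv ind]
    by (subst L2_dist_class) (auto intro: sq_integrable_comp_tds[OF tds inv ind])
qed

text \<open>In a complete space compact closure means total boundedness, and the orbit map carries
  \<open>sqrt (disp B (u - w))\<close> to the L2 distance; radii are therefore squared or rooted on
  the way.\<close>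

lemma mem_kronecker_algebra_strip_iff:
  "B \<in> kronecker_algebra_strip \<mu> T v b \<longleftrightarrow> B \<in> sets borel \<and>
     (\<forall>\<epsilon>>0. \<exists>W. finite W \<and> W \<subseteq> strip v b \<and> (\<forall>w\<in>strip v b. \<exists>u\<in>W. disp B (w - u) < \<epsilon>))"
proof (cases "B \<in> sets borel")
  case B: True
  interpret L2: Metric_space "L2_space \<mu>" "L2_dist \<mu>" by (rule Metric_space_L2)
  define f where "f w = koopman \<mu> T w (L2_class \<mu> (indicator B))" for w
  have f: "f w \<in> L2_space \<mu>" for w
    unfolding f_def by (intro koopman_in[OF tds inv] L2_class_in sq_integrable_indicator B)
  have d: "L2_dist \<mu> (f u) (f w) < \<epsilon> \<longleftrightarrow> disp B (w - u) < \<epsilon>\<^sup>2" if "\<epsilon> > 0" for u w \<epsilon>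
  proof -
    have "L2_dist \<mu> (f u) (f w) = sqrt (disp B (w - u))"
      unfolding f_def L2_dist_koopman[OF B] using disp_minus[OF B, of "w - u"] by simp
    then show ?thesis using that real_sqrt_less_iff[of "disp B (w - u)" "\<epsilon>\<^sup>2"] by simp
  qed
  have "L2.mtotally_bounded (f ` strip v b) \<longleftrightarrow>
      (\<forall>\<epsilon>>0. \<exists>W. finite W \<and> W \<subseteq> strip v b \<and> (\<forall>w\<in>strip v b. \<exists>u\<in>W. disp B (w - u) < \<epsilon>))"
  proof (intro iffI allI impI)
    fix \<epsilon> :: real assume tb: "L2.mtotally_bounded (f ` strip v b)" and \<epsilon>: "\<epsilon> > 0"
    obtain K where K: "finite K" "K \<subseteq> f ` strip v b" "f ` strip v b \<subseteq> (\<Union>x\<in>K. L2.mball x (sqrt \<epsilon>))"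
      using tb \<epsilon> unfolding L2.mtotally_bounded_def by (meson real_sqrt_gt_zero)
    obtain W where W: "W \<subseteq> strip v b" "finite W" "K = f ` W"
      using finite_subset_image[OF K(1,2)] by blast
    have "\<exists>u\<in>W. disp B (w - u) < \<epsilon>" if w: "w \<in> strip v b" for w
    proof -
      obtain u where "u \<in> W" "L2_dist \<mu> (f u) (f w) < sqrt \<epsilon>"
        using K(3) w unfolding W(3) by (auto simp: L2.mball_def)
      then show ?thesis using d[of "sqrt \<epsilon>" u w] \<epsilon> by auto
    qed
    then show "\<exists>W. finite W \<and> W \<subseteq> strip v b \<and> (\<forall>w\<in>strip v b. \<exists>u\<in>W. disp B (w - u) < \<epsilon>)"
      using W by blast
  next
    assume net: "\<forall>\<epsilon>>0. \<exists>W. finite W \<and> W \<subseteq> strip v b \<and> (\<forall>w\<in>strip v b. \<exists>u\<in>W. disp B (w - u) < \<epsilon>)"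
    show "L2.mtotally_bounded (f ` strip v b)"
      unfolding L2.mtotally_bounded_def
    proof (intro allI impI)
      fix \<epsilon> :: real assume \<epsilon>: "\<epsilon> > 0"
      then obtain W where W: "finite W" "W \<subseteq> strip v b" "\<And>w. w \<in> strip v b \<Longrightarrow> \<exists>u\<in>W. disp B (w - u) < \<epsilon>\<^sup>2"
        using net[rule_format, of "\<epsilon>\<^sup>2"] by (metis zero_less_power)
      have "f ` strip v b \<subseteq> (\<Union>x\<in>f ` W. L2.mball x \<epsilon>)"
      proof (intro image_subsetI)
        fix w assume "w \<in> strip v b"
        then obtain u where "u \<in> W" "disp B (w - u) < \<epsilon>\<^sup>2" using W(3) by blast
        then have "f w \<in> L2.mball (f u) \<epsilon>" using d[OF \<epsilon>] f by (simp add: L2.in_mball)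
        then show "f w \<in> (\<Union>x\<in>f ` W. L2.mball x \<epsilon>)" using \<open>u \<in> W\<close> by blast
      qed
      then show "\<exists>K. finite K \<and> K \<subseteq> f ` strip v b \<and> f ` strip v b \<subseteq> (\<Union>x\<in>K. L2.mball x \<epsilon>)"
        using W(1,2) by (intro exI[of _ "f ` W"]) auto
    qed
  qed
  moreover have "L2.mtotally_bounded (f ` strip v b) \<longleftrightarrow>
      compactin L2.mtopology (L2.mtopology closure_of (f ` strip v b))"
    using L2.mtotally_bounded_eq_compact_closure_of[OF mcomplete_L2[OF finite_measure_axioms]] f by blast
  ultimately show ?thesis
    using B by (simp add: kronecker_algebra_strip_def L2_topology_def f_def)
qed (simp add: kronecker_algebra_strip_def)

text \<open>The colour of a time is a nearby point of a finite net. In this form total boundedness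
  can be fed to the pigeonhole argument of \<open>many_returns\<close>.\<close>

lemma disp_coloring:
  assumes "B \<in> kronecker_algebra_strip \<mu> T v b" "\<epsilon> > 0"
  shows "\<exists>c :: 'n lattice \<Rightarrow> 'n lattice. finite (c ` strip v b) \<and>
    (\<forall>u\<in>strip v b. \<forall>w\<in>strip v b. c u = c w \<longrightarrow> disp B (u - w) < \<epsilon>)"
proof -
  have B: "B \<in> sets borel" using assms(1) mem_kronecker_algebra_strip_iff by blast
  obtain W where W: "finite W" "\<And>w. w \<in> strip v b \<Longrightarrow> \<exists>u\<in>W. disp B (w - u) < \<epsilon> / 2"
    using assms half_gt_zero[OF assms(2)] unfolding mem_kronecker_algebra_strip_iff by meson
  obtain c where c: "\<And>w. w \<in> strip v b \<Longrightarrow> c w \<in> W \<and> disp B (w - c w) < \<epsilon> / 2"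
    using W(2) by metis
  have "disp B (u - w) < \<epsilon>" if "u \<in> strip v b" "w \<in> strip v b" "c u = c w" for u w
  proof -
    have "disp B (u - w) \<le> disp B (u - c u) + disp B (- (w - c w))"
      using disp_add[OF B, of "u - c u" "- (w - c w)"] that(3) by simp
    then show ?thesis using c[OF that(1)] c[OF that(2)] unfolding disp_minus[OF B] by simp
  qed
  moreover have "finite (c ` strip v b)" by (rule finite_subset[OF _ W(1)]) (use c in blast)
  ultimately show ?thesis by blast
qed

text \<open>Adding \<open>side\<close> forces every \<open>w\<close> with
  \<open>wdisp v B w \<le> 1\<close> into the strip of width 1. Weights that are Lipschitz in
  \<open>wdisp\<close> and vanish from radius \<open>\<eta> \<le> 1\<close> on thus need no sharp
  cut-off at the boundary of the strip.\<close>

definition wdisp :: "real \<times> (real ^ 'n) \<Rightarrow> 'a set \<Rightarrow> 'n lattice \<Rightarrow> real" where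
  "wdisp v B w = disp B w + side v w"

lemma wdisp_nonneg: "0 \<le> wdisp v B w"
  by (simp add: wdisp_def disp_nonneg side_nonneg)

lemma wdisp_add: "B \<in> sets borel \<Longrightarrow> wdisp v B (u + w) \<le> wdisp v B u + wdisp v B w"
  unfolding wdisp_def using disp_add[of B u w] side_add[of v u w] by linarith

lemma wdisp_minus: "B \<in> sets borel \<Longrightarrow> wdisp v B (- w) = wdisp v B w"
  by (simp add: wdisp_def disp_minus side_minus)

lemma wdisp_coloring:
  assumes "B \<in> kronecker_algebra_strip \<mu> T v b" "\<epsilon> > 0"
  shows "\<exists>c :: 'n lattice \<Rightarrow> 'n lattice \<times> ('n \<Rightarrow> int). finite (c ` strip v b) \<and>
    (\<forall>u\<in>strip v b. \<forall>w\<in>strip v b. c u = c w \<longrightarrow> wdisp v B (u - w) < \<epsilon>)"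
proof -
  obtain c1 :: "'n lattice \<Rightarrow> 'n lattice" where c1: "finite (c1 ` strip v b)"
    "\<And>u w. u \<in> strip v b \<Longrightarrow> w \<in> strip v b \<Longrightarrow> c1 u = c1 w \<Longrightarrow> disp B (u - w) < \<epsilon> / 2"
    using disp_coloring[OF assms(1) half_gt_zero[OF assms(2)]] by metis
  obtain c2 :: "'n lattice \<Rightarrow> 'n \<Rightarrow> int" where c2: "finite (c2 ` strip v b)"
    "\<And>u w. c2 u = c2 w \<Longrightarrow> side v (u - w) < \<epsilon> / 2"
    using side_coloring[OF half_gt_zero[OF assms(2)]] by metis
  have "finite ((\<lambda>w. (c1 w, c2 w)) ` strip v b)"
    by (rule finite_subset[OF _ finite_cartesian_product[OF c1(1) c2(1)]]) blast
  moreover have "wdisp v B (u - w) < \<epsilon>" if "u \<in> strip v b" "w \<in> strip v b" "c1 u = c1 w" "c2 u = c2 w" for u w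
    using c1(2)[OF that(1-3)] c2(2)[OF that(4)] by (simp add: wdisp_def)
  ultimately show ?thesis by (intro exI[of _ "\<lambda>w. (c1 w, c2 w)"]) simp
qed

lemma wdisp_net:
  assumes "B \<in> kronecker_algebra_strip \<mu> T v b" "\<epsilon> > 0"
  shows "\<exists>W. finite W \<and> W \<subseteq> strip v b \<and> (\<forall>w\<in>strip v b. \<exists>u\<in>W. wdisp v B (w - u) < \<epsilon>)"
proof -
  obtain c :: "'n lattice \<Rightarrow> 'n lattice \<times> ('n \<Rightarrow> int)" where c: "finite (c ` strip v b)"
    "\<And>u w. u \<in> strip v b \<Longrightarrow> w \<in> strip v b \<Longrightarrow> c u = c w \<Longrightarrow> wdisp v B (u - w) < \<epsilon>"
    using wdisp_coloring[OF assms] by metis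
  define W where "W = inv_into (strip v b) c ` c ` strip v b"
  have "finite W" unfolding W_def using c(1) by (rule finite_imageI)
  moreover have "W \<subseteq> strip v b" unfolding W_def by (intro image_subsetI inv_into_into)
  moreover have "\<exists>u\<in>W. wdisp v B (w - u) < \<epsilon>" if w: "w \<in> strip v b" for w
  proof
    show u: "inv_into (strip v b) c (c w) \<in> W" unfolding W_def using w by blast
    show "wdisp v B (w - inv_into (strip v b) c (c w)) < \<epsilon>"
      using w by (intro c(2) inv_into_into) (simp_all add: f_inv_into_f)
  qed
  ultimately show ?thesis by blast
qed

section \<open>Lusin sets\<close>


lemma prob_Int_gt:
  assumes "A \<in> sets borel" "B \<in> sets borel" "prob A > 1 - a" "prob B > 1 - b"
  shows "prob (A \<inter> B) > 1 - (a + b)"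
proof -
  have "A \<union> B \<in> events" "A \<in> events" "B \<in> events" using assms(1,2) by (auto simp: sets_eq_borel)
  then have "prob (A \<union> B) = prob A + prob B - prob (A \<inter> B)"
    by (simp add: measure_Un3 fmeasurable_eq_sets)
  moreover have "prob (A \<union> B) \<le> 1" by simp
  ultimately show ?thesis using assms(3,4) by linarith
qed

text \<open>One more than the cardinality keeps the inequality strict when \<open>I\<close> is
  empty.\<close>

lemma prob_INT_gt:
  assumes "finite I" "\<And>i. i \<in> I \<Longrightarrow> K i \<in> sets borel" "\<And>i. i \<in> I \<Longrightarrow> prob (K i) > 1 - a" "a > 0"
  shows "prob (\<Inter>i\<in>I. K i) > 1 - (real (card I) + 1) * a"
  using assms
proof (induction I)
  case empty
  then show ?case using prob_space by simp
next
  case (insert i I)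
  have "(\<Inter>i\<in>I. K i) \<in> sets borel"
    using insert by (cases "I = {}") auto
  then have "prob (K i \<inter> (\<Inter>i\<in>I. K i)) > 1 - (a + (real (card I) + 1) * a)"
    using insert by (intro prob_Int_gt) auto
  then show ?case using insert by (simp add: algebra_simps)
qed

text \<open>Lusin's theorem for an indicator, stated with a uniform \<open>\<delta>\<close> on
  \<open>K\<close>; this replaces compactness of \<open>K\<close> combined with relative
  continuity.\<close>

definition lusin_set :: "'a set \<Rightarrow> bool" where
  "lusin_set A \<longleftrightarrow> (\<forall>\<epsilon>>0. \<exists>K\<in>sets borel. \<exists>\<delta>>0. prob K > 1 - \<epsilon> \<and>
     (\<forall>x\<in>K. \<forall>y\<in>K. dist x y < \<delta> \<longrightarrow> (x \<in> A \<longleftrightarrow> y \<in> A)))"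

lemma lusin_set_open:
  assumes "open U"
  shows "lusin_set U"
\<comment> \<open>The whole space is split off because \<open>infdist x {}\<close> is 0 by
  convention, which would make the sets \<open>C n\<close> below empty.\<close>
proof (cases "U = UNIV")
  case True
  then show ?thesis unfolding lusin_set_def using prob_space
    by (intro allI impI bexI[of _ UNIV] exI[of _ 1]) auto
next
  case False
  show ?thesis unfolding lusin_set_def
  proof (intro allI impI)
    fix \<epsilon> :: real assume \<epsilon>: "\<epsilon> > 0"
    define C where "C n = {x. infdist x (- U) \<ge> 1 / real (Suc n)} \<union> - U" for n
    have Cm: "C n \<in> sets borel" for n
      unfolding C_def using assms
      by (intro sets.Un borel_closed closed_Collect_le continuous_intros) auto
    have inc: "incseq C"
    proof (rule incseq_SucI)
      fix n have "1 / real (Suc (Suc n)) \<le> 1 / real (Suc n)" by (simp add: frac_le)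
      then show "C n \<subseteq> C (Suc n)" unfolding C_def by (auto intro: order_trans)
    qed
    have "(\<Union>n. C n) = UNIV"
    proof (intro equalityI subset_UNIV subsetI)
      fix x :: 'a
      show "x \<in> (\<Union>n. C n)"
      proof (cases "x \<in> U")
        case True
        have "closed (- U)" "- U \<noteq> {}" using assms False by auto
        then have "infdist x (- U) > 0"
          using True in_closed_iff_infdist_zero[of "- U" x] infdist_nonneg[of x "- U"] by fastforce
        then obtain n where "1 / real (Suc n) < infdist x (- U)"
          using nat_approx_posE by blast
        then show ?thesis unfolding C_def by (auto intro!: exI[of _ n])
      qed (auto simp: C_def)
    qed
    then have "(\<lambda>n. prob (C n)) \<longlonglongrightarrow> 1"
      using finite_Lim_measure_incseq[OF _ inc] Cm prob_space by (auto simp: sets_eq_borel)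
    then have "eventually (\<lambda>n. prob (C n) > 1 - \<epsilon>) sequentially"
      using \<epsilon> by (intro order_tendstoD(1)) auto
    then obtain n where n: "prob (C n) > 1 - \<epsilon>"
      by (auto simp: eventually_sequentially)
    have "x \<in> U \<longleftrightarrow> y \<in> U" if "x \<in> C n" "y \<in> C n" "dist x y < 1 / real (Suc n)" for x y
    proof -
      have *: "b \<in> U" if "a \<in> C n" "a \<in> U" "dist a b < 1 / real (Suc n)" for a b
      proof (rule ccontr)
        assume "b \<notin> U"
        then have "infdist a (- U) \<le> dist a b" by (intro infdist_le) auto
        then show False using that by (simp add: C_def)
      qed
      show ?thesis using *[of x y] *[of y x] that by (auto simp: dist_commute)
    qed
    moreover have "1 / real (Suc n) > 0" by simp
    ultimately show "\<exists>K\<in>sets borel. \<exists>\<delta>>0. prob K > 1 - \<epsilon> \<and>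
        (\<forall>x\<in>K. \<forall>y\<in>K. dist x y < \<delta> \<longrightarrow> (x \<in> U \<longleftrightarrow> y \<in> U))"
      using n Cm by blast
  qed
qed

text \<open>By continuity of the measure a finite union already fills the whole union up to a small
  set \<open>E\<close>. Off \<open>E\<close> membership is decided by finitely many
  \<open>A n\<close>, so finitely many Lusin sets can be intersected.\<close>

lemma lusin_set_UN:
  assumes A: "\<And>n::nat. lusin_set (A n)" and [measurable]: "\<And>n. A n \<in> sets borel"
  shows "lusin_set (\<Union>n. A n)"
  unfolding lusin_set_def
proof (intro allI impI)
  fix \<epsilon> :: real assume \<epsilon>: "\<epsilon> > 0"
  define U where "U n = (\<Union>i<n. A i)" for n
  have "incseq U" unfolding U_def by (rule incseq_SucI) (auto simp: less_Suc_eq)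
  moreover have "(\<Union>n. U n) = (\<Union>n. A n)" unfolding U_def by auto
  moreover have [measurable]: "U n \<in> sets borel" for n unfolding U_def by measurable
  ultimately have "(\<lambda>n. prob (U n)) \<longlonglongrightarrow> prob (\<Union>n. A n)"
    using finite_Lim_measure_incseq[of U] by (simp add: sets_eq_borel image_subset_iff)
  then have "eventually (\<lambda>n. prob (U n) > prob (\<Union>n. A n) - \<epsilon> / 2) sequentially"
    using \<epsilon> by (intro order_tendstoD(1)) auto
  then obtain N where N: "prob (U N) > prob (\<Union>n. A n) - \<epsilon> / 2"
    by (auto simp: eventually_sequentially)
  define E where "E = (\<Union>n. A n) - U N"
  have Em[measurable]: "E \<in> sets borel" unfolding E_def by measurable
  have "prob E = prob (\<Union>n. A n) - prob (U N)"
    unfolding E_def by (rule finite_measure_Diff) (auto simp: U_def sets_eq_borel)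
  then have E: "prob (- E) > 1 - \<epsilon> / 2"
    using prob_compl[of E] N by (simp add: Compl_eq_Diff_UNIV sets_eq_borel)
  \<comment> \<open>Half of \<open>\<epsilon>\<close> goes to \<open>E\<close>, the other half is
    shared as \<open>prob_INT_gt\<close> demands.\<close>
  define \<eta> where "\<eta> = \<epsilon> / (2 * (real N + 1))"
  have \<eta>: "\<eta> > 0" "(real N + 1) * \<eta> = \<epsilon> / 2" using \<epsilon> by (auto simp: \<eta>_def field_simps)
  have "\<forall>n. \<exists>K \<delta>. K \<in> sets borel \<and> \<delta> > 0 \<and> prob K > 1 - \<eta> \<and>
      (\<forall>x\<in>K. \<forall>y\<in>K. dist x y < \<delta> \<longrightarrow> (x \<in> A n \<longleftrightarrow> y \<in> A n))"
    using A \<eta>(1) unfolding lusin_set_def by meson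
  then obtain K \<delta> where K: "\<And>n. K n \<in> sets borel" "\<And>n. \<delta> n > 0" "\<And>n. prob (K n) > 1 - \<eta>"
    "\<And>n x y. x \<in> K n \<Longrightarrow> y \<in> K n \<Longrightarrow> dist x y < \<delta> n \<Longrightarrow> (x \<in> A n \<longleftrightarrow> y \<in> A n)"
    by metis
  define K' where "K' = - E \<inter> (\<Inter>n\<in>{..<N}. K n)"
  define \<delta>' where "\<delta>' = Min (insert 1 (\<delta> ` {..<N}))"
  have KI: "(\<Inter>n\<in>{..<N}. K n) \<in> sets borel"
    using K(1) by (intro sets.countable_INT'') auto
  have "prob (\<Inter>n\<in>{..<N}. K n) > 1 - \<epsilon> / 2"
    using prob_INT_gt[of "{..<N}" K \<eta>] K(1,3) \<eta> by simp
  then have "prob K' > 1 - \<epsilon>"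
    unfolding K'_def using prob_Int_gt[OF _ KI E, of "\<epsilon> / 2"] by simp
  moreover have "K' \<in> sets borel" unfolding K'_def using KI by simp
  moreover have "\<delta>' > 0" unfolding \<delta>'_def using K(2) by (subst Min_gr_iff) auto
  moreover have "x \<in> (\<Union>n. A n) \<longleftrightarrow> y \<in> (\<Union>n. A n)" if xy: "x \<in> K'" "y \<in> K'" "dist x y < \<delta>'" for x y
  proof -
    have *: "z \<in> (\<Union>n. A n) \<longleftrightarrow> (\<exists>n<N. z \<in> A n)" if "z \<in> K'" for z
      using that unfolding K'_def E_def U_def by auto
    have "x \<in> A n \<longleftrightarrow> y \<in> A n" if n: "n < N" for n
    proof (rule K(4))
      show "x \<in> K n" "y \<in> K n" using xy n by (auto simp: K'_def)
      have "\<delta>' \<le> \<delta> n" unfolding \<delta>'_def using n by (intro Min_le) auto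
      then show "dist x y < \<delta> n" using xy by simp
    qed
    then show ?thesis using *[OF xy(1)] *[OF xy(2)] by blast
  qed
  ultimately show "\<exists>K\<in>sets borel. \<exists>\<delta>>0. prob K > 1 - \<epsilon> \<and>
      (\<forall>x\<in>K. \<forall>y\<in>K. dist x y < \<delta> \<longrightarrow> (x \<in> (\<Union>n. A n) \<longleftrightarrow> y \<in> (\<Union>n. A n)))" by blast
qed

text \<open>The property is symmetric in a set and its complement, so the induction over the
  sigma-algebra needs work only for open sets and countable unions.\<close>

lemma lusin_set_borel:
  assumes "A \<in> sets borel"
  shows "lusin_set A"
proof -
  have "A \<in> sigma_sets UNIV {S. open S}" using assms by (simp add: borel_def)
  then show ?thesis
  proof (induction A)
    case (Basic a) then show ?case by (simp add: lusin_set_open)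
  next
    case Empty show ?case using lusin_set_open[of "{}"] by simp
  next
    case (Compl a) then show ?case unfolding lusin_set_def by simp
  next
    case (Union a)
    then have "a i \<in> sets borel" for i by (simp add: borel_def)
    then show ?case using Union by (intro lusin_set_UN)
  qed
qed

text \<open>Values in [0, 1] leave finitely many relevant levels \<open>n * \<eta>\<close>. Two
  points lying in the same superlevel sets have values at most \<open>\<eta>\<close> apart.\<close>

lemma lusin:
  assumes "finite I" "\<And>i. i \<in> I \<Longrightarrow> f i \<in> borel_measurable borel"
    and bd: "\<And>i x. i \<in> I \<Longrightarrow> 0 \<le> f i x \<and> f i x \<le> (1::real)" and "\<eta> > 0" "\<epsilon> > 0"
  shows "\<exists>K\<in>sets borel. \<exists>\<delta>>0. prob K > 1 - \<epsilon> \<and>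
    (\<forall>x\<in>K. \<forall>y\<in>K. dist x y < \<delta> \<longrightarrow> (\<forall>i\<in>I. \<bar>f i x - f i y\<bar> \<le> \<eta>))"
proof -
  define J where "J = I \<times> {..nat \<lfloor>1 / \<eta>\<rfloor>}"
  have J: "finite J" unfolding J_def using assms(1) by simp
  define L where "L = (\<lambda>(i, n::nat). {x. f i x \<ge> real n * \<eta>})"
  have Lm: "L j \<in> sets borel" if "j \<in> J" for j
    using that assms(2) unfolding L_def J_def by (auto intro!: borel_measurable_le)
  define \<theta> where "\<theta> = \<epsilon> / (real (card J) + 1)"
  have \<theta>: "\<theta> > 0" "(real (card J) + 1) * \<theta> = \<epsilon>" using assms(5) by (auto simp: \<theta>_def field_simps)
  have "\<forall>j\<in>J. \<exists>K \<delta>. K \<in> sets borel \<and> \<delta> > 0 \<and> prob K > 1 - \<theta> \<and>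
      (\<forall>x\<in>K. \<forall>y\<in>K. dist x y < \<delta> \<longrightarrow> (x \<in> L j \<longleftrightarrow> y \<in> L j))"
    using lusin_set_borel[OF Lm] \<theta>(1) unfolding lusin_set_def by meson
  then obtain K \<delta> where K: "\<And>j. j \<in> J \<Longrightarrow> K j \<in> sets borel" "\<And>j. j \<in> J \<Longrightarrow> \<delta> j > 0"
    "\<And>j. j \<in> J \<Longrightarrow> prob (K j) > 1 - \<theta>"
    "\<And>j x y. j \<in> J \<Longrightarrow> x \<in> K j \<Longrightarrow> y \<in> K j \<Longrightarrow> dist x y < \<delta> j \<Longrightarrow> (x \<in> L j \<longleftrightarrow> y \<in> L j)"
    by metis
  define K' where "K' = (\<Inter>j\<in>J. K j)"
  define \<delta>' where "\<delta>' = Min (insert 1 (\<delta> ` J))"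
  have "K' \<in> sets borel" unfolding K'_def
    using K(1) countable_finite[OF J] by (intro sets.countable_INT'') auto
  moreover have "prob K' > 1 - \<epsilon>"
    unfolding K'_def using prob_INT_gt[OF J, of K \<theta>] K(1,3) \<theta> by simp
  moreover have "\<delta>' > 0" unfolding \<delta>'_def using K(2) J by (subst Min_gr_iff) auto
  moreover have "\<bar>f i x - f i y\<bar> \<le> \<eta>" if xy: "x \<in> K'" "y \<in> K'" "dist x y < \<delta>'" "i \<in> I" for x y i
  proof -
    have *: "real n * \<eta> \<le> f i x \<longleftrightarrow> real n * \<eta> \<le> f i y" if "n \<le> nat \<lfloor>1 / \<eta>\<rfloor>" for n
    proof -
      have j: "(i, n) \<in> J" unfolding J_def using that xy(4) by simp
      have "\<delta>' \<le> \<delta> (i, n)" unfolding \<delta>'_def using j J by (intro Min_le) auto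
      then have "x \<in> L (i, n) \<longleftrightarrow> y \<in> L (i, n)"
        using xy j by (intro K(4)) (auto simp: K'_def)
      then show ?thesis by (simp add: L_def)
    qed
    have le: "f i a \<le> f i b + \<eta>"
      if a: "\<And>n. n \<le> nat \<lfloor>1 / \<eta>\<rfloor> \<Longrightarrow> real n * \<eta> \<le> f i a \<Longrightarrow> real n * \<eta> \<le> f i b" for a b
    proof -
      define n where "n = nat \<lfloor>f i a / \<eta>\<rfloor>"
      have "f i a / \<eta> \<le> 1 / \<eta>" using bd[OF xy(4)] assms(4) by (intro divide_right_mono) auto
      then have "n \<le> nat \<lfloor>1 / \<eta>\<rfloor>" unfolding n_def by (intro nat_mono floor_mono)
      moreover have "0 \<le> f i a / \<eta>" using bd[OF xy(4)] assms(4) by simp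
      then have "real n = of_int \<lfloor>f i a / \<eta>\<rfloor>" unfolding n_def by simp
      then have "real n \<le> f i a / \<eta>" "f i a / \<eta> < real n + 1"
        using floor_correct[of "f i a / \<eta>"] by simp_all
      then have "real n * \<eta> \<le> f i a" "f i a < (real n + 1) * \<eta>" using assms(4) by (simp_all add: field_simps)
      ultimately have "real n * \<eta> \<le> f i b" "f i a < (real n + 1) * \<eta>" using a by auto
      then show ?thesis by (simp add: algebra_simps)
    qed
    show ?thesis using le[of x y] le[of y x] * by (auto simp: abs_le_iff)
  qed
  ultimately show ?thesis by blast
qed

end

section \<open>A maximal inequality along the strip\<close>

text \<open>Rising sun: the bad starting points in \<open>[m, N)\<close> are covered greedily, from left to right, by
  disjoint intervals of length at most \<open>L\<close> on which the average of \<open>a\<close> exceeds \<open>t\<close>.\<close>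

lemma rising_sun_count:
  fixes a :: "nat \<Rightarrow> real"
  assumes a: "\<And>n. 0 \<le> a n" and t: "0 \<le> t"
    and bad: "\<And>m. m \<in> M \<Longrightarrow> \<exists>k\<ge>1. k \<le> L \<and> t * real k \<le> (\<Sum>n\<in>{m..<m + k}. a n)"
  shows "t * real (card (M \<inter> {m..<N})) \<le> (\<Sum>n\<in>{m..<N + L}. a n)"
proof (induction "N - m" arbitrary: m rule: less_induct)
  case less
  show ?case
  proof (cases "m < N")
    case False
    then show ?thesis using a by (simp add: sum_nonneg)
  next
    case mN: True
    show ?thesis
    proof (cases "m \<in> M")
      case False
      then have "x \<in> M \<Longrightarrow> m \<le> x \<longleftrightarrow> Suc m \<le> x" for x by (cases "x = m") auto
      then have "M \<inter> {m..<N} = M \<inter> {Suc m..<N}" by auto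
      moreover have "N - Suc m < N - m" using mN by simp
      ultimately have "t * real (card (M \<inter> {m..<N})) \<le> (\<Sum>n\<in>{Suc m..<N + L}. a n)"
        using less by metis
      also have "\<dots> \<le> (\<Sum>n\<in>{m..<N + L}. a n)"
        using a by (intro sum_mono2) auto
      finally show ?thesis .
    next
      case True
      then obtain k where k: "k \<ge> 1" "k \<le> L" "t * real k \<le> (\<Sum>n\<in>{m..<m + k}. a n)"
        using bad by blast
      have "card (M \<inter> {m..<N}) \<le> card ({m..<m + k} \<union> (M \<inter> {m + k..<N}))"
        by (intro card_mono) auto
      also have "\<dots> \<le> k + card (M \<inter> {m + k..<N})"
        by (rule order_trans[OF card_Un_le]) simp
      finally have "t * real (card (M \<inter> {m..<N})) \<le> t * real (k + card (M \<inter> {m + k..<N}))"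
        using t by (intro mult_left_mono) auto
      also have "\<dots> = t * real k + t * real (card (M \<inter> {m + k..<N}))" by (simp add: algebra_simps)
      also have "\<dots> \<le> (\<Sum>n\<in>{m..<m + k}. a n) + (\<Sum>n\<in>{m + k..<N + L}. a n)"
        using k mN less[of "m + k"] by (intro add_mono) auto
      also have "\<dots> = (\<Sum>n\<in>{m..<N + L}. a n)"
        using k mN by (intro sum.atLeastLessThan_concat) auto
      finally show ?thesis .
    qed
  qed
qed

text \<open>The spine is a homomorphism up to rounding: \<open>\<lfloor>x + y\<rfloor> -
  \<lfloor>x\<rfloor> - \<lfloor>y\<rfloor>\<close> is 0 or 1.\<close>

lemma exists_spine_add:
  "\<exists>e\<in>cube 1. spine v m + spine v n = spine v (m + n) + (0, - e)"
proof
  let ?e = "\<chi> i. \<lfloor>snd v $ i * real_of_int (m + n)\<rfloor> - \<lfloor>snd v $ i * real_of_int m\<rfloor> - \<lfloor>snd v $ i * real_of_int n\<rfloor>"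
  show "spine v m + spine v n = spine v (m + n) + (0, - ?e)"
    by (simp add: spine_def vec_eq_iff)
  have "\<lfloor>x + y\<rfloor> - \<lfloor>x\<rfloor> - \<lfloor>y\<rfloor> \<in> {-1..1}" for x y :: real
    by (simp, linarith)
  then show "?e \<in> cube 1" unfolding cube_def by (simp add: ring_distribs)
qed

context invariant_system
begin

definition box_sum :: "int \<Rightarrow> ('a \<Rightarrow> real) \<Rightarrow> 'a \<Rightarrow> real" where
  "box_sum r h x = (\<Sum>j\<in>cube r. h (T (0, j) x))"

lemma box_sum_nonneg: "(\<And>x. 0 \<le> h x) \<Longrightarrow> 0 \<le> box_sum r h x"
  by (simp add: box_sum_def sum_nonneg)

lemma box_sum_measurable [measurable]:
  "h \<in> borel_measurable borel \<Longrightarrow> box_sum r h \<in> borel_measurable borel"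
  unfolding box_sum_def by (intro borel_measurable_sum measurable_compose[OF T_measurable])

lemma integrable_box_sum: "integrable \<mu> h \<Longrightarrow> integrable \<mu> (box_sum r h)"
  unfolding box_sum_def by (intro Bochner_Integration.integrable_sum integrable_T)

lemma integral_box_sum:
  assumes "integrable \<mu> h"
  shows "(LINT x|\<mu>. box_sum r h x) = real (card (cube r :: (int^'n) set)) * (LINT x|\<mu>. h x)"
proof -
  have "h \<in> borel_measurable borel" using assms by auto
  then show ?thesis
    unfolding box_sum_def using assms integrable_T[OF assms] integral_T[of h]
    by (subst Bochner_Integration.integral_sum) auto
qed

text \<open>The rounding error \<open>e\<close> translates the cube of radius \<open>r\<close> into
  the one of radius \<open>r + 1\<close>; nonnegativity of \<open>h\<close> pays for the additional
  terms.\<close>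

lemma box_sum_spine:
  assumes "\<And>x. 0 \<le> h x"
  shows "box_sum r h (T (spine v n) (T (spine v m) x)) \<le> box_sum (r + 1) h (T (spine v (m + n)) x)"
proof -
  obtain e where e: "e \<in> cube 1" "spine v n + spine v m = spine v (n + m) + (0, - e)"
    using exists_spine_add by blast
  have "T (0, j) (T (spine v n) (T (spine v m) x)) = T (0, j - e) (T (spine v (m + n)) x)" for j
  proof -
    have "(0, j) + (spine v n + spine v m) = (0, j - e) + spine v (m + n)"
      unfolding e(2) by (simp add: prod_eq_iff add.commute)
    then show ?thesis by (simp add: T_add[symmetric])
  qed
  then have "box_sum r h (T (spine v n) (T (spine v m) x)) =
      (\<Sum>j\<in>cube r. h (T (0, j - e) (T (spine v (m + n)) x)))"
    by (simp add: box_sum_def)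
  also have "\<dots> = (\<Sum>j\<in>(\<lambda>j. j - e) ` cube r. h (T (0, j) (T (spine v (m + n)) x)))"
    by (subst sum.reindex) (auto simp: inj_on_def)
  also have "\<dots> \<le> box_sum (r + 1) h (T (spine v (m + n)) x)"
    unfolding box_sum_def
  proof (intro sum_mono2 finite_cube)
    show "(\<lambda>j. j - e) ` cube r \<subseteq> cube (r + 1)"
    proof (intro image_subsetI)
      fix j :: "int^'n" assume "j \<in> cube r"
      then have "- r \<le> j $ i \<and> j $ i \<le> r" "- 1 \<le> e $ i \<and> e $ i \<le> 1" for i
        using e(1) by (auto simp: cube_def)
      then show "j - e \<in> cube (r + 1)"
        unfolding cube_def by (auto) (smt (verit, best))+
    qed
  qed (use assms in auto)
  finally show ?thesis .
qed

text \<open>Transference: the counting bound holds along every single orbit, and integrating it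
  against the invariant measure turns the count of bad times into the measure of the bad set. The
  radius grows by one because the orbit is restarted at each spine point.\<close>

lemma maximal_inequality_spine:
  fixes h :: "'a \<Rightarrow> real" and r :: int and v :: "real \<times> (real ^ 'n)"
  assumes h0: "\<And>x. 0 \<le> h x" and hi: "integrable \<mu> h" and t: "t > 0"
  defines "E \<equiv> {x. \<exists>k. t * real k < (\<Sum>n<k. box_sum r h (T (spine v (int n)) x))}"
  shows "E \<in> sets borel" "t * prob E \<le> 2 * real (card (cube (r + 1) :: (int^'n) set)) * (LINT x|\<mu>. h x)"
proof -
  have hm[measurable]: "h \<in> borel_measurable borel" using hi by auto
  define c where "c = real (card (cube (r + 1) :: (int^'n) set)) * (LINT x|\<mu>. h x)"
  \<comment> \<open>\<open>rising_sun_count\<close> needs a bound on the length of the intervals;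
    \<open>L\<close> tends to infinity at the end.\<close>
  define E' where "E' L = {x. \<exists>k\<in>{..L}. t * real k < (\<Sum>n<k. box_sum r h (T (spine v (int n)) x))}" for L
  have bm[measurable]: "(\<lambda>x. box_sum q h (T w x)) \<in> borel_measurable borel" for q w
    by (intro measurable_compose[OF T_measurable] box_sum_measurable hm)
  have [measurable]: "E' L \<in> sets borel" for L unfolding E'_def by measurable
  have EU: "E = (\<Union>L. E' L)" unfolding E_def E'_def by auto
  then show E: "E \<in> sets borel" by simp
  have bound: "t * prob (E' L) \<le> 2 * c" if L: "L \<ge> 1" for L
  proof -
    have pt: "t * (\<Sum>m<L. indicat_real (E' L) (T (spine v (int m)) x)) \<le>
        (\<Sum>n<2 * L. box_sum (r + 1) h (T (spine v (int n)) x))" for x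
    proof -
      define a where "a n = box_sum (r + 1) h (T (spine v (int n)) x)" for n
      define M where "M = {m. T (spine v (int m)) x \<in> E' L}"
      have bad: "\<exists>k\<ge>1. k \<le> L \<and> t * real k \<le> (\<Sum>n\<in>{m..<m + k}. a n)" if "m \<in> M" for m
      proof -
        obtain k where k: "k \<le> L" "t * real k < (\<Sum>n<k. box_sum r h (T (spine v (int n)) (T (spine v (int m)) x)))"
          using \<open>m \<in> M\<close> by (auto simp: M_def E'_def)
        have "k \<ge> 1" using k(2) by (cases k) auto
        note k(2)
        also have "(\<Sum>n<k. box_sum r h (T (spine v (int n)) (T (spine v (int m)) x))) \<le> (\<Sum>n<k. a (m + n))"
          unfolding a_def of_nat_add by (intro sum_mono box_sum_spine h0)
        also have "\<dots> = (\<Sum>n\<in>{m..<m + k}. a n)"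
          using sum.shift_bounds_nat_ivl[of a 0 m k] by (simp add: add.commute atLeast0LessThan)
        finally show ?thesis using k(1) \<open>k \<ge> 1\<close> by (intro exI[of _ k]) simp
      qed
      \<comment> \<open>Intervals that start in \<open>[0, L)\<close> end before \<open>2 L\<close>.
        After integration the left side carries the factor \<open>L\<close> and the right side
        \<open>2 L\<close>, which leaves the constant 2 whatever \<open>L\<close> is.\<close>
      have "t * real (card (M \<inter> {0..<L})) \<le> (\<Sum>n\<in>{0..<L + L}. a n)"
        using bad t by (intro rising_sun_count) (auto simp: a_def intro: box_sum_nonneg h0)
      moreover have "(\<Sum>m<L. indicat_real (E' L) (T (spine v (int m)) x)) = real (card (M \<inter> {0..<L}))"
      proof -
        have "(\<Sum>m<L. indicat_real (E' L) (T (spine v (int m)) x)) = (\<Sum>m<L. if m \<in> M then 1 else 0)"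
          by (intro sum.cong) (auto simp: M_def indicator_def)
        also have "\<dots> = real (card (M \<inter> {0..<L}))"
          by (simp add: sum.If_cases atLeast0LessThan Int_commute)
        finally show ?thesis .
      qed
      ultimately show ?thesis by (simp add: a_def atLeast0LessThan mult_2)
    qed
    have i1: "integrable \<mu> (\<lambda>x. indicat_real (E' L) (T w x))" for w
      by (rule integrable_bounded[of _ 1]) (auto simp: indicator_def)
    have i2: "integrable \<mu> (\<lambda>x. box_sum (r + 1) h (T w x))" for w
      by (intro integrable_T integrable_box_sum hi)
    have "(LINT x|\<mu>. t * (\<Sum>m<L. indicat_real (E' L) (T (spine v (int m)) x))) \<le>
        (LINT x|\<mu>. (\<Sum>n<2 * L. box_sum (r + 1) h (T (spine v (int n)) x)))"
      using pt i1 i2 by (intro integral_mono) auto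
    moreover have "(LINT x|\<mu>. t * (\<Sum>m<L. indicat_real (E' L) (T (spine v (int m)) x))) = real L * (t * prob (E' L))"
      using i1 integral_T[of "indicat_real (E' L)"] by simp
    moreover have "(LINT x|\<mu>. (\<Sum>n<2 * L. box_sum (r + 1) h (T (spine v (int n)) x))) = real L * (2 * c)"
      using i2 integral_T[of "box_sum (r + 1) h"] integral_box_sum[OF hi]
      by (simp add: c_def)
    ultimately have "real L * (t * prob (E' L)) \<le> real L * (2 * c)" by linarith
    then show ?thesis using L by (simp add: mult_le_cancel_left_pos)
  qed
  have "incseq E'" unfolding E'_def by (rule incseq_SucI) auto
  then have "(\<lambda>L. prob (E' L)) \<longlonglongrightarrow> prob E"
    unfolding EU by (intro finite_Lim_measure_incseq) (simp_all add: sets_eq_borel image_subset_iff)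
  then have "(\<lambda>L. t * prob (E' L)) \<longlonglongrightarrow> t * prob E" by (intro tendsto_intros)
  then have "t * prob E \<le> 2 * c"
    by (rule LIMSEQ_le_const2) (use bound in blast)
  then show "t * prob E \<le> 2 * real (card (cube (r + 1) :: (int^'n) set)) * (LINT x|\<mu>. h x)"
    by (simp add: c_def)
qed

text \<open>Each strip point is a spine point plus a vector of the cube, and different pairs give
  different lattice points; for nonnegative \<open>h\<close> the surplus pairs only increase the
  sum.\<close>

lemma strip_sum_le_box_sum:
  "\<exists>r. \<forall>h k x. (\<forall>x. 0 \<le> h x) \<longrightarrow>
    (\<Sum>w\<in>strip_upto v b k. h (T w x)) \<le> (\<Sum>n<k. box_sum r h (T (spine v (int n)) x))"
proof -
  obtain r where r: "\<forall>w\<in>strip v b. \<exists>j\<in>cube r. w = spine v (fst w) + (0, j)"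
    using exists_cube by blast
  have "(\<Sum>w\<in>strip_upto v b k. h (T w x)) \<le> (\<Sum>n<k. box_sum r h (T (spine v (int n)) x))"
    if h: "\<forall>x. 0 \<le> h x" for h :: "'a \<Rightarrow> real" and k x
  proof -
    define g where "g = (\<lambda>(n::nat, j). (0, j) + spine v (int n))"
    have fin: "finite ({..<k} \<times> (cube r :: (int^'n) set))" by (simp add: finite_cube)
    have inj: "inj_on g ({..<k} \<times> cube r)"
      by (auto simp: inj_on_def g_def spine_def)
    have "strip_upto v b k \<subseteq> g ` ({..<k} \<times> cube r)"
    proof
      fix w assume w: "w \<in> strip_upto v b k"
      then have "w \<in> strip v b" "0 \<le> fst w" "fst w < int k" by (auto simp: strip_upto_def)
      moreover from this obtain j where j: "j \<in> cube r" "w = spine v (fst w) + (0, j)" using r by blast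
      ultimately show "w \<in> g ` ({..<k} \<times> cube r)"
        by (intro image_eqI[of _ _ "(nat (fst w), j)"]) (auto simp: g_def add.commute)
    qed
    then have "(\<Sum>w\<in>strip_upto v b k. h (T w x)) \<le> (\<Sum>w\<in>g ` ({..<k} \<times> cube r). h (T w x))"
      using h fin by (intro sum_mono2) auto
    also have "\<dots> = (\<Sum>p\<in>{..<k} \<times> cube r. h (T (g p) x))"
      using inj by (subst sum.reindex) auto
    also have "\<dots> = (\<Sum>n<k. \<Sum>j\<in>cube r. h (T (g (n, j)) x))"
      by (simp add: sum.cartesian_product)
    also have "\<dots> = (\<Sum>n<k. box_sum r h (T (spine v (int n)) x))"
      by (simp add: g_def box_sum_def T_add)
    finally show ?thesis .
  qed
  then show ?thesis by blast
qed

lemma maximal_inequality: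
  assumes "b \<in> pos_vectors"
  shows "\<exists>C>0. \<forall>h t. (\<forall>x. 0 \<le> h x) \<longrightarrow> integrable \<mu> h \<longrightarrow> t > 0 \<longrightarrow>
    (\<exists>K\<in>sets borel. prob K \<ge> 1 - C * (LINT x|\<mu>. h x) / t \<and>
      (\<forall>x\<in>K. \<forall>k. (\<Sum>w\<in>strip_upto v b k. h (T w x)) \<le> t * real (card (strip_upto v b k))))"
proof -
  obtain N where N: "N > 0" "\<And>k. k \<le> card (strip_upto v b k :: 'n lattice set) * N"
    using card_strip_upto_ge[OF assms] by blast
  obtain r where r: "\<And>h k x. (\<forall>x. 0 \<le> h x) \<Longrightarrow>
      (\<Sum>w\<in>strip_upto v b k. h (T w x)) \<le> (\<Sum>n<k. box_sum r h (T (spine v (int n)) x))"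
    using strip_sum_le_box_sum by blast
  define C0 where "C0 = 2 * real (card (cube (r + 1) :: (int^'n) set))"
  \<comment> \<open>The summand 1 keeps \<open>C\<close> positive even if the cube is empty.\<close>
  define C where "C = C0 * real N + 1"
  have C: "C > 0" by (simp add: C_def C0_def add_nonneg_pos)
  have "\<exists>K\<in>sets borel. prob K \<ge> 1 - C * (LINT x|\<mu>. h x) / t \<and>
      (\<forall>x\<in>K. \<forall>k. (\<Sum>w\<in>strip_upto v b k. h (T w x)) \<le> t * real (card (strip_upto v b k)))"
    if h: "\<forall>x. 0 \<le> h x" "integrable \<mu> h" and t: "t > 0" for h :: "'a \<Rightarrow> real" and t
  proof -
    \<comment> \<open>The maximal inequality divides by \<open>k\<close>, the claim by the
      cardinality of the strip, which is at least \<open>k / N\<close>.\<close>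
    define s where "s = t / real N"
    have s: "s > 0" "s * real N = t" using t N by (auto simp: s_def)
    define E where "E = {x. \<exists>k. s * real k < (\<Sum>n<k. box_sum r h (T (spine v (int n)) x))}"
    have E: "E \<in> sets borel" "s * prob E \<le> C0 * (LINT x|\<mu>. h x)"
      unfolding E_def C0_def using maximal_inequality_spine[of h s r v] h s by auto
    have nn: "(LINT x|\<mu>. h x) \<ge> 0" using h by simp
    have "t * prob E \<le> C0 * real N * (LINT x|\<mu>. h x)"
      using mult_right_mono[OF E(2), of "real N"] unfolding s(2)[symmetric] by (simp add: algebra_simps)
    also have "\<dots> \<le> C * (LINT x|\<mu>. h x)" using nn by (intro mult_right_mono) (simp_all add: C_def)
    finally have "prob E \<le> C * (LINT x|\<mu>. h x) / t" using t by (simp add: field_simps)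
    moreover have "prob (- E) = 1 - prob E"
      using prob_compl[of E] E(1) by (simp add: Compl_eq_Diff_UNIV sets_eq_borel)
    ultimately have "prob (- E) \<ge> 1 - C * (LINT x|\<mu>. h x) / t" by simp
    moreover have "(\<Sum>w\<in>strip_upto v b k. h (T w x)) \<le> t * real (card (strip_upto v b k :: 'n lattice set))"
      if "x \<in> - E" for x k
    proof -
      have "(\<Sum>w\<in>strip_upto v b k. h (T w x)) \<le> (\<Sum>n<k. box_sum r h (T (spine v (int n)) x))"
        by (rule r[OF h(1)])
      also have "\<dots> \<le> s * real k" using that by (auto simp: E_def not_less)
      also have "\<dots> \<le> s * real (card (strip_upto v b k :: 'n lattice set) * N)"
        using N(2)[of k] s(1) by (intro mult_left_mono of_nat_mono) auto
      also have "\<dots> = t * real (card (strip_upto v b k :: 'n lattice set))"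
        using s(2) by (simp add: algebra_simps)
      finally show ?thesis .
    qed
    ultimately show ?thesis using E(1) by (intro bexI[of _ "- E"]) auto
  qed
  then show ?thesis using C by blast
qed

section \<open>Bounded complexity implies discrete spectrum\<close>


lemma integrable_indicat: "A \<in> sets borel \<Longrightarrow> integrable \<mu> (indicat_real A)"
  by (rule integrable_bounded[of _ 1]) (auto simp: indicator_def)

lemma sum_dist_eq_mean_dist:
  assumes "b \<in> pos_vectors" "k \<ge> 1"
  shows "(\<Sum>w\<in>strip_upto v b k. dist (T w x) (T w y)) = real (card (strip_upto v b k)) * mean_dist T v b k x y"
proof -
  have "card (strip_upto v b k :: 'n lattice set) \<noteq> 0"
    using zero_in_strip_upto[OF assms] finite_strip_upto by (metis card_0_eq empty_iff)
  then show ?thesis by (simp add: mean_dist_def)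
qed

lemma mean_dist_triangle: "mean_dist T v b k x z \<le> mean_dist T v b k y x + mean_dist T v b k y z"
  unfolding mean_dist_def add_divide_distrib[symmetric] sum.distrib[symmetric]
  by (intro divide_right_mono sum_mono dist_triangle3) simp

lemma continuous_on_mean_dist: "continuous_on UNIV (mean_dist T v b k x)"
  unfolding mean_dist_def divide_inverse
  by (intro continuous_intros continuous_on_T)

lemma open_mean_dist_ball: "open {y. mean_dist T v b k x y < e}"
  by (intro open_Collect_less continuous_on_mean_dist continuous_on_const)

text \<open>If two orbits are close in mean, then for most times they visit \<open>B\<close>
  simultaneously, by Lusin. So the visits of almost all points are predicted by those of at most
  \<open>C\<close> centres, and a time is described by one of \<open>2 ^ C\<close> patterns of
  visits. Times with the same pattern differ by a return time.\<close>

lemma bounded_complexity_returns: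
  assumes b: "b \<in> pos_vectors" and bc: "bounded_complexity \<mu> (mean_dist T v b)"
    and B[measurable]: "B \<in> sets borel" and \<epsilon>: "\<epsilon> > 0"
  shows "\<exists>N>0. \<forall>k. \<exists>A. finite A \<and> k \<le> card A * N \<and>
    (\<forall>a\<in>A. 0 \<le> fst a \<and> fst a < int k \<and> a \<in> strip v (b + b) \<and> disp B a \<le> \<epsilon>)"
proof -
  \<comment> \<open>The final estimate costs \<open>12 e\<close> for each of two times and
    \<open>2 e\<close> for the exceptional set \<open>- Y\<close>.\<close>
  define e where "e = \<epsilon> / 26"
  have e: "e > 0" using \<epsilon> by (simp add: e_def)
  \<comment> \<open>With measure defect \<open>e * e\<close>, Markov's inequality gives orbits that
    leave \<open>K\<close> at no more than a fraction \<open>e\<close> of the times, outside a set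
    of measure at most \<open>e\<close>.\<close>
  obtain K \<delta> where K[measurable]: "K \<in> sets borel" and \<delta>: "\<delta> > 0" and pK: "prob K > 1 - e * e"
    and lus: "\<And>x y. x \<in> K \<Longrightarrow> y \<in> K \<Longrightarrow> dist x y < \<delta> \<Longrightarrow> (x \<in> B \<longleftrightarrow> y \<in> B)"
    using lusin_set_borel[OF B] mult_pos_pos[OF e e] unfolding lusin_set_def by meson
  \<comment> \<open>The bound \<open>e * \<delta>\<close> lets a mean distance of
    \<open>2 * (e * \<delta>)\<close> exceed \<open>\<delta>\<close> at no more than a fraction
    \<open>2 e\<close> of the times; the bound \<open>e\<close> limits the uncovered
    measure.\<close>
  define \<epsilon>' where "\<epsilon>' = min (e * \<delta>) e"
  have \<epsilon>': "\<epsilon>' > 0" "\<epsilon>' \<le> e * \<delta>" "\<epsilon>' \<le> e" using e \<delta> by (auto simp: \<epsilon>'_def)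
  obtain C :: nat where C: "\<And>k. k \<ge> 1 \<Longrightarrow> \<exists>F. finite F \<and> card F \<le> C \<and>
      prob (\<Union>x\<in>F. {y. mean_dist T v b k x y < \<epsilon>'}) > 1 - \<epsilon>'"
    using bc \<epsilon>'(1) unfolding bounded_complexity_def by meson
  obtain N0 where N0: "N0 > 0" "\<And>k. k \<le> card (strip_upto v b k :: 'n lattice set) * N0"
    using card_strip_upto_ge[OF b] by blast
  \<comment> \<open>Losses in density: half of the times, the density \<open>1 / N0\<close> of the
    strip, and the number of patterns.\<close>
  define N where "N = 2 * N0 * 2 ^ C"
  have "\<exists>A. finite A \<and> k \<le> card A * N \<and>
    (\<forall>a\<in>A. 0 \<le> fst a \<and> fst a < int k \<and> a \<in> strip v (b + b) \<and> disp B a \<le> \<epsilon>)" for k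
  proof (cases "k = 0")
    case True
    then show ?thesis by (intro exI[of _ "{}"]) simp
  next
    case False
    then have k: "k \<ge> 1" by simp
    define S where "S = (strip_upto v b k :: 'n lattice set)"
    define n where "n = real (card S)"
    have S: "finite S" "S \<noteq> {}"
      unfolding S_def by (rule finite_strip_upto) (use zero_in_strip_upto[OF b k, of v] in blast)
    then have n: "n > 0" by (simp add: n_def card_gt_0_iff)
    obtain F where F: "finite F" "card F \<le> C" "prob (\<Union>x\<in>F. {y. mean_dist T v b k x y < \<epsilon>'}) > 1 - \<epsilon>'"
      using C[OF k] by blast
    obtain m and h :: "nat \<Rightarrow> 'a" where Fh: "F = h ` {..<m}" and m: "m \<le> C"
      using ex_bij_betw_nat_finite[OF F(1)] bij_betw_imp_surj_on F(2) atLeast0LessThan by metis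
    define V where "V i = {y. mean_dist T v b k (h i) y < \<epsilon>'}" for i
    have V[measurable]: "V i \<in> sets borel" for i
      unfolding V_def by (intro borel_open open_mean_dist_ball)
    define U where "U = (\<Union>i<m. V i)"
    have U[measurable]: "U \<in> sets borel" unfolding U_def by measurable
    have "U = (\<Union>x\<in>F. {y. mean_dist T v b k x y < \<epsilon>'})"
      unfolding U_def V_def Fh by simp
    then have pU: "prob U > 1 - e" using F(3) \<epsilon>'(3) by simp
    define bad where "bad x = (\<Sum>w\<in>S. indicat_real (- K) (T w x))" for x
    have [measurable]: "(\<lambda>x. indicat_real A (T w x)) \<in> borel_measurable borel" if "A \<in> sets borel" for A w
      using that by (intro measurable_compose[OF T_measurable] borel_measurable_indicator)
    have iK: "integrable \<mu> (\<lambda>x. indicat_real (- K) (T w x))" for w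
      by (rule integrable_bounded[of _ 1]) (auto simp: indicator_def)
    have ibad: "(LINT x|\<mu>. bad x) = n * prob (- K)"
      unfolding bad_def using iK integral_T[of "indicat_real (- K)"]
      by (simp add: n_def)
    have badm[measurable]: "bad \<in> borel_measurable borel" unfolding bad_def by measurable
    define G where "G = {x. bad x \<le> e * n}"
    have G[measurable]: "G \<in> sets borel" unfolding G_def by measurable
    have pG: "prob (- G) \<le> e"
    proof -
      have "(LINT x|\<mu>. (e * n) * indicat_real (- G) x) \<le> (LINT x|\<mu>. bad x)"
      proof (intro integral_mono)
        show "integrable \<mu> bad" unfolding bad_def using iK by simp
        have "0 \<le> bad x" for x unfolding bad_def by (intro sum_nonneg) simp
        then show "e * n * indicat_real (- G) x \<le> bad x" for x
          by (auto simp: indicator_def G_def)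
      qed (simp add: integrable_indicat)
      then have "(e * n) * prob (- G) \<le> n * prob (- K)" using ibad by simp
      also have "prob (- K) \<le> e * e"
        using prob_compl[of K] pK by (simp add: Compl_eq_Diff_UNIV sets_eq_borel)
      finally have "(e * n) * prob (- G) \<le> (e * n) * e" using n by (simp add: algebra_simps)
      then show ?thesis using mult_pos_pos[OF e n] by (simp only: mult_le_cancel_left_pos)
    qed
    define Y where "Y = G \<inter> U"
    have Y[measurable]: "Y \<in> sets borel" unfolding Y_def by measurable
    have pY: "prob (- Y) \<le> 2 * e"
    proof -
      have "prob (- Y) \<le> prob (- G) + prob (- U)"
        unfolding Y_def Compl_Int by (intro measure_Un_le) (auto simp: sets_eq_borel)
      moreover have "prob (- U) \<le> e"
        using prob_compl[of U] pU by (simp add: Compl_eq_Diff_UNIV sets_eq_borel)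
      ultimately show ?thesis using pG by simp
    qed
    \<comment> \<open>The given centre \<open>h i\<close> may have an orbit that often leaves
      \<open>K\<close>, so a point of the ball that lies in \<open>G\<close> takes its place, at the
      price of doubling the radius. The choice is meaningless if there is none, but such an
      \<open>i\<close> never arises as \<open>idx y\<close> with \<open>y \<in> Y\<close>.\<close>
    define z where "z i = (SOME y. y \<in> V i \<inter> G)" for i
    \<comment> \<open>The least index makes the assignment of centres measurable.\<close>
    define idx where "idx y = (LEAST i. y \<in> V i)" for y
    have idxm[measurable]: "idx \<in> borel \<rightarrow>\<^sub>M count_space UNIV"
      unfolding idx_def by measurable
    have idx: "idx y < m" "y \<in> V (idx y)" "z (idx y) \<in> V (idx y)" "z (idx y) \<in> G" if yY: "y \<in> Y" for y
    proof -
      obtain i where i: "i < m" "y \<in> V i" using yY by (auto simp: Y_def U_def)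
      have "idx y \<le> i" unfolding idx_def using i(2) by (rule Least_le)
      then show "idx y < m" using i(1) by simp
      show y: "y \<in> V (idx y)" unfolding idx_def using i(2) by (rule LeastI)
      have "y \<in> V (idx y) \<inter> G" using y yY by (simp add: Y_def)
      then have "z (idx y) \<in> V (idx y) \<inter> G" unfolding z_def by (rule someI)
      then show "z (idx y) \<in> V (idx y)" "z (idx y) \<in> G" by auto
    qed
    define E where "E w y = \<bar>indicat_real B (T w y) - indicat_real B (T w (z (idx y)))\<bar>" for w y
    have Em[measurable]: "E w \<in> borel_measurable borel" for w
    proof -
      have "(\<lambda>y. indicat_real B (T w (z (idx y)))) \<in> borel_measurable borel"
        by (rule measurable_compose[OF idxm]) simp
      then show ?thesis unfolding E_def by measurable
    qed
    have E01: "0 \<le> E w y" "E w y \<le> 1" for w y by (auto simp: E_def indicator_def)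
    have Ei: "integrable \<mu> (E w)" for w
      using E01 by (intro integrable_bounded[of _ 1]) auto
    have iY: "integrable \<mu> (indicat_real (- Y))" by (simp add: integrable_indicat)
    \<comment> \<open>A disagreement at time \<open>w\<close> means that one of the two points is
      outside \<open>K\<close> or that they are at least \<open>\<delta>\<close> apart. The three
      causes contribute \<open>e * n\<close>, \<open>e * n\<close> and \<open>2 * e * n\<close>; off
      \<open>Y\<close> the trivial bound \<open>n\<close> is used.\<close>
    have sumE: "(\<Sum>w\<in>S. E w y) \<le> 4 * e * n + n * indicat_real (- Y) y" for y
    proof (cases "y \<in> Y")
      case True
      define x where "x = z (idx y)"
      have le: "E w y \<le> indicat_real (- K) (T w y) + indicat_real (- K) (T w x) + dist (T w y) (T w x) / \<delta>" for w
      proof (cases "T w y \<in> K \<and> T w x \<in> K \<and> dist (T w y) (T w x) < \<delta>")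
        case True
        then have "E w y = 0" using lus[of "T w y" "T w x"] by (simp add: E_def x_def indicator_def)
        then show ?thesis using \<delta> by simp
      next
        case False
        have "0 \<le> dist (T w y) (T w x) / \<delta>" using \<delta> by simp
        moreover have "1 \<le> dist (T w y) (T w x) / \<delta>" if "\<not> dist (T w y) (T w x) < \<delta>"
          using that \<delta> by simp
        ultimately show ?thesis using E01(2)[of w y] False
          by (cases "T w y \<in> K"; cases "T w x \<in> K") auto
      qed
      have "(\<Sum>w\<in>S. E w y) \<le> (\<Sum>w\<in>S. indicat_real (- K) (T w y) + indicat_real (- K) (T w x) + dist (T w y) (T w x) / \<delta>)"
        by (intro sum_mono le)
      also have "\<dots> = bad y + bad x + (\<Sum>w\<in>S. dist (T w y) (T w x)) / \<delta>"
        by (simp add: sum.distrib bad_def sum_divide_distrib)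
      also have "(\<Sum>w\<in>S. dist (T w y) (T w x)) / \<delta> \<le> 2 * e * n"
      proof -
        have "mean_dist T v b k y x \<le> mean_dist T v b k (h (idx y)) y + mean_dist T v b k (h (idx y)) x"
          by (rule mean_dist_triangle)
        also have "\<dots> \<le> 2 * (e * \<delta>)"
          using idx(2,3)[OF True] \<epsilon>'(2) by (simp add: V_def x_def)
        finally have "n * mean_dist T v b k y x \<le> n * (2 * (e * \<delta>))"
          using n by (intro mult_left_mono) auto
        then have "(\<Sum>w\<in>S. dist (T w y) (T w x)) \<le> n * (2 * (e * \<delta>))"
          unfolding S_def n_def sum_dist_eq_mean_dist[OF b k] .
        then show ?thesis using \<delta> by (simp add: field_simps)
      qed
      also have "bad y \<le> e * n" using True by (simp add: Y_def G_def)
      also have "bad x \<le> e * n" using idx(4)[OF True] by (simp add: x_def G_def)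
      finally show ?thesis using True by simp
    next
      case False
      have "(\<Sum>w\<in>S. E w y) \<le> (\<Sum>w\<in>S. 1)" by (intro sum_mono E01)
      then show ?thesis using False e n by (simp add: n_def add_increasing)
    qed
    have "(\<Sum>w\<in>S. LINT y|\<mu>. E w y) = (LINT y|\<mu>. (\<Sum>w\<in>S. E w y))"
      using Ei by simp
    also have "\<dots> \<le> (LINT y|\<mu>. 4 * e * n + n * indicat_real (- Y) y)"
      using Ei iY sumE by (intro integral_mono) auto
    also have "\<dots> = 4 * e * n + n * prob (- Y)"
      using iY prob_space by simp
    also have "\<dots> \<le> 6 * e * n" using mult_left_mono[OF pY, of n] n by simp
    finally have tot: "(\<Sum>w\<in>S. LINT y|\<mu>. E w y) \<le> 6 * e * n" .
    \<comment> \<open>The average error is at most \<open>6 e\<close>, so by Markov at most half of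
      the times exceed \<open>12 e\<close>.\<close>
    define S' where "S' = {w \<in> S. (LINT y|\<mu>. E w y) \<le> 12 * e}"
    have S': "finite S'" "S' \<subseteq> S" using S by (auto simp: S'_def)
    have half: "card S \<le> 2 * card S'"
    proof -
      have "real (card (S - S')) * (12 * e) = (\<Sum>w\<in>S - S'. 12 * e)" by simp
      also have "\<dots> \<le> (\<Sum>w\<in>S - S'. LINT y|\<mu>. E w y)"
        by (intro sum_mono) (auto simp: S'_def)
      also have "\<dots> \<le> (\<Sum>w\<in>S. LINT y|\<mu>. E w y)"
        using S E01 by (intro sum_mono2 integral_nonneg) auto
      also note tot
      finally have le: "real (card (S - S')) * (12 * e) \<le> 6 * e * n" .
      have "(6 * e) * (real (card (S - S')) * 2) = real (card (S - S')) * (12 * e)" by algebra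
      with le have "(6 * e) * (real (card (S - S')) * 2) \<le> (6 * e) * n" by (simp only:)
      then have "real (card (S - S')) * 2 \<le> n" using e by (simp only: mult_le_cancel_left_pos)
      moreover have "card (S - S') + card S' = card S"
        using S S' card_Diff_subset[of S' S] card_mono[of S S'] by simp
      ultimately show ?thesis unfolding n_def by linarith
    qed
    then have "S' \<noteq> {}" using S by (auto simp: card_gt_0_iff)
    \<comment> \<open>Times of the same colour agree at all centres \<open>z i\<close>, hence nearly everywhere, since every
      good point follows the centre \<open>z (idx y)\<close> for most times.\<close>
    define c where "c w = {i\<in>{..<m}. T w (z i) \<in> B}" for w
    have "card (c ` S') \<le> card (Pow {..<m})"
      by (intro card_mono) (auto simp: c_def)
    also have "\<dots> \<le> 2 ^ C" using m by (simp add: card_Pow)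
    finally have cc: "card (c ` S') \<le> 2 ^ C" .
    have sub: "S' \<subseteq> {w. 0 \<le> fst w \<and> fst w < int k}"
    proof
      fix w assume "w \<in> S'"
      then have "w \<in> strip_upto v b k" using S'(2) unfolding S_def by blast
      then show "w \<in> {w. 0 \<le> fst w \<and> fst w < int k}" unfolding strip_upto_def by (simp add: mem_Times_iff)
    qed
    obtain A where A: "finite A" "card S' \<le> card A * 2 ^ C"
      "\<forall>a\<in>A. 0 \<le> fst a \<and> fst a < int k \<and> (\<exists>u\<in>S'. \<exists>w\<in>S'. c u = c w \<and> a = u - w)"
      using pigeonhole_differences[OF S'(1) \<open>S' \<noteq> {}\<close> sub cc] by blast
    have close: "disp B (u - w) \<le> \<epsilon>" if u: "u \<in> S'" and w: "w \<in> S'" and cuw: "c u = c w" for u w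
    proof -
      have pt: "\<bar>indicat_real B (T u y) - indicat_real B (T w y)\<bar> \<le> E u y + E w y + indicat_real (- Y) y" for y
      proof (cases "y \<in> Y")
        case True
        have "T u (z (idx y)) \<in> B \<longleftrightarrow> T w (z (idx y)) \<in> B"
          using cuw idx(1)[OF True] unfolding c_def by blast
        then have "indicat_real B (T u (z (idx y))) = indicat_real B (T w (z (idx y)))"
          by (simp add: indicator_def)
        then show ?thesis using True unfolding E_def by simp
      next
        case False
        then show ?thesis using E01(1)[of u y] E01(1)[of w y]
          by (auto simp: indicator_def)
      qed
      have "disp B (u - w) \<le> (LINT y|\<mu>. E u y + E w y + indicat_real (- Y) y)"
        unfolding disp_diff[OF B] using Ei iY pt by (intro integral_mono integrable_indicator_diff B) auto
      also have "\<dots> = (LINT y|\<mu>. E u y) + (LINT y|\<mu>. E w y) + prob (- Y)"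
        using Ei iY by simp
      also have "\<dots> \<le> \<epsilon>" using u w pY by (simp add: S'_def e_def)
      finally show ?thesis .
    qed
    have "0 \<le> fst a \<and> fst a < int k \<and> a \<in> strip v (b + b) \<and> disp B a \<le> \<epsilon>" if a: "a \<in> A" for a
    proof -
      obtain u w where uw: "u \<in> S'" "w \<in> S'" "c u = c w" "a = u - w" using A(3) a by blast
      have "u \<in> strip v b" "w \<in> strip v b" using uw(1,2) S'(2) unfolding S_def strip_upto_def by blast+
      then have "a \<in> strip v (b + b)" unfolding uw(4) by (rule strip_diff)
      moreover have "disp B a \<le> \<epsilon>" unfolding uw(4) using uw(1-3) by (rule close)
      moreover have "0 \<le> fst a \<and> fst a < int k" using A(3) a by blast
      ultimately show ?thesis by blast
    qed
    moreover have "k \<le> card A * N"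
    proof -
      have "k \<le> card S * N0" unfolding S_def by (rule N0(2))
      also have "\<dots> \<le> (2 * (card A * 2 ^ C)) * N0"
        using half A(2) by (intro mult_right_mono) auto
      finally show ?thesis by (simp add: N_def algebra_simps)
    qed
    ultimately show ?thesis using A(1) by blast
  qed
  moreover have "N > 0" using N0(1) by (simp add: N_def)
  ultimately show ?thesis by blast
qed

text \<open>An \<open>\<epsilon>\<close>-separated subset of the strip is bounded in size: its translates of the return set are
  disjoint, and each of them has positive density in a wider strip.\<close>

lemma bounded_complexity_imp_kronecker:
  assumes b: "b \<in> pos_vectors" and bc: "bounded_complexity \<mu> (mean_dist T v b)"
    and B: "B \<in> sets borel"
  shows "B \<in> kronecker_algebra_strip \<mu> T v b"
  unfolding mem_kronecker_algebra_strip_iff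
proof (intro conjI allI impI B)
  fix \<epsilon> :: real assume \<epsilon>: "\<epsilon> > 0"
  \<comment> \<open>With thirds, two intersecting translates would put their base points at
    displacement at most \<open>2 * \<epsilon> / 3\<close>, contradicting separation.\<close>
  obtain N where N: "N > 0" "\<And>k. \<exists>A. finite A \<and> k \<le> card A * N \<and>
    (\<forall>a\<in>A. 0 \<le> fst a \<and> fst a < int k \<and> a \<in> strip v (b + b) \<and> disp B a \<le> \<epsilon> / 3)"
    using bounded_complexity_returns[OF b bc B, of "\<epsilon> / 3"] \<epsilon> by auto
  obtain D :: nat where D: "\<And>I. finite I \<Longrightarrow> finite {w \<in> strip v (b + (b + b)). fst w \<in> I} \<and>
      card {w \<in> strip v (b + (b + b)). fst w \<in> I} \<le> D * card I"
    using card_strip_le by blast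
  define P where "P W \<longleftrightarrow> finite W \<and> W \<subseteq> strip v b \<and> (\<forall>u\<in>W. \<forall>w\<in>W. u \<noteq> w \<longrightarrow> \<epsilon> \<le> disp B (w - u))" for W
  have bound: "card W \<le> D * (3 * N)" if W: "P W" for W
  proof -
    define m where "m = (\<Sum>w\<in>W. nat \<bar>fst w\<bar>)"
    have m: "\<bar>fst w\<bar> \<le> int m" if "w \<in> W" for w
    proof -
      have "nat \<bar>fst w\<bar> \<le> m" unfolding m_def using W that by (intro member_le_sum) (auto simp: P_def)
      then show ?thesis by simp
    qed
    \<comment> \<open>The window must be long compared with the extent \<open>m\<close> of
      \<open>W\<close>: then all translates lie over an interval of
      \<open>k + 2 * m \<le> 3 * k\<close> integers, and the bound no longer depends on
      \<open>W\<close>.\<close>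
    define k where "k = m + 1"
    obtain A where A: "finite A" "k \<le> card A * N"
      "\<And>a. a \<in> A \<Longrightarrow> 0 \<le> fst a \<and> fst a < int k \<and> a \<in> strip v (b + b) \<and> disp B a \<le> \<epsilon> / 3"
      using N(2)[of k] by metis
    define g where "g = (\<lambda>(w :: 'n lattice, a). w + a)"
    have inj: "inj_on g (W \<times> A)"
    proof (rule inj_onI)
      fix p q assume p: "p \<in> W \<times> A" and q: "q \<in> W \<times> A" and gpq: "g p = g q"
      obtain u a w c where [simp]: "p = (u, a)" "q = (w, c)" by (cases p, cases q) blast
      have eq: "u + a = w + c" using gpq by (simp add: g_def del: plus_prod_def)
      then have wu: "w - u = a - c" by (metis add.commute add_diff_cancel_left diff_add_eq diff_diff_eq2 add_diff_cancel_right')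
      have "disp B (w - u) \<le> disp B a + disp B (- c)"
        unfolding wu using disp_add[OF B, of a "- c"] by simp
      also have "\<dots> \<le> \<epsilon> / 3 + \<epsilon> / 3"
        unfolding disp_minus[OF B] using A(3) p q by (intro add_mono) auto
      also have "\<dots> < \<epsilon>" using \<epsilon> by simp
      finally have "u = w" using W p q unfolding P_def by force
      then show "p = q" using eq by simp
    qed
    have img: "g ` (W \<times> A) \<subseteq> {w \<in> strip v (b + (b + b)). fst w \<in> {- int m..<int (k + m)}}"
    proof (intro image_subsetI)
      fix p assume p: "p \<in> W \<times> A"
      obtain u a where pu: "p = (u, a)" by (cases p) blast
      then have ua: "u \<in> W" "a \<in> A" using p by auto
      have "u \<in> strip v b" using W ua(1) unfolding P_def by blast
      then have "u + a \<in> strip v (b + (b + b))" using A(3)[OF ua(2)] by (intro strip_add) auto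
      moreover have "fst (u + a) \<in> {- int m..<int (k + m)}"
        using m[OF ua(1)] A(3)[OF ua(2)] by (simp add: abs_le_iff)
      ultimately show "g p \<in> {w \<in> strip v (b + (b + b)). fst w \<in> {- int m..<int (k + m)}}"
        by (simp add: g_def pu)
    qed
    have "card W * card A = card (g ` (W \<times> A))"
      using card_image[OF inj] by (simp add: card_cartesian_product)
    also have "\<dots> \<le> card {w \<in> strip v (b + (b + b)). fst w \<in> {- int m..<int (k + m)}}"
      by (rule card_mono[OF conjunct1[OF D] img]) simp
    also have "\<dots> \<le> D * card {- int m..<int (k + m)}" using D by blast
    also have "\<dots> \<le> D * (3 * k)" by (simp add: k_def nat_le_iff)
    also have "\<dots> \<le> D * (3 * (card A * N))" using A(2) by (intro mult_left_mono) auto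
    finally have "card W * card A \<le> (D * (3 * N)) * card A" by (simp add: algebra_simps)
    moreover have "card A > 0" using A(2) by (cases "card A") (auto simp: k_def)
    ultimately show ?thesis by simp
  qed
  have "P {}" by (simp add: P_def)
  \<comment> \<open>A separated set of greatest cardinality is a net, since a point far from all of
    it could be added.\<close>
  then obtain W where W: "P W" "\<And>W'. P W' \<Longrightarrow> card W' \<le> card W"
    using ex_has_greatest_nat[of P "{}" card "Suc (D * (3 * N))"] bound by (metis le_imp_less_Suc)
  have Wf: "finite W" "W \<subseteq> strip v b" "\<And>u w. u \<in> W \<Longrightarrow> w \<in> W \<Longrightarrow> u \<noteq> w \<Longrightarrow> \<epsilon> \<le> disp B (w - u)"
    using W(1) unfolding P_def by simp_all
  have "\<exists>u\<in>W. disp B (w - u) < \<epsilon>" if w: "w \<in> strip v b" for w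
  proof (rule ccontr)
    assume "\<not> (\<exists>u\<in>W. disp B (w - u) < \<epsilon>)"
    then have far: "\<epsilon> \<le> disp B (w - u)" if "u \<in> W" for u using that by (meson not_less)
    then have far': "\<epsilon> \<le> disp B (u - w)" if "u \<in> W" for u
      using that disp_minus[OF B, of "w - u"] by simp
    have "w \<notin> W" using far[of w] \<epsilon> by (auto simp: disp_zero)
    moreover have "P (insert w W)"
      unfolding P_def
    proof (intro conjI ballI impI)
      fix x y assume "x \<in> insert w W" "y \<in> insert w W" "x \<noteq> y"
      then show "\<epsilon> \<le> disp B (y - x)" using far far' Wf(3) by (cases "x = w"; cases "y = w") simp_all
    qed (use Wf w in simp_all)
    ultimately show False using W(2)[of "insert w W"] W(1) by (simp add: P_def)
  qed
  then show "\<exists>W. finite W \<and> W \<subseteq> strip v b \<and> (\<forall>w\<in>strip v b. \<exists>u\<in>W. disp B (w - u) < \<epsilon>)"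
    using Wf(1,2) by (intro exI[of _ W] conjI) simp_all
qed

section \<open>Almost periodic approximation\<close>


text \<open>The weights are a normalised tent over a seminorm \<open>\<nu>\<close>, so a shift by
  \<open>s\<close> changes each unnormalised weight by at most \<open>\<nu> k s\<close>. It affects
  at most about \<open>k\<close> points, while recurrence makes the total mass at least proportional
  to \<open>k\<close>; the quotient has a constant independent of \<open>k\<close>.\<close>

lemma almost_invariant_weights:
  fixes v :: "real \<times> (real ^ 'n)"
  assumes B: "B \<in> kronecker_algebra_strip \<mu> T v (\<chi> i. 1)" and \<eta>: "0 < \<eta>" "\<eta> \<le> 1"
  shows "\<exists>\<alpha> C. 0 \<le> C \<and> (\<forall>k. finite {w. \<alpha> k w \<noteq> 0} \<and> (\<Sum>w | \<alpha> k w \<noteq> 0. \<alpha> k w) = (1::real) \<and>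
    (\<forall>w. 0 \<le> \<alpha> k w \<and> (\<alpha> k w \<noteq> 0 \<longrightarrow> w \<in> strip v (\<chi> i. 1) \<and> wdisp v B w < \<eta>)) \<and>
    (\<forall>s. (\<Sum>w | \<alpha> k w \<noteq> 0 \<or> \<alpha> k (w - s) \<noteq> 0. \<bar>\<alpha> k (w - s) - \<alpha> k w\<bar>) \<le>
      C * (wdisp v B s + \<bar>real_of_int (fst s)\<bar> / real (Suc k))))"
proof -
  have Bm: "B \<in> sets borel" using B mem_kronecker_algebra_strip_iff by blast
  define \<rho> where "\<rho> = wdisp v B"
  have \<rho>: "0 \<le> \<rho> w" "\<rho> (u + w) \<le> \<rho> u + \<rho> w" "\<rho> (- w) = \<rho> w" for u w
    unfolding \<rho>_def using wdisp_nonneg wdisp_add[OF Bm] wdisp_minus[OF Bm] by auto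
  obtain c :: "'n lattice \<Rightarrow> 'n lattice \<times> ('n \<Rightarrow> int)" where c: "finite (c ` strip v (\<chi> i. 1))"
    "\<And>u w. u \<in> strip v (\<chi> i. 1) \<Longrightarrow> w \<in> strip v (\<chi> i. 1) \<Longrightarrow> c u = c w \<Longrightarrow> \<rho> (u - w) < \<eta> / 3"
    using wdisp_coloring[OF B, of "\<eta> / 3"] \<eta>(1) unfolding \<rho>_def by (metis divide_pos_pos zero_less_numeral)
  have "\<exists>N>0. \<forall>k. \<exists>A. finite A \<and> k \<le> card A * N \<and>
      (\<forall>a\<in>A. 0 \<le> fst a \<and> fst a < int k \<and> \<rho> a < \<eta> / 3)"
    by (rule many_returns[OF c(1)]) (rule c(2))
  then obtain N where N: "N > 0" "\<And>k. \<exists>A. finite A \<and> k \<le> card A * N \<and>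
      (\<forall>a\<in>A. 0 \<le> fst a \<and> fst a < int k \<and> \<rho> a < \<eta> / 3)"
    by blast
  obtain D :: nat where D: "\<And>I. finite I \<Longrightarrow> finite {w \<in> strip v (\<chi> i. 1). fst w \<in> I} \<and>
      card {w \<in> strip v (\<chi> i. 1). fst w \<in> I} \<le> D * card I"
    using card_strip_le by blast
  \<comment> \<open>The second term makes the support finite and disappears as \<open>k\<close>
    grows. The factor 3 leaves returns with \<open>\<rho> < \<eta> / 3\<close> and first coordinate
    up to \<open>Suc k\<close> at \<open>\<nu> \<le> 2/3\<close>, hence at weight at least
    1/3.\<close>
  define \<nu> where "\<nu> k w = \<rho> w / \<eta> + \<bar>real_of_int (fst w)\<bar> / (3 * real (Suc k))" for k w
  have \<nu>0: "0 \<le> \<nu> k w" for k w using \<rho>(1) \<eta>(1) by (simp add: \<nu>_def)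
  have \<nu>_le: "\<nu> k u \<le> \<nu> k w + \<nu> k (u - w)" for k u w
  proof -
    have "\<rho> u / \<eta> \<le> (\<rho> w + \<rho> (u - w)) / \<eta>"
      using \<rho>(2)[of w "u - w"] \<eta>(1) by (intro divide_right_mono) auto
    moreover have "\<bar>real_of_int (fst u)\<bar> / (3 * real (Suc k)) \<le>
        (\<bar>real_of_int (fst w)\<bar> + \<bar>real_of_int (fst (u - w))\<bar>) / (3 * real (Suc k))"
      by (intro divide_right_mono) auto
    ultimately show ?thesis unfolding \<nu>_def add_divide_distrib by linarith
  qed
  have \<nu>_minus: "\<nu> k (- w) = \<nu> k w" for k w by (simp add: \<nu>_def \<rho>(3))
  define a where "a k w = max 0 (1 - \<nu> k w)" for k w
  define V where "V k = {w \<in> strip v (\<chi> i. 1). fst w \<in> {- (3 * int (Suc k))..3 * int (Suc k)}}" for k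
  have V: "finite (V k)" "card (V k) \<le> 7 * D * Suc k" for k
  proof -
    show "finite (V k)" unfolding V_def by (rule conjunct1[OF D]) simp
    have "card (V k) \<le> D * card {- (3 * int (Suc k))..3 * int (Suc k)}" unfolding V_def using D by blast
    also have "\<dots> \<le> D * (7 * Suc k)" by (intro mult_left_mono) (simp_all add: nat_le_iff)
    finally show "card (V k) \<le> 7 * D * Suc k" by (simp add: algebra_simps)
  qed
  have supp: "w \<in> V k" "\<rho> w < \<eta>" if "a k w \<noteq> 0" for k w
  proof -
    have lt: "\<nu> k w < 1" using that by (auto simp: a_def max_def split: if_splits)
    have nn: "0 \<le> \<rho> w / \<eta>" "0 \<le> \<bar>real_of_int (fst w)\<bar> / (3 * real (Suc k))"
      using \<rho>(1) \<eta>(1) by simp_all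
    then have "\<rho> w / \<eta> < 1" using lt unfolding \<nu>_def by linarith
    then show r: "\<rho> w < \<eta>" using \<eta>(1) by simp
    have "\<bar>real_of_int (fst w)\<bar> / (3 * real (Suc k)) < 1"
      using lt nn unfolding \<nu>_def by linarith
    then have "\<bar>real_of_int (fst w)\<bar> < 3 * real (Suc k)" by simp
    then have "fst w \<in> {- (3 * int (Suc k))..3 * int (Suc k)}" by simp linarith
    moreover have "side v w \<le> 1" using r \<eta>(2) disp_nonneg[of B w] by (simp add: \<rho>_def wdisp_def)
    then have "w \<in> strip v (\<chi> i. 1)" by (rule side_le_imp_mem_strip)
    ultimately show "w \<in> V k" unfolding V_def by blast
  qed
  define Z where "Z k = (\<Sum>w\<in>V k. a k w)" for k
  \<comment> \<open>Positive density of the return times, each of weight at least 1/3.\<close>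
  have Z: "real (Suc k) \<le> 3 * real N * Z k" for k
  proof -
    obtain A where A: "finite A" "Suc k \<le> card A * N"
      "\<And>w. w \<in> A \<Longrightarrow> 0 \<le> fst w \<and> fst w < int (Suc k) \<and> \<rho> w < \<eta> / 3"
      using N(2)[of "Suc k"] by metis
    have third: "1 / 3 \<le> a k w" if w: "w \<in> A" for w
    proof -
      have "\<rho> w / \<eta> \<le> 1 / 3" using A(3)[OF w] \<eta>(1) by (simp add: field_simps)
      moreover have "\<bar>real_of_int (fst w)\<bar> \<le> real (Suc k)" using A(3)[OF w] by linarith
      then have "\<bar>real_of_int (fst w)\<bar> / (3 * real (Suc k)) \<le> 1 / 3" by (simp add: field_simps)
      ultimately have "\<nu> k w \<le> 2 / 3" unfolding \<nu>_def by linarith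
      then show ?thesis by (simp add: a_def)
    qed
    then have "A \<subseteq> V k" using supp(1) by force
    then have "(\<Sum>w\<in>A. a k w) \<le> Z k"
      unfolding Z_def using V(1) by (intro sum_mono2) (auto simp: a_def)
    moreover have "real (card A) * (1 / 3) \<le> (\<Sum>w\<in>A. a k w)"
      using sum_bounded_below[of A "1/3" "a k"] third by simp
    ultimately have "real (card A) \<le> 3 * Z k" by simp
    then have "real (card A) * real N \<le> 3 * Z k * real N" by (intro mult_right_mono) auto
    moreover have "real (Suc k) \<le> real (card A) * real N" using A(2) by (metis of_nat_le_iff of_nat_mult)
    ultimately show ?thesis by (simp add: algebra_simps)
  qed
  have Zpos: "Z k > 0" for k
  proof (rule ccontr)
    assume "\<not> Z k > 0"
    then have "3 * real N * Z k \<le> 0" by (intro mult_nonneg_nonpos) auto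
    then show False using Z[of k] by simp
  qed
  define \<alpha> where "\<alpha> k w = a k w / Z k" for k w
  have \<alpha>0: "\<alpha> k w \<noteq> 0 \<longleftrightarrow> a k w \<noteq> 0" for k w using Zpos[of k] by (simp add: \<alpha>_def)
  have fin: "finite {w. \<alpha> k w \<noteq> 0}" for k
    by (rule finite_subset[OF _ V(1)[of k]]) (use \<alpha>0 supp(1) in blast)
  have sum1: "(\<Sum>w | \<alpha> k w \<noteq> 0. \<alpha> k w) = 1" for k
  proof -
    have "(\<Sum>w | \<alpha> k w \<noteq> 0. \<alpha> k w) = (\<Sum>w\<in>V k. \<alpha> k w)"
      using V(1) \<alpha>0 supp(1) by (intro sum.mono_neutral_left) auto
    also have "\<dots> = 1" unfolding \<alpha>_def sum_divide_distrib[symmetric] using Zpos[of k] by (simp add: Z_def)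
    finally show ?thesis .
  qed
  \<comment> \<open>Here 42 is 14 from the two supports times 3 from \<open>Z\<close>;
    \<open>1 / \<eta> + 1\<close> dominates both coefficients of \<open>\<nu>\<close>.\<close>
  define C where "C = 42 * real D * real N * (1 / \<eta> + 1)"
  have shift: "(\<Sum>w | \<alpha> k w \<noteq> 0 \<or> \<alpha> k (w - s) \<noteq> 0. \<bar>\<alpha> k (w - s) - \<alpha> k w\<bar>) \<le>
      C * (\<rho> s + \<bar>real_of_int (fst s)\<bar> / real (Suc k))" for k s
  proof -
    define X where "X = {w. \<alpha> k w \<noteq> 0 \<or> \<alpha> k (w - s) \<noteq> 0}"
    \<comment> \<open>Counting the two supports separately keeps the bound independent of
      \<open>s\<close>.\<close>
    have sub: "X \<subseteq> V k \<union> (\<lambda>w. w + s) ` V k"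
    proof
      fix w assume "w \<in> X"
      then have "w \<in> V k \<or> w - s \<in> V k" using \<alpha>0 supp(1) unfolding X_def by blast
      then show "w \<in> V k \<union> (\<lambda>w. w + s) ` V k"
        by (metis UnCI diff_add_cancel image_eqI)
    qed
    have "card X \<le> card (V k) + card ((\<lambda>w. w + s) ` V k)"
      using card_mono[OF _ sub] V(1)[of k] card_Un_le[of "V k" "(\<lambda>w. w + s) ` V k"]
      by (meson finite_UnI finite_imageI le_trans)
    also have "\<dots> \<le> card (V k) + card (V k)" using card_image_le[OF V(1)] by simp
    finally have "card X \<le> 14 * D * Suc k" using V(2)[of k] by linarith
    then have "real (card X) \<le> real (14 * D * Suc k)" by (simp only: of_nat_le_iff)
    then have cX: "real (card X) \<le> 14 * real D * real (Suc k)" by (simp only: of_nat_mult of_nat_numeral)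
    have "\<bar>\<alpha> k (w - s) - \<alpha> k w\<bar> \<le> \<nu> k s / Z k" for w
    proof -
      have "\<nu> k (w - s) \<le> \<nu> k w + \<nu> k s"
        using \<nu>_le[of k "w - s" w] \<nu>_minus[of k s] by simp
      moreover have "\<nu> k w \<le> \<nu> k (w - s) + \<nu> k s" using \<nu>_le[of k w "w - s"] by simp
      ultimately have "\<bar>a k (w - s) - a k w\<bar> \<le> \<nu> k s" unfolding a_def by linarith
      then have "\<bar>a k (w - s) - a k w\<bar> / Z k \<le> \<nu> k s / Z k"
        using Zpos[of k] by (intro divide_right_mono) auto
      then show ?thesis
        unfolding \<alpha>_def diff_divide_distrib[symmetric] abs_divide using Zpos[of k] by simp
    qed
    then have "(\<Sum>w\<in>X. \<bar>\<alpha> k (w - s) - \<alpha> k w\<bar>) \<le> real (card X) * (\<nu> k s / Z k)"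
      using sum_bounded_above[of X "\<lambda>w. \<bar>\<alpha> k (w - s) - \<alpha> k w\<bar>" "\<nu> k s / Z k"] by simp
    also have "\<dots> \<le> (14 * real D * real (Suc k)) * (\<nu> k s / Z k)"
      using cX \<nu>0[of k s] Zpos[of k] by (intro mult_right_mono) auto
    also have "\<dots> \<le> (14 * real D * (3 * real N * Z k)) * (\<nu> k s / Z k)"
      using Z[of k] \<nu>0[of k s] Zpos[of k] by (intro mult_right_mono mult_left_mono) auto
    also have "\<dots> = 42 * real D * real N * \<nu> k s" using Zpos[of k] by (simp add: field_simps)
    also have "\<dots> \<le> 42 * real D * real N * ((1 / \<eta> + 1) * (\<rho> s + \<bar>real_of_int (fst s)\<bar> / real (Suc k)))"
    proof (intro mult_left_mono)
      define y where "y = \<bar>real_of_int (fst s)\<bar> / real (Suc k)"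
      have y: "y \<ge> 0" by (simp add: y_def)
      have "\<nu> k s = \<rho> s / \<eta> + y / 3" by (simp add: \<nu>_def y_def)
      also have "\<dots> \<le> \<rho> s / \<eta> + \<rho> s + y / \<eta> + y" using y \<rho>(1)[of s] \<eta>(1) by simp
      also have "\<dots> = (1 / \<eta> + 1) * (\<rho> s + y)" by (simp add: algebra_simps)
      finally show "\<nu> k s \<le> (1 / \<eta> + 1) * (\<rho> s + \<bar>real_of_int (fst s)\<bar> / real (Suc k))"
        by (simp add: y_def)
    qed simp
    also have "\<dots> = C * (\<rho> s + \<bar>real_of_int (fst s)\<bar> / real (Suc k))" by (simp add: C_def)
    finally show ?thesis by (simp add: X_def)
  qed
  show ?thesis
  proof (intro exI[of _ \<alpha>] exI[of _ C] conjI allI impI)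
    show "0 \<le> C" using \<eta>(1) by (simp add: C_def)
    show "finite {w. \<alpha> k w \<noteq> 0}" for k by (rule fin)
    show "(\<Sum>w | \<alpha> k w \<noteq> 0. \<alpha> k w) = 1" for k by (rule sum1)
    show "0 \<le> \<alpha> k w" for k w using Zpos[of k] by (simp add: \<alpha>_def a_def)
    show "w \<in> strip v (\<chi> i. 1)" if "\<alpha> k w \<noteq> 0" for k w using supp(1) \<alpha>0 that unfolding V_def by blast
    show "wdisp v B w < \<eta>" if "\<alpha> k w \<noteq> 0" for k w using supp(2) \<alpha>0 that unfolding \<rho>_def by blast
    show "(\<Sum>w | \<alpha> k w \<noteq> 0 \<or> \<alpha> k (w - s) \<noteq> 0. \<bar>\<alpha> k (w - s) - \<alpha> k w\<bar>) \<le>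
      C * (wdisp v B s + \<bar>real_of_int (fst s)\<bar> / real (Suc k))" for k s
      using shift unfolding \<rho>_def .
  qed
qed

section \<open>Weighted means of an indicator and their limits\<close>

definition weighted_mean :: "('n lattice \<Rightarrow> real) \<Rightarrow> 'a set \<Rightarrow> 'a \<Rightarrow> real" where
  "weighted_mean \<alpha> B x = (\<Sum>w | \<alpha> w \<noteq> 0. \<alpha> w * indicat_real B (T w x))"

lemma weighted_mean_measurable [measurable]:
  "B \<in> sets borel \<Longrightarrow> weighted_mean \<alpha> B \<in> borel_measurable borel"
  unfolding weighted_mean_def
  by (intro borel_measurable_sum borel_measurable_times borel_measurable_const
      measurable_compose[OF T_measurable] borel_measurable_indicator)

lemma weighted_mean_bounds:
  assumes "\<And>w. 0 \<le> \<alpha> w" "(\<Sum>w | \<alpha> w \<noteq> 0. \<alpha> w) = 1"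
  shows "0 \<le> weighted_mean \<alpha> B x" "weighted_mean \<alpha> B x \<le> 1"
proof -
  show "0 \<le> weighted_mean \<alpha> B x" unfolding weighted_mean_def using assms(1) by (intro sum_nonneg) simp
  have "weighted_mean \<alpha> B x \<le> (\<Sum>w | \<alpha> w \<noteq> 0. \<alpha> w)"
    unfolding weighted_mean_def using assms(1) by (intro sum_mono) (simp add: mult_left_le)
  then show "weighted_mean \<alpha> B x \<le> 1" using assms(2) by simp
qed

lemma weighted_mean_shift:
  assumes fin: "finite {w. \<alpha> w \<noteq> 0}"
  shows "\<bar>weighted_mean \<alpha> B (T s x) - weighted_mean \<alpha> B x\<bar> \<le>
    (\<Sum>w | \<alpha> w \<noteq> 0 \<or> \<alpha> (w - s) \<noteq> 0. \<bar>\<alpha> (w - s) - \<alpha> w\<bar>)"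
proof -
  define X where "X = {w. \<alpha> w \<noteq> 0 \<or> \<alpha> (w - s) \<noteq> 0}"
  have img: "(\<lambda>w. w + s) ` {w. \<alpha> w \<noteq> 0} = {w. \<alpha> (w - s) \<noteq> 0}"
  proof (intro equalityI subsetI)
    fix w assume "w \<in> {w. \<alpha> (w - s) \<noteq> 0}"
    then show "w \<in> (\<lambda>w. w + s) ` {w. \<alpha> w \<noteq> 0}" by (intro image_eqI[of w _ "w - s"]) simp_all
  next
    fix w assume "w \<in> (\<lambda>w. w + s) ` {w. \<alpha> w \<noteq> 0}"
    then obtain u where "\<alpha> u \<noteq> 0" "w = u + s" by blast
    then show "w \<in> {w. \<alpha> (w - s) \<noteq> 0}" by simp
  qed
  have X: "X = {w. \<alpha> w \<noteq> 0} \<union> {w. \<alpha> (w - s) \<noteq> 0}" unfolding X_def by blast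
  have finX: "finite X" unfolding X img[symmetric] using fin by blast
  have 1: "weighted_mean \<alpha> B x = (\<Sum>w\<in>X. \<alpha> w * indicat_real B (T w x))"
    unfolding weighted_mean_def by (intro sum.mono_neutral_left finX) (use X in simp_all)
  have "weighted_mean \<alpha> B (T s x) = (\<Sum>w | \<alpha> w \<noteq> 0. \<alpha> (w + s - s) * indicat_real B (T (w + s) x))"
    unfolding weighted_mean_def by (simp only: T_add add_diff_cancel_right')
  also have "\<dots> = (\<Sum>w\<in>(\<lambda>w. w + s) ` {w. \<alpha> w \<noteq> 0}. \<alpha> (w - s) * indicat_real B (T w x))"
    by (subst sum.reindex) (simp_all add: inj_on_def)
  also have "\<dots> = (\<Sum>w\<in>X. \<alpha> (w - s) * indicat_real B (T w x))"
    unfolding img by (intro sum.mono_neutral_left finX) (use X in simp_all)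
  finally have "weighted_mean \<alpha> B (T s x) - weighted_mean \<alpha> B x =
      (\<Sum>w\<in>X. (\<alpha> (w - s) - \<alpha> w) * indicat_real B (T w x))"
    by (simp add: 1 sum_subtractf left_diff_distrib)
  also have "\<bar>\<dots>\<bar> \<le> (\<Sum>w\<in>X. \<bar>(\<alpha> (w - s) - \<alpha> w) * indicat_real B (T w x)\<bar>)" by (rule sum_abs)
  also have "\<dots> \<le> (\<Sum>w\<in>X. \<bar>\<alpha> (w - s) - \<alpha> w\<bar>)"
    by (intro sum_mono) (simp add: abs_mult indicator_def)
  finally show ?thesis unfolding X_def .
qed

text \<open>The map \<open>c\<close> is free because the estimate is used twice: with
  \<open>c w\<close> a nearby point of a net, for compactness of the means, and with
  \<open>c w = 0\<close>, for closeness to the indicator itself.\<close>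

lemma weighted_mean_close:
  assumes B[measurable]: "B \<in> sets borel" and \<alpha>: "\<And>w. 0 \<le> \<alpha> w" "(\<Sum>w | \<alpha> w \<noteq> 0. \<alpha> w) = 1"
    and d: "\<And>w. \<alpha> w \<noteq> 0 \<Longrightarrow> disp B (w - c w) \<le> e"
  shows "(LINT x|\<mu>. \<bar>weighted_mean \<alpha> B x - (\<Sum>w | \<alpha> w \<noteq> 0. \<alpha> w * indicat_real B (T (c w) x))\<bar>) \<le> e"
proof -
  let ?q = "\<lambda>x. \<Sum>w | \<alpha> w \<noteq> 0. \<alpha> w * indicat_real B (T (c w) x)"
  let ?d = "\<lambda>w x. \<bar>indicat_real B (T w x) - indicat_real B (T (c w) x)\<bar>"
  have pt: "\<bar>weighted_mean \<alpha> B x - ?q x\<bar> \<le> (\<Sum>w | \<alpha> w \<noteq> 0. \<alpha> w * ?d w x)" for x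
  proof -
    have "weighted_mean \<alpha> B x - ?q x = (\<Sum>w | \<alpha> w \<noteq> 0. \<alpha> w * (indicat_real B (T w x) - indicat_real B (T (c w) x)))"
      unfolding weighted_mean_def sum_subtractf[symmetric] by (simp only: right_diff_distrib)
    also have "\<bar>\<dots>\<bar> \<le> (\<Sum>w | \<alpha> w \<noteq> 0. \<bar>\<alpha> w * (indicat_real B (T w x) - indicat_real B (T (c w) x))\<bar>)"
      by (rule sum_abs)
    also have "\<dots> = (\<Sum>w | \<alpha> w \<noteq> 0. \<alpha> w * ?d w x)"
      using \<alpha>(1) by (simp add: abs_mult)
    finally show ?thesis .
  qed
  have qm[measurable]: "?q \<in> borel_measurable borel"
    by (intro borel_measurable_sum borel_measurable_times borel_measurable_const
      measurable_compose[OF T_measurable] borel_measurable_indicator B)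
  have i: "integrable \<mu> (?d w)" for w by (rule integrable_indicator_diff[OF B])
  have i2: "integrable \<mu> (\<lambda>x. \<Sum>w | \<alpha> w \<noteq> 0. \<alpha> w * ?d w x)"
    using i by (intro Bochner_Integration.integrable_sum Bochner_Integration.integrable_mult_right)
  have "(LINT x|\<mu>. \<bar>weighted_mean \<alpha> B x - ?q x\<bar>) \<le> (LINT x|\<mu>. (\<Sum>w | \<alpha> w \<noteq> 0. \<alpha> w * ?d w x))"
  proof (rule integral_mono[OF _ i2 pt])
    show "integrable \<mu> (\<lambda>x. \<bar>weighted_mean \<alpha> B x - ?q x\<bar>)"
      by (rule Bochner_Integration.integrable_bound[OF i2]) (use pt in \<open>auto intro!: AE_I2 order_trans[OF pt]\<close>)
  qed
  also have "\<dots> = (\<Sum>w | \<alpha> w \<noteq> 0. \<alpha> w * disp B (w - c w))"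
    using i by (simp add: disp_diff[OF B])
  also have "\<dots> \<le> (\<Sum>w | \<alpha> w \<noteq> 0. \<alpha> w * e)"
    using d \<alpha>(1) by (intro sum_mono mult_left_mono) auto
  also have "\<dots> = e" using \<alpha>(2) by (simp add: sum_distrib_right[symmetric])
  finally show ?thesis .
qed


text \<open>Convex combinations of a totally bounded set form a totally bounded set. Completeness
  then yields an L2 limit of a subsequence, and a further subsequence converges almost
  everywhere.\<close>

lemma convergent_weighted_means:
  assumes B: "B \<in> kronecker_algebra_strip \<mu> T v b"
    and fin: "\<And>k. finite {w. \<alpha> k w \<noteq> 0}" and sub: "\<And>k w. \<alpha> k w \<noteq> 0 \<Longrightarrow> w \<in> strip v b"
    and \<alpha>: "\<And>k w. 0 \<le> \<alpha> k w" "\<And>k. (\<Sum>w | \<alpha> k w \<noteq> 0. \<alpha> k w) = 1"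
  shows "\<exists>r q. strict_mono (r :: nat \<Rightarrow> nat) \<and> q \<in> borel_measurable borel \<and>
    (AE x in \<mu>. (\<lambda>j. weighted_mean (\<alpha> (r j)) B x) \<longlonglongrightarrow> (q x :: real))"
proof -
  interpret L2: Metric_space "L2_space \<mu>" "L2_dist \<mu>" by (rule Metric_space_L2)
  have Bm[measurable]: "B \<in> sets borel" using B mem_kronecker_algebra_strip_iff by blast
  define p where "p k = weighted_mean (\<alpha> k) B" for k
  have [measurable]: "p k \<in> borel_measurable borel" for k unfolding p_def by measurable
  have p01: "0 \<le> p k x" "p k x \<le> 1" for k x
    unfolding p_def using weighted_mean_bounds[of "\<alpha> k"] \<alpha> by auto
  define F where "F k = L2_class \<mu> (\<lambda>x. complex_of_real (p k x))" for k
  have sq: "(\<lambda>x. complex_of_real (p k x)) \<in> sq_integrable \<mu>" for k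
  proof -
    have "integrable \<mu> (\<lambda>x. (cmod (complex_of_real (p k x)))\<^sup>2)"
      using p01 by (intro integrable_bounded[of _ 1]) (auto simp: power_le_one)
    then show ?thesis by (simp add: sq_integrable_def)
  qed
  have F: "F k \<in> L2_space \<mu>" for k unfolding F_def by (rule L2_class_in[OF sq])
  have dF: "L2_dist \<mu> (F k) (F l) \<le> sqrt (LINT x|\<mu>. \<bar>p k x - p l x\<bar>)" for k l
  proof -
    \<comment> \<open>Values in [0, 1] let L1 bounds, which come from \<open>disp\<close>, control
      L2 distances.\<close>
    have le: "(p k x - p l x)\<^sup>2 \<le> \<bar>p k x - p l x\<bar>" for x
    proof -
      have "\<bar>p k x - p l x\<bar> \<le> 1" using p01[of k x] p01[of l x] by linarith
      then have "\<bar>p k x - p l x\<bar> * \<bar>p k x - p l x\<bar> \<le> \<bar>p k x - p l x\<bar> * 1"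
        by (intro mult_left_mono) auto
      then show ?thesis by (simp add: power2_eq_square abs_mult_self_eq)
    qed
    have i: "integrable \<mu> (\<lambda>x. \<bar>p k x - p l x\<bar>)"
    proof (rule integrable_bounded[of _ 1])
      show "\<bar>\<bar>p k x - p l x\<bar>\<bar> \<le> 1" for x using p01[of k x] p01[of l x] by linarith
    qed measurable
    have "L2_dist \<mu> (F k) (F l) = sqrt (LINT x|\<mu>. (p k x - p l x)\<^sup>2)"
      unfolding F_def L2_dist_class[OF sq sq] of_real_diff[symmetric] norm_of_real by simp
    also have "\<dots> \<le> sqrt (LINT x|\<mu>. \<bar>p k x - p l x\<bar>)"
      by (intro real_sqrt_le_mono integral_mono Bochner_Integration.integrable_bound[OF i] i)
        (use le in auto)
    finally show ?thesis .
  qed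
  \<comment> \<open>Moving every time to its net point turns the mean into a combination of finitely
    many fixed functions, whose coefficients are then rounded. Two moves and the rounding cost
    \<open>e\<close> each.\<close>
  have coloring: "\<exists>c :: nat \<Rightarrow> ('n lattice \<Rightarrow> nat). finite (range c) \<and>
      (\<forall>k l. c k = c l \<longrightarrow> (LINT x|\<mu>. \<bar>p k x - p l x\<bar>) \<le> 3 * e)" if e: "e > 0" for e
  proof -
    obtain W where W: "finite W" "\<And>w. w \<in> strip v b \<Longrightarrow> \<exists>u\<in>W. disp B (w - u) < e"
      using B e unfolding mem_kronecker_algebra_strip_iff by meson
    obtain h where h: "\<And>w. w \<in> strip v b \<Longrightarrow> h w \<in> W \<and> disp B (w - h w) < e"
      using W(2) by metis
    \<comment> \<open>Rounding \<open>card W\<close> coefficients to multiples of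
      \<open>1 / M\<close> must cost at most \<open>e\<close> in total; the summand 1 makes
      \<open>M\<close> positive when \<open>W\<close> is empty.\<close>
    define M where "M = nat \<lceil>real (card W) / e\<rceil> + 1"
    have M: "M > 0" "real (card W) / real M \<le> e"
    proof -
      show "M > 0" by (simp add: M_def)
      have "real (card W) / e \<le> real M" unfolding M_def by linarith
      then show "real (card W) / real M \<le> e" using e \<open>M > 0\<close> by (simp add: field_simps)
    qed
    define C where "C k u = (\<Sum>w | \<alpha> k w \<noteq> 0 \<and> h w = u. \<alpha> k w)" for k u
    define q where "q k x = (\<Sum>w | \<alpha> k w \<noteq> 0. \<alpha> k w * indicat_real B (T (h w) x))" for k x
    have qC: "q k x = (\<Sum>u\<in>W. C k u * indicat_real B (T u x))" for k x
    proof -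
      have "(\<Sum>u\<in>W. \<Sum>w | w \<in> {w. \<alpha> k w \<noteq> 0} \<and> h w = u. \<alpha> k w * indicat_real B (T (h w) x)) =
          (\<Sum>w | \<alpha> k w \<noteq> 0. \<alpha> k w * indicat_real B (T (h w) x))"
        using h sub by (intro sum.group fin W(1)) blast
      then have "q k x = (\<Sum>u\<in>W. \<Sum>w | \<alpha> k w \<noteq> 0 \<and> h w = u. \<alpha> k w * indicat_real B (T (h w) x))"
        unfolding q_def by simp
      also have "\<dots> = (\<Sum>u\<in>W. C k u * indicat_real B (T u x))"
        unfolding C_def sum_distrib_right by (intro sum.cong refl) auto
      finally show ?thesis .
    qed
    have C01: "0 \<le> C k u" "C k u \<le> 1" for k u
    proof -
      show "0 \<le> C k u" unfolding C_def by (intro sum_nonneg \<alpha>(1))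
      have "C k u \<le> (\<Sum>w | \<alpha> k w \<noteq> 0. \<alpha> k w)"
        unfolding C_def by (intro sum_mono2 fin) (use \<alpha>(1) in auto)
      then show "C k u \<le> 1" by (simp add: \<alpha>(2))
    qed
    have pq: "(LINT x|\<mu>. \<bar>p k x - q k x\<bar>) \<le> e" for k
      unfolding p_def q_def using \<alpha> h sub less_imp_le by (intro weighted_mean_close Bm) blast+
    have qm[measurable]: "q k \<in> borel_measurable borel" for k unfolding q_def
      by (intro borel_measurable_sum borel_measurable_times borel_measurable_const
        measurable_compose[OF T_measurable] borel_measurable_indicator Bm)
    have q01: "0 \<le> q k x \<and> q k x \<le> 1" for k x
    proof -
      have "q k x \<le> (\<Sum>w | \<alpha> k w \<noteq> 0. \<alpha> k w)"
        unfolding q_def using \<alpha>(1) by (intro sum_mono) (simp add: mult_left_le)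
      then show ?thesis using \<alpha> by (simp add: q_def sum_nonneg)
    qed
    define c where "c k = (\<lambda>u\<in>W. nat \<lfloor>real M * C k u\<rfloor>)" for k
    have "range c \<subseteq> PiE W (\<lambda>_. {..M})"
    proof (intro image_subsetI)
      fix k
      have "nat \<lfloor>real M * C k u\<rfloor> \<le> M" for u
      proof -
        have "real M * C k u \<le> real M" using C01[of k u] by (simp add: mult_left_le)
        then have "\<lfloor>real M * C k u\<rfloor> \<le> int M" by linarith
        then show ?thesis by simp
      qed
      then show "c k \<in> PiE W (\<lambda>_. {..M})" unfolding c_def by auto
    qed
    then have "finite (range c)" by (rule finite_subset) (intro finite_PiE W(1); simp)
    moreover have "(LINT x|\<mu>. \<bar>p k x - p l x\<bar>) \<le> 3 * e" if kl: "c k = c l" for k l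
    proof -
      have near: "\<bar>C k u - C l u\<bar> \<le> 1 / real M" if u: "u \<in> W" for u
      proof -
        have "nat \<lfloor>real M * C k u\<rfloor> = nat \<lfloor>real M * C l u\<rfloor>"
          using fun_cong[OF kl, of u] u by (simp add: c_def)
        moreover have "0 \<le> real M * C k u" "0 \<le> real M * C l u" using C01 by simp_all
        ultimately have "\<lfloor>real M * C k u\<rfloor> = \<lfloor>real M * C l u\<rfloor>" by (simp add: eq_nat_nat_iff)
        then have "\<bar>real M * C k u - real M * C l u\<bar> \<le> 1" by linarith
        then have "real M * \<bar>C k u - C l u\<bar> \<le> 1"
          by (simp add: right_diff_distrib[symmetric] abs_mult)
        then show ?thesis using M(1) by (simp add: field_simps)
      qed
      have qq: "\<bar>q k x - q l x\<bar> \<le> e" for x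
      proof -
        have "q k x - q l x = (\<Sum>u\<in>W. (C k u - C l u) * indicat_real B (T u x))"
          unfolding qC sum_subtractf[symmetric] by (simp only: left_diff_distrib)
        also have "\<bar>\<dots>\<bar> \<le> (\<Sum>u\<in>W. \<bar>(C k u - C l u) * indicat_real B (T u x)\<bar>)" by (rule sum_abs)
        also have "\<dots> \<le> (\<Sum>u\<in>W. 1 / real M)"
        proof (intro sum_mono)
          fix u assume "u \<in> W"
          then show "\<bar>(C k u - C l u) * indicat_real B (T u x)\<bar> \<le> 1 / real M"
            using near by (auto simp: indicator_def)
        qed
        also have "\<dots> \<le> e" using M(2) by simp
        finally show ?thesis .
      qed
      have ipq: "integrable \<mu> (\<lambda>x. \<bar>p i x - q i x\<bar>)" for i
      proof (rule integrable_bounded[of _ 1])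
        show "\<bar>\<bar>p i x - q i x\<bar>\<bar> \<le> 1" for x using p01[of i x] q01[of i x] by linarith
      qed measurable
      have ipp: "integrable \<mu> (\<lambda>x. \<bar>p k x - p l x\<bar>)"
      proof (rule integrable_bounded[of _ 1])
        show "\<bar>\<bar>p k x - p l x\<bar>\<bar> \<le> 1" for x using p01[of k x] p01[of l x] by linarith
      qed measurable
      have "(LINT x|\<mu>. \<bar>p k x - p l x\<bar>) \<le> (LINT x|\<mu>. \<bar>p k x - q k x\<bar> + \<bar>p l x - q l x\<bar> + e)"
      proof (intro integral_mono ipp)
        show "integrable \<mu> (\<lambda>x. \<bar>p k x - q k x\<bar> + \<bar>p l x - q l x\<bar> + e)" using ipq by simp
        show "\<bar>p k x - p l x\<bar> \<le> \<bar>p k x - q k x\<bar> + \<bar>p l x - q l x\<bar> + e" for x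
          using qq[of x] by linarith
      qed
      also have "\<dots> = (LINT x|\<mu>. \<bar>p k x - q k x\<bar>) + (LINT x|\<mu>. \<bar>p l x - q l x\<bar>) + e"
        using ipq prob_space by simp
      also have "\<dots> \<le> 3 * e" using pq[of k] pq[of l] by simp
      finally show ?thesis .
    qed
    ultimately show ?thesis by blast
  qed
  have "L2.mtotally_bounded (range F)"
    unfolding L2.mtotally_bounded_def
  proof (intro allI impI)
    fix \<epsilon> :: real assume \<epsilon>: "\<epsilon> > 0"
    \<comment> \<open>The L1 error \<open>3 * (\<epsilon>\<^sup>2 / 4)\<close> has a square root
      below \<open>\<epsilon>\<close>.\<close>
    obtain c :: "nat \<Rightarrow> ('n lattice \<Rightarrow> nat)" where c: "finite (range c)"
      "\<And>k l. c k = c l \<Longrightarrow> (LINT x|\<mu>. \<bar>p k x - p l x\<bar>) \<le> 3 * (\<epsilon>\<^sup>2 / 4)"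
      using coloring[of "\<epsilon>\<^sup>2 / 4"] \<epsilon> by (metis zero_less_divide_iff zero_less_numeral zero_less_power)
    define R where "R = inv c ` range c"
    have "F k \<in> (\<Union>x\<in>F ` R. L2.mball x \<epsilon>)" for k
    proof -
      define l where "l = inv c (c k)"
      have l: "l \<in> R" "c l = c k" unfolding l_def R_def by (simp_all add: f_inv_into_f)
      have "L2_dist \<mu> (F l) (F k) \<le> sqrt (3 * (\<epsilon>\<^sup>2 / 4))"
        using dF[of l k] c(2)[OF l(2)] by (meson order_trans real_sqrt_le_mono)
      also have "\<dots> < \<epsilon>" using \<epsilon> by (intro real_less_lsqrt) auto
      finally have "F k \<in> L2.mball (F l) \<epsilon>" using F by (simp add: L2.in_mball)
      then show ?thesis using l(1) by blast
    qed
    then show "\<exists>K. finite K \<and> K \<subseteq> range F \<and> range F \<subseteq> (\<Union>x\<in>K. L2.mball x \<epsilon>)"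
      using c(1) by (intro exI[of _ "F ` R"]) (auto simp: R_def)
  qed
  then obtain r1 :: "nat \<Rightarrow> nat" where r1: "strict_mono r1" "L2.MCauchy (F \<circ> r1)"
    unfolding L2.mtotally_bounded_sequentially by blast
  then obtain G where G: "limitin L2.mtopology (F \<circ> r1) G sequentially"
    using mcomplete_L2[OF finite_measure_axioms] unfolding L2.mcomplete_def by blast
  then have GL: "G \<in> L2_space \<mu>" and lim: "(\<lambda>j. L2_dist \<mu> (F (r1 j)) G) \<longlonglongrightarrow> 0"
    unfolding L2.limitin_metric_dist_null by (simp_all add: comp_def)
  note g = L2_rep_sq_integrable[OF GL]
  define u where "u j x = (cmod (complex_of_real (p (r1 j) x) - L2_rep G x))\<^sup>2" for j x
  have ui: "integrable \<mu> (u j)" for j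
    unfolding u_def using sq_integrable_diff[OF sq g] by (simp add: sq_integrable_def)
  have "L2_dist \<mu> (F (r1 j)) G = sqrt (LINT x|\<mu>. u j x)" for j
    using L2_dist_class[OF sq g, of "r1 j"] L2_class_rep[OF GL] unfolding F_def u_def by simp
  then have "(\<lambda>j. (sqrt (LINT x|\<mu>. u j x))\<^sup>2) \<longlonglongrightarrow> 0\<^sup>2"
    using tendsto_power[OF lim, of 2] by simp
  then have "(\<lambda>j. LINT x|\<mu>. norm (u j x)) \<longlonglongrightarrow> 0"
    by (simp add: u_def)
  from tendsto_L1_AE_subseq[OF ui this]
  obtain r2 :: "nat \<Rightarrow> nat" where r2: "strict_mono r2" "AE x in \<mu>. (\<lambda>n. u (r2 n) x) \<longlonglongrightarrow> 0" by blast
  have "AE x in \<mu>. (\<lambda>j. weighted_mean (\<alpha> ((r1 \<circ> r2) j)) B x) \<longlonglongrightarrow> Re (L2_rep G x)"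
    using r2(2)
  proof eventually_elim
    case (elim x)
    have "(\<lambda>j. sqrt (u (r2 j) x)) \<longlonglongrightarrow> sqrt 0" by (intro tendsto_intros elim)
    then have "(\<lambda>j. complex_of_real (p (r1 (r2 j)) x) - L2_rep G x) \<longlonglongrightarrow> 0"
      by (simp add: u_def tendsto_norm_zero_iff)
    then have "(\<lambda>j. complex_of_real (p (r1 (r2 j)) x)) \<longlonglongrightarrow> L2_rep G x"
      by (rule LIM_zero_cancel)
    from tendsto_Re[OF this] show ?case by (simp add: p_def)
  qed
  moreover have "L2_rep G \<in> borel_measurable borel"
    using g by (simp add: sq_integrable_def measurable_cong_sets[OF sets_eq_borel refl])
  then have "(\<lambda>x. Re (L2_rep G x)) \<in> borel_measurable borel"
    by (simp add: borel_measurable_complex_iff)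
  ultimately show ?thesis
    using strict_mono_o[OF r1(1) r2(1)] by blast
qed

text \<open>Averaging \<open>1\<^sub>B\<close> over the return times of its orbit, with weights that are Lipschitz for the seminorm,
  makes the orbit equicontinuous in the uniform norm without using eigenfunctions.\<close>

lemma lipschitz_approximation:
  fixes v :: "real \<times> (real ^ 'n)"
  assumes B: "B \<in> kronecker_algebra_strip \<mu> T v (\<chi> i. 1)" and \<eta>: "0 < \<eta>" "\<eta> \<le> 1"
  shows "\<exists>p C. p \<in> borel_measurable borel \<and> (\<forall>x. 0 \<le> p x \<and> p x \<le> 1) \<and> 0 \<le> C \<and>
    (LINT x|\<mu>. \<bar>p x - indicat_real B x\<bar>) \<le> \<eta> \<and>
    (AE x in \<mu>. \<forall>s. \<bar>p (T s x) - p x\<bar> \<le> C * wdisp v B s)"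
proof -
  have Bm[measurable]: "B \<in> sets borel" using B mem_kronecker_algebra_strip_iff by blast
  obtain \<alpha> C where C: "0 \<le> C"
    and fin: "\<And>k. finite {w. \<alpha> k w \<noteq> 0}" and \<alpha>1: "\<And>k. (\<Sum>w | \<alpha> k w \<noteq> 0. \<alpha> k w) = (1::real)"
    and \<alpha>0: "\<And>k w. 0 \<le> \<alpha> k w" and supp: "\<And>k w. \<alpha> k w \<noteq> 0 \<Longrightarrow> w \<in> strip v (\<chi> i. 1) \<and> wdisp v B w < \<eta>"
    and shift: "\<And>k s. (\<Sum>w | \<alpha> k w \<noteq> 0 \<or> \<alpha> k (w - s) \<noteq> 0. \<bar>\<alpha> k (w - s) - \<alpha> k w\<bar>) \<le>
      C * (wdisp v B s + \<bar>real_of_int (fst s)\<bar> / real (Suc k))"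
    using almost_invariant_weights[OF assms] by blast
  have "\<exists>r q. strict_mono (r :: nat \<Rightarrow> nat) \<and> q \<in> borel_measurable borel \<and>
      (AE x in \<mu>. (\<lambda>j. weighted_mean (\<alpha> (r j)) B x) \<longlonglongrightarrow> (q x :: real))"
    using supp by (intro convergent_weighted_means[OF B] fin \<alpha>0 \<alpha>1) blast
  then obtain r :: "nat \<Rightarrow> nat" and q :: "'a \<Rightarrow> real" where r: "strict_mono r"
    and qm[measurable]: "q \<in> borel_measurable borel"
    and q: "AE x in \<mu>. (\<lambda>j. weighted_mean (\<alpha> (r j)) B x) \<longlonglongrightarrow> q x"
    by blast
  define P where "P j = weighted_mean (\<alpha> (r j)) B" for j
  have Pm[measurable]: "P j \<in> borel_measurable borel" for j unfolding P_def by measurable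
  have P01: "0 \<le> P j x" "P j x \<le> 1" for j x
    unfolding P_def using weighted_mean_bounds[of "\<alpha> (r j)"] \<alpha>0 \<alpha>1 by auto
  \<comment> \<open>Clamping makes the bounds hold everywhere, as the maximal inequality and
    \<open>lusin\<close> expect, and changes the limit on a null set only.\<close>
  define p where "p x = max 0 (min 1 (q x))" for x
  have pm[measurable]: "p \<in> borel_measurable borel" unfolding p_def by measurable
  have p01: "0 \<le> p x" "p x \<le> 1" for x by (simp_all add: p_def)
  have p: "AE x in \<mu>. (\<lambda>j. P j x) \<longlonglongrightarrow> p x"
    using q
  proof eventually_elim
    case (elim x)
    then have lim: "(\<lambda>j. P j x) \<longlonglongrightarrow> q x" by (simp add: P_def)
    have "0 \<le> q x" "q x \<le> 1"
      using LIMSEQ_le_const[OF lim, of 0] LIMSEQ_le_const2[OF lim, of 1] P01 by blast+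
    then show ?case using lim by (simp add: p_def)
  qed
  have close: "(LINT x|\<mu>. \<bar>P j x - indicat_real B x\<bar>) \<le> \<eta>" for j
  proof -
    have "(LINT x|\<mu>. \<bar>P j x - (\<Sum>w | \<alpha> (r j) w \<noteq> 0. \<alpha> (r j) w * indicat_real B (T 0 x))\<bar>) \<le> \<eta>"
      unfolding P_def
    proof (intro weighted_mean_close Bm \<alpha>0 \<alpha>1)
      fix w assume "\<alpha> (r j) w \<noteq> 0"
      then have "wdisp v B w < \<eta>" using supp by blast
      then show "disp B (w - 0) \<le> \<eta>" using side_nonneg[of v w] by (simp add: wdisp_def)
    qed
    then show ?thesis by (simp add: sum_distrib_right[symmetric] \<alpha>1)
  qed
  have "(\<lambda>j. LINT x|\<mu>. \<bar>P j x - indicat_real B x\<bar>) \<longlonglongrightarrow> (LINT x|\<mu>. \<bar>p x - indicat_real B x\<bar>)"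
  proof (rule integral_dominated_convergence[where w = "\<lambda>_. 1"])
    show "AE x in \<mu>. (\<lambda>j. \<bar>P j x - indicat_real B x\<bar>) \<longlonglongrightarrow> \<bar>p x - indicat_real B x\<bar>"
      using p by eventually_elim (intro tendsto_intros)
    show "AE x in \<mu>. norm \<bar>P j x - indicat_real B x\<bar> \<le> 1" for j
      using P01 by (intro AE_I2) (auto simp: indicator_def)
  qed auto
  then have pclose: "(LINT x|\<mu>. \<bar>p x - indicat_real B x\<bar>) \<le> \<eta>"
    by (rule LIMSEQ_le_const2) (use close in blast)
  have "AE x in \<mu>. (\<lambda>j. P j (T s x)) \<longlonglongrightarrow> p (T s x)" for s
    by (rule AE_comp_tds[OF tds inv p])
  \<comment> \<open>The lattice is countable, so one null set serves all shifts.\<close>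
  then have "AE x in \<mu>. \<forall>s. (\<lambda>j. P j (T s x)) \<longlonglongrightarrow> p (T s x)"
    by (subst AE_all_countable) blast
  then have "AE x in \<mu>. \<forall>s. \<bar>p (T s x) - p x\<bar> \<le> C * wdisp v B s"
  proof eventually_elim
    case (elim x)
    show ?case
    proof
      fix s
      have "(\<lambda>j. P j (T s x)) \<longlonglongrightarrow> p (T s x)" "(\<lambda>j. P j (T 0 x)) \<longlonglongrightarrow> p (T 0 x)" using elim by blast+
      then have l1: "(\<lambda>j. \<bar>P j (T s x) - P j x\<bar>) \<longlonglongrightarrow> \<bar>p (T s x) - p x\<bar>"
        by (intro tendsto_intros) simp_all
      \<comment> \<open>For fixed \<open>s\<close> the cost of truncating along the strip vanishes
        in the limit, leaving a modulus in \<open>wdisp\<close> alone.\<close>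
      have "(\<lambda>k. \<bar>real_of_int (fst s)\<bar> / real (Suc k)) \<longlonglongrightarrow> 0"
        by (rule LIMSEQ_Suc[OF lim_const_over_n])
      then have "((\<lambda>k. \<bar>real_of_int (fst s)\<bar> / real (Suc k)) \<circ> r) \<longlonglongrightarrow> 0"
        using r by (rule LIMSEQ_subseq_LIMSEQ)
      then have "(\<lambda>j. C * (wdisp v B s + \<bar>real_of_int (fst s)\<bar> / real (Suc (r j)))) \<longlonglongrightarrow> C * (wdisp v B s + 0)"
        by (intro tendsto_intros) (simp add: comp_def)
      moreover have "\<bar>P j (T s x) - P j x\<bar> \<le> C * (wdisp v B s + \<bar>real_of_int (fst s)\<bar> / real (Suc (r j)))" for j
        unfolding P_def using weighted_mean_shift[OF fin, of "r j" B s x] shift[of "r j" s] by linarith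
      ultimately show "\<bar>p (T s x) - p x\<bar> \<le> C * wdisp v B s"
        using LIMSEQ_le[OF l1] by simp
    qed
  qed
  then show ?thesis using pm p01 C pclose by blast
qed

section \<open>Discrete spectrum implies equicontinuity in the mean\<close>


text \<open>The indicator is split into \<open>p\<close> and an error \<open>h\<close>. The error is
  small on average along orbits by the maximal inequality, for all \<open>k\<close> at once. For
  \<open>p\<close> the Lipschitz bound replaces each time by a point of a finite net, and finitely
  many functions are controlled by Lusin.\<close>

lemma mean_oscillation_of_set:
  fixes v :: "real \<times> (real ^ 'n)"
  assumes B: "B \<in> kronecker_algebra \<mu> T v" and b: "b \<in> pos_vectors" and \<eta>: "\<eta> > 0"
  shows "\<exists>K\<in>sets borel. \<exists>\<delta>>0. prob K > 1 - \<eta> \<and> (\<forall>x\<in>K. \<forall>y\<in>K. dist x y < \<delta> \<longrightarrow>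
    (\<forall>k. (\<Sum>w\<in>strip_upto v b k. \<bar>indicat_real B (T w x) - indicat_real B (T w y)\<bar>) \<le>
      \<eta> * real (card (strip_upto v b k))))"
proof -
  have B1: "B \<in> kronecker_algebra_strip \<mu> T v (\<chi> i. 1)" using B by (simp add: kronecker_algebra_def)
  have Bb: "B \<in> kronecker_algebra_strip \<mu> T v b"
    using B kronecker_algebra_strip_eq[OF tds inv b, of v] by simp
  have Bm[measurable]: "B \<in> sets borel" using B1 mem_kronecker_algebra_strip_iff by blast
  obtain C0 where C0: "C0 > 0" and max: "\<And>h t. (\<forall>x. 0 \<le> h x) \<Longrightarrow> integrable \<mu> h \<Longrightarrow> t > 0 \<Longrightarrow>
    \<exists>K\<in>sets borel. prob K \<ge> 1 - C0 * (LINT x|\<mu>. h x) / t \<and>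
      (\<forall>x\<in>K. \<forall>k. (\<Sum>w\<in>strip_upto v b k. h (T w x)) \<le> t * real (card (strip_upto v b k)))"
    using maximal_inequality[OF b, of v] by metis
  \<comment> \<open>Chosen so that the maximal inequality at threshold \<open>\<eta> / 4\<close>
    loses measure at most \<open>\<eta> / 4\<close>.\<close>
  define \<eta>1 where "\<eta>1 = min 1 (\<eta> * \<eta> / (16 * C0))"
  have \<eta>1: "0 < \<eta>1" "\<eta>1 \<le> 1" "\<eta>1 \<le> \<eta> * \<eta> / (16 * C0)" using \<eta> C0 by (simp_all add: \<eta>1_def)
  obtain p C where pm[measurable]: "p \<in> borel_measurable borel" and p01: "\<And>x. 0 \<le> p x \<and> p x \<le> 1" and C: "0 \<le> C"
    and close: "(LINT x|\<mu>. \<bar>p x - indicat_real B x\<bar>) \<le> \<eta>1"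
    and lip: "AE x in \<mu>. \<forall>s. \<bar>p (T s x) - p x\<bar> \<le> C * wdisp v B s"
    using lipschitz_approximation[OF B1 \<eta>1(1,2)] by blast
  define h where "h x = \<bar>p x - indicat_real B x\<bar>" for x
  have "integrable \<mu> h"
  proof (rule integrable_bounded[of _ 1])
    show "\<bar>h x\<bar> \<le> 1" for x using p01[of x] by (auto simp: h_def indicator_def)
  qed (simp add: h_def[abs_def])
  then obtain K1 where K1: "K1 \<in> sets borel" "prob K1 \<ge> 1 - C0 * (LINT x|\<mu>. h x) / (\<eta> / 4)"
      "\<And>x k. x \<in> K1 \<Longrightarrow> (\<Sum>w\<in>strip_upto v b k. h (T w x)) \<le> \<eta> / 4 * real (card (strip_upto v b k))"
    using max[of h "\<eta> / 4"] \<eta> by (auto simp: h_def)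
  have "C0 * (LINT x|\<mu>. h x) \<le> C0 * (\<eta> * \<eta> / (16 * C0))"
    using close \<eta>1(3) C0 by (intro mult_left_mono) (simp_all add: h_def)
  also have "\<dots> = (\<eta> / 4) * (\<eta> / 4)" using C0 by (simp add: field_simps)
  finally have "C0 * (LINT x|\<mu>. h x) / (\<eta> / 4) \<le> \<eta> / 4" using \<eta> by (simp add: field_simps)
  then have pK1: "prob K1 > 1 - \<eta> / 3" using K1(2) \<eta> by linarith
  \<comment> \<open>Here \<open>C + 1\<close> in place of \<open>C\<close> allows
    \<open>C = 0\<close>.\<close>
  define e where "e = \<eta> / (8 * (C + 1))"
  have e: "e > 0" "C * e \<le> \<eta> / 8"
  proof -
    show "e > 0" using \<eta> C by (simp add: e_def)
    have "C * e \<le> (C + 1) * e" using \<open>e > 0\<close> by (intro mult_right_mono) auto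
    also have "\<dots> = \<eta> / 8" using C by (simp add: e_def field_simps)
    finally show "C * e \<le> \<eta> / 8" .
  qed
  obtain W where W: "finite W" "\<And>w. w \<in> strip v b \<Longrightarrow> \<exists>u\<in>W. wdisp v B (w - u) < e"
    using wdisp_net[OF Bb e(1)] by metis
  have "\<exists>K\<in>sets borel. \<exists>\<delta>>0. prob K > 1 - \<eta> / 3 \<and>
    (\<forall>x\<in>K. \<forall>y\<in>K. dist x y < \<delta> \<longrightarrow> (\<forall>u\<in>W. \<bar>p (T u x) - p (T u y)\<bar> \<le> \<eta> / 4))"
    using p01 \<eta> by (intro lusin[OF W(1)] measurable_compose[OF T_measurable pm]) auto
  then obtain K2 \<delta> where K2: "K2 \<in> sets borel" and \<delta>: "\<delta> > 0" and pK2: "prob K2 > 1 - \<eta> / 3"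
    and lus: "\<And>x y u. x \<in> K2 \<Longrightarrow> y \<in> K2 \<Longrightarrow> dist x y < \<delta> \<Longrightarrow> u \<in> W \<Longrightarrow> \<bar>p (T u x) - p (T u y)\<bar> \<le> \<eta> / 4"
    by metis
  \<comment> \<open>The Lipschitz bound is applied at the points \<open>T u z\<close>, so the
    exceptional set must be null for all base times \<open>u\<close> simultaneously.\<close>
  have "AE x in \<mu>. \<forall>s. \<bar>p (T s (T u x)) - p (T u x)\<bar> \<le> C * wdisp v B s" for u
    by (rule AE_comp_tds[OF tds inv lip])
  moreover define good where "good x \<longleftrightarrow> (\<forall>u s. \<bar>p (T s (T u x)) - p (T u x)\<bar> \<le> C * wdisp v B s)" for x
  ultimately have "AE x in \<mu>. good x"
    unfolding good_def by (subst AE_all_countable) blast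
  then obtain N where N: "{x \<in> space \<mu>. \<not> good x} \<subseteq> N" "emeasure \<mu> N = 0" "N \<in> sets \<mu>" by (rule AE_E)
  define K3 where "K3 = - N"
  have K3: "K3 \<in> sets borel" using N(3) by (simp add: K3_def sets_eq_borel)
  have "prob K3 = 1"
    using prob_compl[OF N(3)] N(2) by (simp add: K3_def Compl_eq_Diff_UNIV measure_def)
  then have pK3: "prob K3 > 1 - \<eta> / 3" using \<eta> by simp
  have lip3: "\<bar>p (T s (T u x)) - p (T u x)\<bar> \<le> C * wdisp v B s" if "x \<in> K3" for x s u
  proof -
    have "good x" using that N(1) by (auto simp: K3_def)
    then show ?thesis unfolding good_def by blast
  qed
  define K where "K = (K1 \<inter> K2) \<inter> K3"
  have K: "K \<in> sets borel" unfolding K_def using K1(1) K2 K3 by auto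
  have pK12: "prob (K1 \<inter> K2) > 1 - (\<eta> / 3 + \<eta> / 3)" using K1(1) K2 pK1 pK2 by (rule prob_Int_gt)
  have "K1 \<inter> K2 \<in> sets borel" using K1(1) K2 by (rule sets.Int)
  then have "prob K > 1 - (\<eta> / 3 + \<eta> / 3 + \<eta> / 3)"
    unfolding K_def using K3 pK12 pK3 by (rule prob_Int_gt)
  then have pK: "prob K > 1 - \<eta>" by linarith
  have osc: "(\<Sum>w\<in>strip_upto v b k. \<bar>indicat_real B (T w x) - indicat_real B (T w y)\<bar>) \<le>
      \<eta> * real (card (strip_upto v b k))" if x: "x \<in> K" and y: "y \<in> K" and xy: "dist x y < \<delta>" for x y k
  proof -
    \<comment> \<open>Here \<open>\<eta> / 2\<close> is \<open>\<eta> / 4\<close> from Lusin plus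
      \<open>\<eta> / 8\<close> for the passage to the net at each of the two points; the averages
      of \<open>h\<close> add \<open>\<eta> / 4\<close> each.\<close>
    have pt: "\<bar>indicat_real B (T w x) - indicat_real B (T w y)\<bar> \<le> h (T w x) + h (T w y) + \<eta> / 2"
      if w: "w \<in> strip v b" for w
    proof -
      obtain u where u: "u \<in> W" "wdisp v B (w - u) < e" using W(2)[OF w] by blast
      have near: "\<bar>p (T w z) - p (T u z)\<bar> \<le> \<eta> / 8" if z: "z \<in> K" for z
      proof -
        have "\<bar>p (T (w - u) (T u z)) - p (T u z)\<bar> \<le> C * wdisp v B (w - u)"
          using z by (intro lip3) (simp add: K_def)
        moreover have "T (w - u) (T u z) = T w z" by (simp add: T_add[symmetric])
        moreover have "C * wdisp v B (w - u) \<le> C * e" using u(2) C by (intro mult_left_mono) auto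
        ultimately show ?thesis using e(2) by simp
      qed
      have "\<bar>p (T u x) - p (T u y)\<bar> \<le> \<eta> / 4"
        using x y xy u(1) by (intro lus) (simp_all add: K_def)
      then show ?thesis using near[OF x] near[OF y] unfolding h_def by linarith
    qed
    have "(\<Sum>w\<in>strip_upto v b k. \<bar>indicat_real B (T w x) - indicat_real B (T w y)\<bar>) \<le>
        (\<Sum>w\<in>strip_upto v b k. h (T w x) + h (T w y) + \<eta> / 2)"
      by (intro sum_mono pt) (simp add: strip_upto_def)
    also have "\<dots> = (\<Sum>w\<in>strip_upto v b k. h (T w x)) + (\<Sum>w\<in>strip_upto v b k. h (T w y)) +
        \<eta> / 2 * real (card (strip_upto v b k))" by (simp add: sum.distrib)
    also have "\<dots> \<le> \<eta> / 4 * real (card (strip_upto v b k)) + \<eta> / 4 * real (card (strip_upto v b k)) +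
        \<eta> / 2 * real (card (strip_upto v b k))"
      using x y by (intro add_mono K1(3)) (simp_all add: K_def)
    also have "\<dots> = \<eta> * real (card (strip_upto v b k))" by (simp add: algebra_simps)
    finally show ?thesis .
  qed
  show ?thesis
    by (intro bexI[OF _ K] exI[of _ \<delta>] conjI \<delta> pK ballI impI allI) (rule osc)
qed

text \<open>The metric is dominated by finitely many indicators: two points share a ball of radius
  \<open>\<epsilon> / 4\<close>, or the indicator of some ball of the cover tells them apart, which
  costs at most the diameter bound \<open>M\<close>.\<close>

lemma mean_dist_lusin:
  fixes v :: "real \<times> (real ^ 'n)"
  assumes ds: "discrete_spectrum \<mu> T v" and b: "b \<in> pos_vectors" and \<epsilon>: "\<epsilon> > 0" and \<tau>: "\<tau> > 0"
  shows "\<exists>K\<in>sets borel. \<exists>\<delta>>0. prob K > 1 - \<tau> \<and>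
    (\<forall>x\<in>K. \<forall>y\<in>K. dist x y < \<delta> \<longrightarrow> (\<forall>k\<ge>1. mean_dist T v b k x y \<le> \<epsilon>))"
proof -
  obtain Z where Z: "finite Z" "(UNIV :: 'a set) \<subseteq> (\<Union>z\<in>Z. ball z (\<epsilon> / 4))"
    using compactE_image[OF compact_UNIV, of UNIV "\<lambda>z. ball z (\<epsilon> / 4)"] \<epsilon>
    by (metis UNIV_I UN_I centre_in_ball open_ball subsetI zero_less_divide_iff zero_less_numeral)
  obtain M where M: "M > 0" "\<And>x y :: 'a. dist x y \<le> M"
  proof -
    obtain e where "\<And>x y :: 'a. dist x y \<le> e"
      using compact_imp_bounded[OF compact_UNIV] unfolding bounded_two_points by auto
    then have "dist x y \<le> max e 1" for x y :: 'a by (meson max.coboundedI1)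
    then show thesis by (intro that[of "max e 1"]) auto
  qed
  define c where "c = real (card Z) + 1"
  have c: "c > 0" "real (card Z) \<le> c" by (simp_all add: c_def)
  \<comment> \<open>The first bound pays for intersecting \<open>card Z\<close> Lusin sets, the
    second for adding up \<open>card Z\<close> oscillations weighted by \<open>M\<close>.\<close>
  define \<eta> where "\<eta> = min (\<tau> / c) (\<epsilon> / (2 * M * c))"
  have \<eta>: "\<eta> > 0" "(real (card Z) + 1) * \<eta> \<le> \<tau>" "M * (real (card Z) * \<eta>) \<le> \<epsilon> / 2"
  proof -
    show pos: "\<eta> > 0" unfolding \<eta>_def using \<tau> \<epsilon> M(1) c(1) by simp
    have "\<eta> \<le> \<tau> / c" by (simp add: \<eta>_def)
    then have "\<eta> * c \<le> \<tau>" by (simp only: pos_le_divide_eq[OF c(1)])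
    then show "(real (card Z) + 1) * \<eta> \<le> \<tau>" by (simp only: c_def mult.commute)
    have "2 * M * c > 0" by (intro mult_pos_pos M(1) c(1)) simp
    moreover have "\<eta> \<le> \<epsilon> / (2 * M * c)" by (simp add: \<eta>_def)
    ultimately have "\<eta> * (2 * M * c) \<le> \<epsilon>" by (simp only: pos_le_divide_eq)
    moreover have "\<eta> * (2 * M * c) = 2 * (M * (c * \<eta>))" by (simp only: ac_simps)
    moreover have "M * (real (card Z) * \<eta>) \<le> M * (c * \<eta>)"
      using M(1) pos c(2) by (intro mult_left_mono mult_right_mono) auto
    ultimately show "M * (real (card Z) * \<eta>) \<le> \<epsilon> / 2" by linarith
  qed
  let ?osc = "\<lambda>z k x y. \<Sum>w\<in>strip_upto v b k. \<bar>indicat_real (ball z (\<epsilon> / 4)) (T w x) - indicat_real (ball z (\<epsilon> / 4)) (T w y)\<bar>"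
  define Q where "Q z K \<delta> \<longleftrightarrow> K \<in> sets borel \<and> \<delta> > 0 \<and> prob K > 1 - \<eta> \<and> (\<forall>x\<in>K. \<forall>y\<in>K. dist x y < \<delta> \<longrightarrow>
      (\<forall>k. ?osc z k x y \<le> \<eta> * real (card (strip_upto v b k))))" for z K \<delta>
  have "\<forall>z. \<exists>K \<delta>. Q z K \<delta>"
  proof
    fix z :: 'a
    have "ball z (\<epsilon> / 4) \<in> kronecker_algebra \<mu> T v" using ds unfolding discrete_spectrum_def by simp
    from mean_oscillation_of_set[OF this b \<eta>(1)]
    show "\<exists>K \<delta>. Q z K \<delta>" unfolding Q_def by blast
  qed
  then obtain K \<delta> where "\<And>z. Q z (K z) (\<delta> z)" by metis
  then have K: "\<And>z. K z \<in> sets borel" "\<And>z. \<delta> z > 0" "\<And>z. prob (K z) > 1 - \<eta>"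
    "\<And>z x y k. x \<in> K z \<Longrightarrow> y \<in> K z \<Longrightarrow> dist x y < \<delta> z \<Longrightarrow> ?osc z k x y \<le> \<eta> * real (card (strip_upto v b k))"
    unfolding Q_def by blast+
  define K' where "K' = (\<Inter>z\<in>Z. K z)"
  define \<delta>' where "\<delta>' = Min (insert 1 (\<delta> ` Z))"
  have K'm: "K' \<in> sets borel" unfolding K'_def
    using K(1) countable_finite[OF Z(1)] by (intro sets.countable_INT'') auto
  have "prob K' > 1 - (real (card Z) + 1) * \<eta>"
    unfolding K'_def using K(1) K(3) \<eta>(1) by (intro prob_INT_gt Z(1))
  then have pK': "prob K' > 1 - \<tau>" using \<eta>(2) by linarith
  have \<delta>': "\<delta>' > 0" unfolding \<delta>'_def using K(2) Z(1) by (subst Min_gr_iff) auto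
  have le: "mean_dist T v b k x y \<le> \<epsilon>" if x: "x \<in> K'" and y: "y \<in> K'" and xy: "dist x y < \<delta>'" and k: "k \<ge> 1" for x y k
  proof -
    define n where "n = real (card (strip_upto v b k :: 'n lattice set))"
    have pt: "dist a c \<le> \<epsilon> / 2 + M * (\<Sum>z\<in>Z. \<bar>indicat_real (ball z (\<epsilon> / 4)) a - indicat_real (ball z (\<epsilon> / 4)) c\<bar>)"
      (is "_ \<le> _ + M * ?S") for a c :: 'a
    proof (cases "\<exists>z\<in>Z. a \<in> ball z (\<epsilon> / 4) \<and> c \<in> ball z (\<epsilon> / 4)")
      case True
      then obtain z where "dist z a < \<epsilon> / 4" "dist z c < \<epsilon> / 4" by auto
      then have "dist a c \<le> \<epsilon> / 2" using dist_triangle3[of a c z] by linarith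
      moreover have "0 \<le> M * ?S" using M(1) by (simp add: sum_nonneg)
      ultimately show ?thesis by linarith
    next
      case False
      obtain z where z: "z \<in> Z" "a \<in> ball z (\<epsilon> / 4)" using Z(2) by blast
      then have "\<bar>indicat_real (ball z (\<epsilon> / 4)) a - indicat_real (ball z (\<epsilon> / 4)) c\<bar> = 1"
        using False by (auto simp: indicator_def)
      then have "1 \<le> ?S"
        using member_le_sum[OF z(1), of "\<lambda>z. \<bar>indicat_real (ball z (\<epsilon> / 4)) a - indicat_real (ball z (\<epsilon> / 4)) c\<bar>"] Z(1)
        by simp
      then have "M * 1 \<le> M * ?S" using M(1) by (intro mult_left_mono) auto
      then show ?thesis using M(2)[of a c] \<epsilon> by simp
    qed
    have "(\<Sum>w\<in>strip_upto v b k. dist (T w x) (T w y)) \<le>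
      (\<Sum>w\<in>strip_upto v b k. \<epsilon> / 2 + M * (\<Sum>z\<in>Z. \<bar>indicat_real (ball z (\<epsilon> / 4)) (T w x) - indicat_real (ball z (\<epsilon> / 4)) (T w y)\<bar>))"
      by (intro sum_mono pt)
    also have "\<dots> = \<epsilon> / 2 * n + M * (\<Sum>z\<in>Z. ?osc z k x y)"
      by (subst sum.swap) (simp add: sum.distrib n_def sum_distrib_left)
    finally have "(\<Sum>w\<in>strip_upto v b k. dist (T w x) (T w y)) \<le> \<epsilon> / 2 * n + M * (\<Sum>z\<in>Z. ?osc z k x y)" .
    moreover have "(\<Sum>z\<in>Z. ?osc z k x y) \<le> (\<Sum>z\<in>Z. \<eta> * n)"
    proof (intro sum_mono)
      fix z assume z: "z \<in> Z"
      have "\<delta>' \<le> \<delta> z" unfolding \<delta>'_def using z Z(1) by (intro Min_le) auto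
      then show "?osc z k x y \<le> \<eta> * n"
        unfolding n_def using x y z xy by (intro K(4)) (auto simp: K'_def)
    qed
    then have "M * (\<Sum>z\<in>Z. ?osc z k x y) \<le> M * (\<Sum>z\<in>Z. \<eta> * n)"
      using M(1) by (intro mult_left_mono) simp_all
    moreover have "M * (\<Sum>z\<in>Z. \<eta> * n) = M * (real (card Z) * \<eta>) * n" by simp
    moreover have "M * (real (card Z) * \<eta>) * n \<le> \<epsilon> / 2 * n"
      using \<eta>(3) by (intro mult_right_mono) (simp_all add: n_def)
    ultimately have "(\<Sum>w\<in>strip_upto v b k. dist (T w x) (T w y)) \<le> \<epsilon> / 2 * n + \<epsilon> / 2 * n" by linarith
    then have "n * mean_dist T v b k x y \<le> n * \<epsilon>"
      unfolding sum_dist_eq_mean_dist[OF b k] n_def by (simp add: mult.commute)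
    moreover have "strip_upto v b k \<noteq> {}" using zero_in_strip_upto[OF b k, of v] by blast
    then have "n > 0" unfolding n_def using finite_strip_upto[of v b k] by (simp add: card_gt_0_iff)
    ultimately show ?thesis by (simp only: mult_le_cancel_left_pos)
  qed
  show ?thesis
    by (intro bexI[OF _ K'm] exI[of _ \<delta>'] conjI \<delta>' pK' ballI impI allI) (rule le)
qed

section \<open>Implications among equicontinuity and complexity\<close>

lemma max_mean_dist_less_iff:
  assumes "k \<ge> 1"
  shows "max_mean_dist T v b k x y < e \<longleftrightarrow> (\<forall>i\<in>{1..k}. mean_dist T v b i x y < e)"
  unfolding max_mean_dist_def using assms by (subst Max_less_iff) auto

lemma mean_dist_le_max_mean_dist:
  assumes "k \<ge> 1"
  shows "mean_dist T v b k x y \<le> max_mean_dist T v b k x y"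
  unfolding max_mean_dist_def using assms by (intro Max_ge) auto

text \<open>The set in \<open>mean_dist_lusin\<close> depends on the precision, so the sets for
  \<open>1 / Suc m\<close> are intersected; the geometric losses add up to
  \<open>\<tau> / 2\<close>. Passing to the maximum is free because the bound there holds for every
  \<open>k\<close>.\<close>

lemma discrete_spectrum_imp_measure_equicontinuous_in_the_mean:
  assumes ds: "discrete_spectrum \<mu> T v" and b: "b \<in> pos_vectors"
  shows "measure_equicontinuous_in_the_mean \<mu> T v b"
  unfolding measure_equicontinuous_in_the_mean_def
proof (intro allI impI)
  fix \<tau> :: real assume \<tau>: "\<tau> > 0"
  have "\<forall>m. \<exists>K \<delta>. K \<in> sets borel \<and> \<delta> > 0 \<and> prob K > 1 - \<tau> * (1/2)^m / 4 \<and>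
    (\<forall>x\<in>K. \<forall>y\<in>K. dist x y < \<delta> \<longrightarrow> (\<forall>k\<ge>1. mean_dist T v b k x y \<le> 1 / real (Suc m)))"
  proof
    fix m
    show "\<exists>K \<delta>. K \<in> sets borel \<and> \<delta> > 0 \<and> prob K > 1 - \<tau> * (1/2)^m / 4 \<and>
      (\<forall>x\<in>K. \<forall>y\<in>K. dist x y < \<delta> \<longrightarrow> (\<forall>k\<ge>1. mean_dist T v b k x y \<le> 1 / real (Suc m)))"
      using mean_dist_lusin[OF ds b, of "1 / real (Suc m)" "\<tau> * (1/2)^m / 4"] \<tau> by auto
  qed
  then obtain K \<delta> where Km: "\<And>m. K m \<in> sets borel" and \<delta>: "\<And>m::nat. \<delta> m > 0"
    and pK: "\<And>m. prob (K m) > 1 - \<tau> * (1/2)^m / 4"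
    and eq: "\<And>m x y k. x \<in> K m \<Longrightarrow> y \<in> K m \<Longrightarrow> dist x y < \<delta> m \<Longrightarrow> k \<ge> 1 \<Longrightarrow> mean_dist T v b k x y \<le> 1 / real (Suc m)"
    by metis
  define K' where "K' = (\<Inter>m. K m)"
  have K'm: "K' \<in> sets borel" unfolding K'_def using Km by (intro sets.countable_INT'') auto
  have s: "(\<lambda>m. \<tau> * (1/2)^m / 4) sums (\<tau> / 2)"
    using sums_mult[OF geometric_sums[of "1/2::real"], of "\<tau> / 4"] by simp
  have pc: "prob (- K m) \<le> \<tau> * (1/2)^m / 4" for m
    using prob_compl[of "K m"] pK[of m] Km[of m] by (simp add: Compl_eq_Diff_UNIV sets_eq_borel)
  have sm: "summable (\<lambda>m. prob (- K m))"
    by (rule summable_comparison_test[OF _ sums_summable[OF s]]) (use pc in auto)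
  have "prob (- K') \<le> (\<Sum>m. prob (- K m))"
    unfolding K'_def Compl_INT using sm Km
    by (intro finite_measure_subadditive_countably) (auto simp: sets_eq_borel)
  also have "\<dots> \<le> (\<Sum>m. \<tau> * (1/2)^m / 4)"
    using pc by (intro suminf_le sm sums_summable[OF s])
  also have "\<dots> = \<tau> / 2" using s by (simp add: sums_iff)
  finally have "prob K' > 1 - \<tau>"
    using prob_compl[of K'] K'm \<tau> by (simp add: Compl_eq_Diff_UNIV sets_eq_borel)
  moreover have "equicontinuous_in_the_mean_on T v b K'"
    unfolding equicontinuous_in_the_mean_on_def
  proof (intro allI impI)
    fix \<epsilon> :: real assume "\<epsilon> > 0"
    then obtain m where m: "1 / real (Suc m) < \<epsilon>" using nat_approx_posE by blast
    have "max_mean_dist T v b k x y < \<epsilon>" if xy: "x \<in> K'" "y \<in> K'" "dist x y < \<delta> m" and k: "k \<ge> 1" for k x y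
      unfolding max_mean_dist_less_iff[OF k]
    proof
      fix i assume "i \<in> {1..k}"
      then have "mean_dist T v b i x y \<le> 1 / real (Suc m)"
        using xy by (intro eq) (auto simp: K'_def)
      then show "mean_dist T v b i x y < \<epsilon>" using m by linarith
    qed
    then show "\<exists>\<delta>>0. \<forall>k\<ge>1. \<forall>x\<in>K'. \<forall>y\<in>K'. dist x y < \<delta> \<longrightarrow> max_mean_dist T v b k x y < \<epsilon>"
      using \<delta>[of m] by blast
  qed
  ultimately show "\<exists>K\<in>sets borel. prob K > 1 - \<tau> \<and> equicontinuous_in_the_mean_on T v b K"
    using K'm by blast
qed

text \<open>The centres must lie in \<open>K\<close> itself, since equicontinuity on
  \<open>K\<close> compares only points of \<open>K\<close>.\<close>

lemma finite_net:
  assumes "\<delta> > 0"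
  shows "\<exists>F. finite F \<and> F \<subseteq> K \<and> (\<forall>y\<in>K. \<exists>x\<in>F. dist x (y :: 'a) < \<delta>)"
proof -
  obtain Z where Z: "finite Z" "(UNIV :: 'a set) \<subseteq> (\<Union>z\<in>Z. ball z (\<delta> / 2))"
    using compactE_image[OF compact_UNIV, of UNIV "\<lambda>z. ball z (\<delta> / 2)"] assms
    by (metis UNIV_I UN_I centre_in_ball open_ball subsetI half_gt_zero)
  define s where "s z = (SOME x. x \<in> K \<inter> ball z (\<delta> / 2))" for z
  define F where "F = s ` {z \<in> Z. K \<inter> ball z (\<delta> / 2) \<noteq> {}}"
  have s: "s z \<in> K \<inter> ball z (\<delta> / 2)" if "K \<inter> ball z (\<delta> / 2) \<noteq> {}" for z
    unfolding s_def using that by (intro some_in_eq[THEN iffD2])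
  have "\<exists>x\<in>F. dist x y < \<delta>" if y: "y \<in> K" for y
  proof -
    obtain z where z: "z \<in> Z" "y \<in> ball z (\<delta> / 2)" using Z(2) by blast
    then have ne: "K \<inter> ball z (\<delta> / 2) \<noteq> {}" using y by blast
    have "dist (s z) y < \<delta>"
      using s[OF ne] z(2) dist_triangle3[of "s z" y z] by simp
    then show ?thesis using z(1) ne unfolding F_def by blast
  qed
  moreover have "finite F" "F \<subseteq> K" unfolding F_def using Z(1) s by auto
  ultimately show ?thesis by blast
qed

lemma measure_equicontinuous_in_the_mean_imp_mean_equicontinuous:
  assumes "measure_equicontinuous_in_the_mean \<mu> T v b"
  shows "measure_mean_equicontinuous \<mu> T v b"
proof -
  have "mean_equicontinuous_on T v b K" if eq: "equicontinuous_in_the_mean_on T v b K" for K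
    unfolding mean_equicontinuous_on_def
  proof (intro allI impI)
    fix \<epsilon> :: real assume \<epsilon>: "\<epsilon> > 0"
    \<comment> \<open>Half of \<open>\<epsilon>\<close> is used since a limsup preserves only weak
      inequalities.\<close>
    obtain \<delta> where \<delta>: "\<delta> > 0"
      "\<And>k x y. k \<ge> 1 \<Longrightarrow> x \<in> K \<Longrightarrow> y \<in> K \<Longrightarrow> dist x y < \<delta> \<Longrightarrow> max_mean_dist T v b k x y < \<epsilon> / 2"
      using eq half_gt_zero[OF \<epsilon>] unfolding equicontinuous_in_the_mean_on_def by meson
    have "limsup (\<lambda>k. ereal (mean_dist T v b k x y)) < ereal \<epsilon>"
      if "x \<in> K" "y \<in> K" "dist x y < \<delta>" for x y
    proof -
      have "limsup (\<lambda>k. ereal (mean_dist T v b k x y)) \<le> ereal (\<epsilon> / 2)"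
      proof (intro Limsup_bounded eventually_sequentiallyI[of 1])
        fix k :: nat assume k: "1 \<le> k"
        show "ereal (mean_dist T v b k x y) \<le> ereal (\<epsilon> / 2)"
          using mean_dist_le_max_mean_dist[OF k, of v b x y] \<delta>(2)[OF k that] by simp
      qed
      also have "\<dots> < ereal \<epsilon>" using \<epsilon> by simp
      finally show ?thesis .
    qed
    then show "\<exists>\<delta>>0. \<forall>x\<in>K. \<forall>y\<in>K. dist x y < \<delta> \<longrightarrow>
        limsup (\<lambda>k. ereal (mean_dist T v b k x y)) < ereal \<epsilon>" using \<delta>(1) by blast
  qed
  then show ?thesis
    using assms unfolding measure_equicontinuous_in_the_mean_def measure_mean_equicontinuous_def by blast
qed

lemma measure_equicontinuous_in_the_mean_imp_bounded_complexity:
  assumes eq: "measure_equicontinuous_in_the_mean \<mu> T v b"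
  shows "bounded_complexity \<mu> (max_mean_dist T v b)"
  unfolding bounded_complexity_def
proof (intro allI impI)
  fix \<epsilon> :: real assume \<epsilon>: "\<epsilon> > 0"
  obtain K where K: "K \<in> sets borel" "prob K > 1 - \<epsilon>" "equicontinuous_in_the_mean_on T v b K"
    using eq \<epsilon> unfolding measure_equicontinuous_in_the_mean_def by blast
  obtain \<delta> where \<delta>: "\<delta> > 0"
    "\<And>k x y. k \<ge> 1 \<Longrightarrow> x \<in> K \<Longrightarrow> y \<in> K \<Longrightarrow> dist x y < \<delta> \<Longrightarrow> max_mean_dist T v b k x y < \<epsilon>"
    using K(3) \<epsilon> unfolding equicontinuous_in_the_mean_on_def by meson
  obtain F where F: "finite F" "F \<subseteq> K" "\<And>y. y \<in> K \<Longrightarrow> \<exists>x\<in>F. dist x y < \<delta>"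
    using finite_net[OF \<delta>(1), of K] by blast
  have "prob (\<Union>x\<in>F. {y. max_mean_dist T v b k x y < \<epsilon>}) > 1 - \<epsilon>" if k: "k \<ge> 1" for k
  proof -
    have "{y. max_mean_dist T v b k x y < \<epsilon>} = (\<Inter>i\<in>{1..k}. {y. mean_dist T v b i x y < \<epsilon>})" for x
      using max_mean_dist_less_iff[OF k, of v b x _ \<epsilon>] by auto
    then have "open {y. max_mean_dist T v b k x y < \<epsilon>}" for x
      by (simp only:) (intro open_INT finite_atLeastAtMost ballI open_mean_dist_ball)
    then have "(\<Union>x\<in>F. {y. max_mean_dist T v b k x y < \<epsilon>}) \<in> sets \<mu>"
      unfolding sets_eq_borel by (intro borel_open open_UN ballI)
    moreover have "K \<subseteq> (\<Union>x\<in>F. {y. max_mean_dist T v b k x y < \<epsilon>})"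
      using F(2,3) \<delta>(2)[OF k] by blast
    ultimately have "prob K \<le> prob (\<Union>x\<in>F. {y. max_mean_dist T v b k x y < \<epsilon>})"
      by (intro finite_measure_mono)
    then show ?thesis using K(2) by simp
  qed
  \<comment> \<open>One net serves every \<open>k\<close>. The successor is taken because
    \<open>C\<close> must be positive, while the net may be empty.\<close>
  then show "\<exists>C>0. \<forall>k\<ge>1. \<exists>F. finite F \<and> card F \<le> C \<and>
      prob (\<Union>x\<in>F. {y. max_mean_dist T v b k x y < \<epsilon>}) > 1 - \<epsilon>"
    using F(1) by (intro exI[of _ "Suc (card F)"]) (auto intro!: exI[of _ F])
qed

lemma bounded_complexity_max_imp_mean:
  assumes bc: "bounded_complexity \<mu> (max_mean_dist T v b)"
  shows "bounded_complexity \<mu> (mean_dist T v b)"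
  unfolding bounded_complexity_def
proof (intro allI impI)
  fix \<epsilon> :: real assume "\<epsilon> > 0"
  then obtain C :: nat where C: "C > 0" "\<And>k. k \<ge> 1 \<Longrightarrow> \<exists>F. finite F \<and> card F \<le> C \<and>
      prob (\<Union>x\<in>F. {y. max_mean_dist T v b k x y < \<epsilon>}) > 1 - \<epsilon>"
    using bc unfolding bounded_complexity_def by meson
  have "\<exists>F. finite F \<and> card F \<le> C \<and> prob (\<Union>x\<in>F. {y. mean_dist T v b k x y < \<epsilon>}) > 1 - \<epsilon>"
    if k: "k \<ge> 1" for k
  proof -
    obtain F where F: "finite F" "card F \<le> C" "prob (\<Union>x\<in>F. {y. max_mean_dist T v b k x y < \<epsilon>}) > 1 - \<epsilon>"
      using C(2)[OF k] by blast
    have "prob (\<Union>x\<in>F. {y. max_mean_dist T v b k x y < \<epsilon>}) \<le> prob (\<Union>x\<in>F. {y. mean_dist T v b k x y < \<epsilon>})"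
    proof (rule finite_measure_mono)
      show "(\<Union>x\<in>F. {y. max_mean_dist T v b k x y < \<epsilon>}) \<subseteq> (\<Union>x\<in>F. {y. mean_dist T v b k x y < \<epsilon>})"
        using le_less_trans[OF mean_dist_le_max_mean_dist[OF k]] by blast
      show "(\<Union>x\<in>F. {y. mean_dist T v b k x y < \<epsilon>}) \<in> sets \<mu>"
        unfolding sets_eq_borel by (intro borel_open open_UN ballI open_mean_dist_ball)
    qed
    then show ?thesis using F by (intro exI[of _ F]) auto
  qed
  then show "\<exists>C>0. \<forall>k\<ge>1. \<exists>F. finite F \<and> card F \<le> C \<and>
      prob (\<Union>x\<in>F. {y. mean_dist T v b k x y < \<epsilon>}) > 1 - \<epsilon>" using C(1) by blast
qed

text \<open>The limsup bound takes effect from a time that depends on the point. Continuity of the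
  measure makes it uniform on most of \<open>K\<close>, and the finitely many remaining
  \<open>k\<close> are covered by compactness of the space.\<close>

lemma measure_mean_equicontinuous_imp_bounded_complexity:
  assumes eq: "measure_mean_equicontinuous \<mu> T v b"
  shows "bounded_complexity \<mu> (mean_dist T v b)"
  unfolding bounded_complexity_def
proof (intro allI impI)
  fix \<epsilon> :: real assume \<epsilon>: "\<epsilon> > 0"
  let ?B = "\<lambda>k x. {y. mean_dist T v b k x y < \<epsilon>}"
  obtain K where K: "K \<in> sets borel" "prob K > 1 - \<epsilon>" "mean_equicontinuous_on T v b K"
    using eq \<epsilon> unfolding measure_mean_equicontinuous_def by blast
  obtain \<delta> where \<delta>: "\<delta> > 0" "\<And>x y. x \<in> K \<Longrightarrow> y \<in> K \<Longrightarrow> dist x y < \<delta> \<Longrightarrow>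
      limsup (\<lambda>k. ereal (mean_dist T v b k x y)) < ereal \<epsilon>"
    using K(3) \<epsilon> unfolding mean_equicontinuous_on_def by meson
  obtain F where F: "finite F" "F \<subseteq> K" "\<And>y. y \<in> K \<Longrightarrow> \<exists>x\<in>F. dist x y < \<delta>"
    using finite_net[OF \<delta>(1), of K] by blast
  have Bo: "?B k x \<in> sets borel" for k x by (intro borel_open open_mean_dist_ball)
  define L where "L N = K \<inter> (\<Union>x\<in>F. \<Inter>k\<in>{N..}. ?B k x)" for N
  have Lm: "L N \<in> sets borel" for N
    unfolding L_def using Bo
    by (intro sets.Int K(1) sets.finite_UN F(1) sets.countable_INT'') auto
  have "incseq L"
  proof (rule incseq_SucI)
    fix N
    show "L N \<subseteq> L (Suc N)"
      unfolding L_def by (intro Int_mono UN_mono INT_anti_mono order_refl) simp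
  qed
  moreover have "(\<Union>N. L N) = K"
  proof (intro equalityI subsetI)
    fix y assume y: "y \<in> K"
    then obtain x where x: "x \<in> F" "dist x y < \<delta>" using F(3) by blast
    then have "limsup (\<lambda>k. ereal (mean_dist T v b k x y)) < ereal \<epsilon>" using F(2) y by (intro \<delta>(2)) auto
    then have "\<forall>\<^sub>F k in sequentially. ereal (mean_dist T v b k x y) < ereal \<epsilon>" by (rule Limsup_lessD)
    then obtain N where "\<And>k. k \<ge> N \<Longrightarrow> mean_dist T v b k x y < \<epsilon>" by (auto simp: eventually_sequentially)
    then have "y \<in> L N" unfolding L_def using x(1) y by auto
    then show "y \<in> (\<Union>N. L N)" by blast
  qed (auto simp: L_def)
  ultimately have "(\<lambda>N. prob (L N)) \<longlonglongrightarrow> prob K"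
    using finite_Lim_measure_incseq[of L] Lm by (simp add: sets_eq_borel image_subset_iff)
  then have "eventually (\<lambda>N. prob (L N) > 1 - \<epsilon>) sequentially"
    using K(2) by (intro order_tendstoD(1))
  then obtain N where N: "prob (L N) > 1 - \<epsilon>" by (auto simp: eventually_sequentially)
  have "\<exists>G. finite G \<and> (UNIV :: 'a set) \<subseteq> (\<Union>x\<in>G. ?B k x)" for k
  proof -
    have "UNIV \<subseteq> (\<Union>x\<in>UNIV. ?B k x)" using \<epsilon> by (auto simp: mean_dist_def)
    from compactE_image[OF compact_UNIV open_mean_dist_ball this] show ?thesis by metis
  qed
  then obtain G where G: "\<And>k. finite (G k)" "\<And>k. (UNIV :: 'a set) \<subseteq> (\<Union>x\<in>G k. ?B k x)" by metis
  define C where "C = Suc (card F + (\<Sum>k<N. card (G k)))"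
  have "\<exists>F. finite F \<and> card F \<le> C \<and> prob (\<Union>x\<in>F. ?B k x) > 1 - \<epsilon>" for k
  proof (cases "k < N")
    case True
    then have "card (G k) \<le> (\<Sum>k<N. card (G k))" by (intro member_le_sum) auto
    moreover have "(\<Union>x\<in>G k. ?B k x) = UNIV" using G(2)[of k] by blast
    then have "prob (\<Union>x\<in>G k. ?B k x) > 1 - \<epsilon>" using \<epsilon> prob_space by simp
    ultimately show ?thesis using G(1) by (intro exI[of _ "G k"]) (simp add: C_def)
  next
    case False
    have "L N \<subseteq> (\<Union>x\<in>F. ?B k x)" using False unfolding L_def by auto
    moreover have "(\<Union>x\<in>F. ?B k x) \<in> sets \<mu>" unfolding sets_eq_borel using Bo F(1) by blast
    ultimately have "prob (L N) \<le> prob (\<Union>x\<in>F. ?B k x)" by (rule finite_measure_mono)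
    then show ?thesis using N F(1) by (intro exI[of _ F]) (simp add: C_def)
  qed
  moreover have "C > 0" by (simp add: C_def)
  ultimately show "\<exists>C>0. \<forall>k\<ge>1. \<exists>F. finite F \<and> card F \<le> C \<and> prob (\<Union>x\<in>F. ?B k x) > 1 - \<epsilon>"
    by blast
qed

lemma bounded_complexity_imp_discrete_spectrum:
  assumes "b \<in> pos_vectors" "bounded_complexity \<mu> (mean_dist T v b)"
  shows "discrete_spectrum \<mu> T v"
proof -
  have "kronecker_algebra_strip \<mu> T v b = sets borel"
    using bounded_complexity_imp_kronecker[OF assms] mem_kronecker_algebra_strip_iff by blast
  then show ?thesis
    unfolding discrete_spectrum_def using kronecker_algebra_strip_eq[OF tds inv assms(1)] by simp
qed

end

theorem theoremA4:
  fixes T :: "int \<times> (int ^ 'n::finite) \<Rightarrow> 'a::metric_space \<Rightarrow> 'a"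
    and \<mu> :: "'a measure"
    and v :: "real \<times> (real ^ 'n)"
  assumes "is_tds T"
    and "\<mu> \<in> invariant_measures T"
    and "fst v = 1"
  shows "((\<exists>b\<in>pos_vectors. bounded_complexity \<mu> (max_mean_dist T v b)) \<longleftrightarrow> discrete_spectrum \<mu> T v) \<and>
         ((\<forall>b\<in>pos_vectors. bounded_complexity \<mu> (max_mean_dist T v b)) \<longleftrightarrow> discrete_spectrum \<mu> T v) \<and>
         ((\<exists>b\<in>pos_vectors. bounded_complexity \<mu> (mean_dist T v b)) \<longleftrightarrow> discrete_spectrum \<mu> T v) \<and>
         ((\<forall>b\<in>pos_vectors. bounded_complexity \<mu> (mean_dist T v b)) \<longleftrightarrow> discrete_spectrum \<mu> T v) \<and>
         ((\<exists>b\<in>pos_vectors. measure_equicontinuous_in_the_mean \<mu> T v b) \<longleftrightarrow> discrete_spectrum \<mu> T v) \<and>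
         ((\<forall>b\<in>pos_vectors. measure_equicontinuous_in_the_mean \<mu> T v b) \<longleftrightarrow> discrete_spectrum \<mu> T v) \<and>
         ((\<exists>b\<in>pos_vectors. measure_mean_equicontinuous \<mu> T v b) \<longleftrightarrow> discrete_spectrum \<mu> T v) \<and>
         ((\<forall>b\<in>pos_vectors. measure_mean_equicontinuous \<mu> T v b) \<longleftrightarrow> discrete_spectrum \<mu> T v)"
proof -
  interpret invariant_system T \<mu> using assms by unfold_locales
  \<comment> \<open>For fixed \<open>b\<close> the implications form two cycles through discrete
    spectrum, one by way of the maximal means and one by way of the limsup condition.\<close>
  have mean: "bounded_complexity \<mu> (mean_dist T v b) \<longleftrightarrow> discrete_spectrum \<mu> T v"
    and max: "bounded_complexity \<mu> (max_mean_dist T v b) \<longleftrightarrow> discrete_spectrum \<mu> T v"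
    and em: "measure_equicontinuous_in_the_mean \<mu> T v b \<longleftrightarrow> discrete_spectrum \<mu> T v"
    and me: "measure_mean_equicontinuous \<mu> T v b \<longleftrightarrow> discrete_spectrum \<mu> T v"
    if b: "b \<in> pos_vectors" for b
    using discrete_spectrum_imp_measure_equicontinuous_in_the_mean[OF _ b, of v]
      measure_equicontinuous_in_the_mean_imp_mean_equicontinuous[of v b]
      measure_equicontinuous_in_the_mean_imp_bounded_complexity[of v b]
      bounded_complexity_max_imp_mean[of v b]
      measure_mean_equicontinuous_imp_bounded_complexity[of v b]
      bounded_complexity_imp_discrete_spectrum[OF b, of v]
    by blast+
  \<comment> \<open>A positive width exists, so the versions for every \<open>b\<close> are not
    vacuous.\<close>
  have "(\<chi> i. 1) \<in> (pos_vectors :: (real ^ 'n) set)" by (simp add: pos_vectors_def)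
  then show ?thesis by (simp add: mean max em me) blast
qed

end
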